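(* Let $L_{np8}$ be the class-2 nilpotent Lie ring of rank $8$ $$L_{np8}=\left\langle x_1,x_2,x_3,x_4,x_5,y_1,y_2,y_3\ \middle|\ [x_1,x_4]=[x_2,x_5]=y_1,\ 2[x_1,x_5]=[x_3,x_4]=2y_2,\ [x_2,x_4]=[x_3,x_5]=y_3\right\rangle.$$ Then for every prime $p\geq3$, $$\zeta_{L_{np8}(\mathbb{F}_p)}^{\triangleleft}(s)=\zeta_{\mathbb{F}_p^5}(s)+p^3|N(\mathbb{F}_p)|\,t^3+p^2\binom{3}{1}_p|N(\mathbb{F}_p)|\,t^4+\left(p+2p^2+p^3\left(1+|N(\mathbb{F}_p)|\right)\right)t^5$$ $$\qquad+\left(1+p+p^2\left(1+|N(\mathbb{F}_p)|\right)\right)t^6+\binom{3}{1}_p t^7+t^8,$$ where $$|N(\mathbb{F}_p)|=\begin{cases}3 & p\equiv1\bmod 3\text{ and }p=a^2+27b^2,\\ 0 & p\equiv1\bmod3\text{ and }p\neq a^2+27b^2,\\ 1 & p\equiv2\bmod3,\end{cases}$$ is the number of roots of $N: x^3-2=0$ over $\mathbb{F}_p$ (here "$p=a^2+27b^2$" means that $p$ has this form for some integers $a,b$, and "$p\neq a^2+27b^2$" that it does not). In particular, $\zeta_{L_{np8}(\mathbb{F}_p)}^{\triangleleft}(s)$ is non-PORC.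
   Context: A presentation of a Lie ring lists a $\mathbb{Z}$-module basis together with relations for brackets of basis elements; all brackets not listed are zero, up to antisymmetry. For a Lie ring $L\cong\mathbb{Z}^n$ (additively) and a prime $p$, $L(\mathbb{F}_p)=L\otimes_{\mathbb{Z}}\mathbb{F}_p$, and $\zeta_{L(\mathbb{F}_p)}^{\triangleleft}(s)=\sum_{i=0}^{n}a_{p^i}^{\triangleleft}(L(\mathbb{F}_p))\,t^{i}$, where $t=p^{-s}$, $s$ is a complex variable, and $a_{p^i}^{\triangleleft}(L(\mathbb{F}_p))$ is the number of Lie ideals of $L(\mathbb{F}_p)$ of codimension $i$. $\binom{m}{i}_p$ denotes the Gaussian binomial coefficient (the number of $i$-dimensional subspaces of $\mathbb{F}_p^m$), and $\zeta_{\mathbb{F}_p^m}(s)=\sum_{i=0}^m\binom{m}{i}_p t^i$. The zeta function $\zeta_{L(\mathbb{F}_p)}^{\triangleleft}(s)$ is called PORC (polynomial on residue classes) if there exist a fixed integer $M$ and finitely many polynomials $W_i(X,Y)\in\mathbb{Q}[X,Y]$, for $i\in\{1,\ldots,M-1\}$, such that for almost all primes $p$, if $p\equiv i\bmod M$ then $\zeta_{L(\mathbb{F}_p)}^{\triangleleft}(s)=W_i(p,p^{-s})$; it is non-PORC if there is no such $M$.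
   Formalization: In the t^5 coefficient, 2p^2 is replaced by p^2(1+|N(F_p)|): the printed value fails whenever |N(F_p)| is not 1 (for p=7 the full coefficient is 400, not 449); both agree when |N(F_p)|=1. PORC takes M at least 2, since M=1 would be vacuous. *)

theory Defs
  imports
    "HOL-Analysis.Analysis"
    "HOL-Number_Theory.Residues"
    "Jordan_Normal_Form.Missing_VectorSpace"
begin

section \<open>Vector spaces over the prime field\<close>

abbreviation Fp :: "nat \<Rightarrow> int ring" where
  "Fp p \<equiv> residue_ring (int p)"

definition Fp_subspaces :: "nat \<Rightarrow> (int, 'v) module \<Rightarrow> nat \<Rightarrow> 'v set set" where
  "Fp_subspaces p V i =
     {W. VectorSpace.subspace (Fp p) W V \<and> vectorspace.dim (Fp p) (V\<lparr>carrier := W\<rparr>) = i}"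

text \<open>The space of row vectors of length \<open>m\<close>. Only the additive group and the scalar action
  of the record matter; the remaining ring fields are irrelevant.\<close>

definition Fp_power :: "nat \<Rightarrow> nat \<Rightarrow> (int, nat \<Rightarrow> int) module" where
  "Fp_power p m =
     \<lparr>carrier = ({..<m} \<rightarrow>\<^sub>E carrier (Fp p)),
      monoid.mult = undefined,
      one = undefined,
      zero = (\<lambda>i\<in>{..<m}. \<zero>\<^bsub>Fp p\<^esub>),
      add = (\<lambda>u v. \<lambda>i\<in>{..<m}. u i \<oplus>\<^bsub>Fp p\<^esub> v i),
      smult = (\<lambda>k u. \<lambda>i\<in>{..<m}. k \<otimes>\<^bsub>Fp p\<^esub> u i)\<rparr>"

definition gauss_binomial :: "nat \<Rightarrow> nat \<Rightarrow> nat \<Rightarrow> nat" where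
  "gauss_binomial p m i = card (Fp_subspaces p (Fp_power p m) i)"

definition zeta_Fp_power :: "nat \<Rightarrow> nat \<Rightarrow> complex \<Rightarrow> complex" where
  "zeta_Fp_power p m s =
     (\<Sum>i\<le>m. of_nat (gauss_binomial p m i) * (of_nat p powr (- s)) ^ i)"

section \<open>Lie rings and their ideal zeta functions\<close>

locale lie_ring = Modules.module zmul
  for zmul :: "int \<Rightarrow> 'a::ab_group_add \<Rightarrow> 'a" +
  fixes br :: "'a \<Rightarrow> 'a \<Rightarrow> 'a"
  assumes br_add_left: "br (u + v) w = br u w + br v w"
    and br_add_right: "br u (v + w) = br u v + br u w"
    and br_self: "br u u = 0"
    and jacobi: "br u (br v w) + br v (br w u) + br w (br u v) = 0"

text \<open>The tensor product of \<open>L\<close> with the prime field is realised as the quotient \<open>L / pL\<close>: its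
  elements are the cosets \<open>u + pL\<close>, and the class of \<open>u\<close> stands for the pure tensor of \<open>u\<close>
  with 1. The \<open>mult\<close> field of the record carries the Lie bracket (so it is neither
  associative nor unital, and the \<open>one\<close> field is irrelevant).\<close>

definition pcoset :: "(int \<Rightarrow> 'a \<Rightarrow> 'a) \<Rightarrow> nat \<Rightarrow> 'a::ab_group_add \<Rightarrow> 'a set" where
  "pcoset zmul p u = {u + zmul (int p) w | w. True}"

definition lie_mod ::
  "(int \<Rightarrow> 'a \<Rightarrow> 'a) \<Rightarrow> ('a \<Rightarrow> 'a \<Rightarrow> 'a) \<Rightarrow> nat \<Rightarrow> (int, 'a::ab_group_add set) module" where
  "lie_mod zmul br p =
     \<lparr>carrier = range (pcoset zmul p),
      monoid.mult = (\<lambda>A B. \<Union>u\<in>A. \<Union>v\<in>B. pcoset zmul p (br u v)),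
      one = undefined,
      zero = pcoset zmul p 0,
      add = (\<lambda>A B. \<Union>u\<in>A. \<Union>v\<in>B. pcoset zmul p (u + v)),
      smult = (\<lambda>k A. \<Union>u\<in>A. pcoset zmul p (zmul k u))\<rparr>"

definition lie_ideal :: "nat \<Rightarrow> (int, 'v) module \<Rightarrow> 'v set \<Rightarrow> bool" where
  "lie_ideal p A I \<longleftrightarrow>
     VectorSpace.subspace (Fp p) I A \<and>
     (\<forall>u\<in>I. \<forall>v\<in>carrier A. u \<otimes>\<^bsub>A\<^esub> v \<in> I \<and> v \<otimes>\<^bsub>A\<^esub> u \<in> I)"

definition ideals_of_codim :: "nat \<Rightarrow> (int, 'v) module \<Rightarrow> nat \<Rightarrow> 'v set set" where
  "ideals_of_codim p A i =
     {I. lie_ideal p A I \<and>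
         vectorspace.dim (Fp p) (A\<lparr>carrier := I\<rparr>) + i = vectorspace.dim (Fp p) A}"

text \<open>The parameter \<open>n\<close> is the rank of \<open>L\<close> as a free abelian group.\<close>

definition ideal_zeta ::
  "(int \<Rightarrow> 'a \<Rightarrow> 'a) \<Rightarrow> ('a \<Rightarrow> 'a \<Rightarrow> 'a::ab_group_add) \<Rightarrow> nat \<Rightarrow> nat \<Rightarrow> complex \<Rightarrow> complex" where
  "ideal_zeta zmul br n p s =
     (\<Sum>i\<le>n. of_nat (card (ideals_of_codim p (lie_mod zmul br p) i)) * (of_nat p powr (- s)) ^ i)"

section \<open>Polynomiality on residue classes\<close>

text \<open>A polynomial in \<open>X\<close> and \<open>Y\<close> is a polynomial in \<open>Y\<close> with coefficients in the rational
  polynomials in \<open>X\<close>.\<close>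

definition eval2 :: "rat poly poly \<Rightarrow> complex \<Rightarrow> complex \<Rightarrow> complex" where
  "eval2 W a b = poly (map_poly (\<lambda>c. poly (map_poly of_rat c) a) W) b"

text \<open>The modulus is required to be at least 2: for \<open>M = 1\<close> the index range \<open>{1..M-1}\<close> is empty
  and the condition would hold for every function. The residue class 0 contains at most one
  prime and is absorbed by the finite exceptional set.\<close>

definition PORC :: "(nat \<Rightarrow> complex \<Rightarrow> complex) \<Rightarrow> bool" where
  "PORC Z \<longleftrightarrow>
     (\<exists>M\<ge>2. \<exists>W :: nat \<Rightarrow> rat poly poly.
        finite {p. prime p \<and>
          \<not> (\<forall>i\<in>{1..M-1}. [p = i] (mod M) \<longrightarrow>
                (\<forall>s. Z p s = eval2 (W i) (of_nat p) (of_nat p powr (- s))))})"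

section \<open>The Lie ring and the cubic\<close>

locale L_np8 = lie_ring zmul br
  for zmul :: "int \<Rightarrow> 'a::ab_group_add \<Rightarrow> 'a" and br :: "'a \<Rightarrow> 'a \<Rightarrow> 'a" +
  fixes x y :: "nat \<Rightarrow> 'a"
  assumes basis_distinct: "distinct [x 1, x 2, x 3, x 4, x 5, y 1, y 2, y 3]"
    and basis_independent: "independent {x 1, x 2, x 3, x 4, x 5, y 1, y 2, y 3}"
    and basis_span: "span {x 1, x 2, x 3, x 4, x 5, y 1, y 2, y 3} = UNIV"
    and rel1: "br (x 1) (x 4) = br (x 2) (x 5)" "br (x 2) (x 5) = y 1"
    and rel2: "zmul 2 (br (x 1) (x 5)) = br (x 3) (x 4)" "br (x 3) (x 4) = zmul 2 (y 2)"
    and rel3: "br (x 2) (x 4) = br (x 3) (x 5)" "br (x 3) (x 5) = y 3"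
    and xx_zero: "\<lbrakk>i \<in> {1..5}; j \<in> {1..5}; i < j;
          (i, j) \<notin> {(1,4), (2,5), (1,5), (3,4), (2,4), (3,5)}\<rbrakk> \<Longrightarrow> br (x i) (x j) = 0"
    and xy_zero: "\<lbrakk>i \<in> {1..5}; j \<in> {1..3}\<rbrakk> \<Longrightarrow> br (x i) (y j) = 0"
    and yy_zero: "\<lbrakk>i \<in> {1..3}; j \<in> {1..3}\<rbrakk> \<Longrightarrow> br (y i) (y j) = 0"


text \<open>The presentation is consistent: a Lie ring satisfying it exists.\<close>

lemma L_np8_exists:
  "\<exists>(zmul :: int \<Rightarrow> int ^ 8 \<Rightarrow> int ^ 8) br x y. L_np8 zmul br x y"
proof -
  define e :: "8 \<Rightarrow> int ^ 8" where "e = (\<lambda>i. axis i 1)"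
  define br :: "int ^ 8 \<Rightarrow> int ^ 8 \<Rightarrow> int ^ 8" where "br = (\<lambda>u v.
      (u$1 * v$4 - u$4 * v$1 + u$2 * v$5 - u$5 * v$2) *s e 6
    + (u$1 * v$5 - u$5 * v$1 + 2 * (u$3 * v$4 - u$4 * v$3)) *s e 7
    + (u$2 * v$4 - u$4 * v$2 + u$3 * v$5 - u$5 * v$3) *s e 8)"
  define x where "x = (\<lambda>n::nat. e (of_nat n))"
  define y where "y = (\<lambda>n::nat. e (of_nat (n + 5)))"
  have e_nth: "e i $ j = (if j = i then 1 else 0)" for i j
    by (simp add: e_def axis_def)
  have e_inj: "e i = e j \<longleftrightarrow> i = j" for i j
    by (auto simp: e_def axis_eq_axis)
  have br_nth: "br u v $ j =
      (if j = 6 then u$1 * v$4 - u$4 * v$1 + u$2 * v$5 - u$5 * v$2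
       else if j = 7 then u$1 * v$5 - u$5 * v$1 + 2 * (u$3 * v$4 - u$4 * v$3)
       else if j = 8 then u$2 * v$4 - u$4 * v$2 + u$3 * v$5 - u$5 * v$3 else 0)" for u v j
    by (simp add: br_def e_nth)
  interpret m: Modules.module "(*s) :: int \<Rightarrow> int ^ 8 \<Rightarrow> int ^ 8"
    by unfold_locales (vector field_simps)+
  interpret lie_ring "(*s) :: int \<Rightarrow> int ^ 8 \<Rightarrow> int ^ 8" br
    by unfold_locales (simp_all add: vec_eq_iff br_nth algebra_simps)
  have all: "{x 1, x 2, x 3, x 4, x 5, y 1, y 2, y 3} = range e"
  proof -
    have "i \<in> {1, 2, 3, 4, 5, 6, 7, 8}" for i :: 8
    proof (cases i)
      case (of_int z)
      then have "z \<in> {0, 1, 2, 3, 4, 5, 6, 7}" by auto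
      then show ?thesis using of_int by auto
    qed
    then have "(UNIV :: 8 set) = {1, 2, 3, 4, 5, 6, 7, 8}" by blast
    then have "range e = e ` {1, 2, 3, 4, 5, 6, 7, 8}" by (rule arg_cong)
    then show ?thesis by (simp add: x_def y_def)
  qed
  have ind: "m.independent (range e)"
    unfolding m.independent_explicit_module
  proof (intro allI impI)
    fix t u v
    assume t: "finite t" "t \<subseteq> range e" "(\<Sum>w\<in>t. u w *s w) = 0" "v \<in> t"
    then obtain i where i: "v = e i" by blast
    have "0 = (\<Sum>w\<in>t. u w *s w) $ i" using t by simp
    also have "\<dots> = (\<Sum>w\<in>t. if w = v then u v else 0)"
      unfolding sum_component
    proof (rule sum.cong)
      fix w assume "w \<in> t"
      then obtain j where "w = e j" using t by blast
      then show "(u w *s w) $ i = (if w = v then u v else 0)"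
        using i by (auto simp: e_nth e_inj)
    qed simp
    also have "\<dots> = u v" using t by simp
    finally show "u v = 0" by simp
  qed
  have spn: "m.span (range e) = UNIV"
  proof -
    have "v \<in> m.span (range e)" for v
    proof -
      have "v = (\<Sum>i\<in>UNIV. (v $ i) *s e i)"
        by (simp add: vec_eq_iff e_nth if_distrib cong: if_cong)
      also have "\<dots> \<in> m.span (range e)"
        by (intro m.span_sum m.span_scale m.span_base) auto
      finally show ?thesis .
    qed
    then show ?thesis by auto
  qed
  have "L_np8 ((*s) :: int \<Rightarrow> int ^ 8 \<Rightarrow> int ^ 8) br x y"
  proof unfold_locales
    show "m.independent {x 1, x 2, x 3, x 4, x 5, y 1, y 2, y 3}"
      unfolding all by (rule ind)
    show "m.span {x 1, x 2, x 3, x 4, x 5, y 1, y 2, y 3} = UNIV"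
      unfolding all by (rule spn)
    show "distinct [x 1, x 2, x 3, x 4, x 5, y 1, y 2, y 3]"
      by (simp add: x_def y_def e_inj)
    have xr: "i \<in> {1, 2, 3, 4, 5}" if "i \<in> {1..5}" for i :: nat using that by auto
    have yr: "i \<in> {1, 2, 3}" if "i \<in> {1..3}" for i :: nat using that by auto
    show "br (x i) (x j) = 0" if "i \<in> {1..5}" "j \<in> {1..5}" "i < j"
      "(i, j) \<notin> {(1,4), (2,5), (1,5), (3,4), (2,4), (3,5)}" for i j
      using xr[OF that(1)] xr[OF that(2)] that(3,4)
      by (elim insertE emptyE) (simp_all add: br_def x_def e_nth)
    show "br (x i) (y j) = 0" if "i \<in> {1..5}" "j \<in> {1..3}" for i j
      using xr[OF that(1)] yr[OF that(2)]
      by (elim insertE emptyE) (simp_all add: br_def x_def y_def e_nth)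
    show "br (y i) (y j) = 0" if "i \<in> {1..3}" "j \<in> {1..3}" for i j
      using yr[OF that(1)] yr[OF that(2)]
      by (elim insertE emptyE) (simp_all add: br_def y_def e_nth)
  qed (simp_all add: br_def x_def y_def e_nth)
  then show ?thesis by blast
qed

definition num_roots :: "nat \<Rightarrow> nat" where
  "num_roots p = card {r \<in> carrier (Fp p). [r ^ 3 - 2 = 0] (mod int p)}"

text \<open>Write \<open>N\<close> for the number of roots. In the ideal zeta function of the Lie ring above modulo
  \<open>p\<close>, the coefficient of \<open>t^5\<close> is \<open>1 + p + p^2 (1 + N) + p^3 (1 + N)\<close>, where the leading 1 is the
  top term of the zeta function of the five-dimensional space. It counts ideals by their image
  \<open>U\<close> modulo the span \<open>Z\<close> of the \<open>y i\<close> and their intersection \<open>J\<close> with \<open>Z\<close>: one for \<open>U = 0\<close>,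
  \<open>J = Z\<close>, and \<open>p\<close> for each pair of a line \<open>U\<close> and a plane \<open>J\<close> containing \<open>[U, L]\<close>. Modulo \<open>J\<close>
  the bracket is an alternating form on a five-dimensional space; for \<open>N\<close> of the \<open>1 + p + p^2\<close>
  planes its radical has dimension 3 and for the others it has dimension 1, which gives
  \<open>1 + p + p^2 + N (p + p^2)\<close> pairs. The source prints \<open>2 p^2\<close> in place of \<open>p^2 (1 + N)\<close>;
  the two agree only for \<open>N = 1\<close>, and for \<open>p = 7\<close> (where \<open>N = 0\<close>) the coefficient is 400,
  not 449.\<close>

end

(* Subspaces of L/pL are handled as subgroups of L containing pL. Let Z be the span of the y_i.
   An ideal I is determined by J = I intersected with Z, U = I + Z with [U, L] contained in J, and one of
   |Z/J|^(dim U/Z) choices of a lift, so only pairs (J, U) have to be counted. Modulo a plane J of Z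
   the bracket is a skew form with radical of dimension 1 over Z, unless J is one of the planes
   r y_1^* + y_2^* + r^2 y_3^* = 0 with r^3 = 2, where the radical has dimension 3; for a line J the
   radical is trivial unless J is spanned by (r, r^2, 1) with r^3 = 2.

   The cubic character of 2 is read off the Jacobi sum J(chi, chi) = n_0 + n_1 w + n_2 w^2 of norm p
   from the parities of the n_i, and descent shows that 4 p = A^2 + 27 B^2 is essentially unique.

   The coefficient of t^6 is 1 + p + p^2 (1 + N), so it suffices to find, for every M, infinitely
   many primes p = 1 (mod M) with N = 3 and with N = 0. Both come from prime divisors of norms of
   elements 1 + c G(z), where z is a root of unity of large order: such primes are 1 modulo M. For
   N = 3 the element is 1 - 2 (c g)^3. For N = 0 the norm down to Z[w] is made congruent to w modulo
   2 and to 1 modulo 3, so that by the descent not all of its prime divisors are u^2 + 27 v^2. *)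

theory Submission
  imports "HOL-Algebra.Algebraic_Closure_Type" "HOL-Library.Z2" "HOL-Number_Theory.Number_Theory" Defs
begin

section \<open>The cubic residue character of 2\<close>

text \<open>The splitting field of x^3 - 2 is not abelian over Q, so no congruence on p decides N;
  refuting every modulus M takes primes in the class 1 modulo M with a prescribed cubic character of
  2. Divisors of cyclotomic norms give the congruence for free, and the freedom in the element is
  spent on the character. Algebraic integers occur only as integer polynomials evaluated at all
  primitive roots of unity, traces and norms as sums and products of such values. The price is a
  denominator: a value common to all conjugates is known to be integral only after multiplication by
  a fixed factor. In general this factor is put into the coefficient of the element; but the partial
  norm has to be read modulo 2, where the coefficient must stay odd, so powers of 2 are removed from
  it by passing to a field of characteristic 2. The cubic comes from a 2 x 3 matrix: modulo the
  plane a y_1^* + b y_2^* + c y_3^* = 0 the bracket pairs x_1, x_2, x_3 with x_4, x_5 by the rows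
  (a, c, 2b) and (b, a, c), which for a nonzero form are proportional exactly if a = r b, c = r^2 b
  and r^3 = 2.\<close>

lemma fermat_int:
  assumes "prime p" "\<not> int p dvd x"
  shows "[x ^ (p - 1) = 1] (mod int p)"
proof -
  have p0: "int p > 0" using assms(1) prime_gt_0_nat by simp
  define a where "a = nat (x mod int p)"
  have a: "int a = x mod int p" using p0 by (simp add: a_def)
  then have "\<not> p dvd a" using assms(2) by (metis dvd_mod_iff dvd_refl int_dvd_int_iff)
  then have "[int (a ^ (p - 1)) = int 1] (mod int p)"
    using fermat_theorem[OF assms(1)] cong_int_iff by blast
  then have "[(x mod int p) ^ (p - 1) = 1] (mod int p)" by (simp add: a)
  then show ?thesis by (simp add: unique_euclidean_semiring_class.cong_def power_mod)
qed

text \<open>Oddness of \<open>A\<close> says that (A + B sqrt(-27))/2 lies outside Z[sqrt(-27)]. As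
  \<open>p\<close> divides A^2 v^2 - B^2 u^2, multiplying by u + v sqrt(-27) or by its conjugate
  yields a multiple of \<open>p\<close>, and division by \<open>p\<close> removes one factor
  \<open>p\<close> from the norm. Oddness survives because \<open>p\<close> is odd, so that u and v
  have opposite parity.\<close>

lemma descent_odd:
  fixes A B u v :: int and p n :: nat
  assumes "prime p" "int p = u^2 + 27 * v ^ 2" "4 * int p * int n = A^2 + 27 * B^2" "odd A"
  shows "\<exists>A' B'. 4 * int n = A'^2 + 27 * B'^2 \<and> odd A'"
proof -
  have eq: "A^2 * v ^ 2 - B^2 * u^2 = int p * (4 * int n * v ^ 2 - B^2)"
    using assms(2,3) by Groebner_Basis.algebra
  then have "int p dvd (A * v - B * u) * (A * v + B * u)"
    by (metis dvd_triv_left power_mult_distrib square_diff_square_factored power2_eq_square mult.commute)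
  then have "int p dvd A * v - B * u \<or> int p dvd A * v + B * u"
    using assms(1) by (simp add: prime_dvd_mult_iff)
  then obtain e :: int where e: "e = 1 \<or> e = -1" "int p dvd A * v - e * B * u"
    by (metis diff_minus_eq_add minus_mult_left mult_1 mult_minus_left)
  then obtain B' where B': "A * v - e * B * u = int p * B'" by auto
  have e2: "e * e = 1" using e by auto
  have "int p dvd (A * u + 27 * e * B * v)^2"
  proof -
    have "(A * u + 27 * e * B * v)^2 = (A^2 + 27 * (e * e) * B^2) * (u^2+27 * v ^ 2) - 27 * (A * v - e * B * u)^2"
      by Groebner_Basis.algebra
    also have "\<dots> = int p * (4 * int p * int n) - 27 * (int p * B')^2"
      using assms(2,3) B' e2 by simp
    also have "int p dvd \<dots>" by (simp add: power2_eq_square)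
    finally show ?thesis .
  qed
  then have "int p dvd A * u + 27 * e * B * v" using assms(1) prime_dvd_power by (metis prime_nat_int_transfer)
  then obtain A' where A': "A * u + 27 * e * B * v = int p * A'" by auto
  have "int p * (int p * (A'^2 + 27 * B'^2)) = (int p * A')^2 + 27 * (int p * B')^2"
    by Groebner_Basis.algebra
  also have "\<dots> = (A * u + 27 * e * B * v)^2 + 27 * (A * v - e * B * u)^2" using A' B' by simp
  also have "\<dots> = (A^2 + 27 * (e * e) * B^2) * (u^2+27 * v ^ 2)" by Groebner_Basis.algebra
  also have "\<dots> = int p * (int p * (4 * int n))"
    using assms(3) unfolding e2 assms(2)[symmetric] by simp
  finally have eq: "4 * int n = A'^2 + 27 * B'^2" using assms(1) prime_gt_0_nat by force
  have "even (A^2 + 27 * B^2)" using assms(3) by (metis dvd_mult2 even_numeral)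
  then have "odd B" using \<open>odd A\<close> by simp
  have "odd p"
  proof
    assume "even p" then have "p = 2" using assms(1) primes_dvd_imp_eq two_is_prime_nat by blast
    then have "2 = u^2 + 27 * v ^ 2" using assms(2) by simp
    moreover have "v = 0"
    proof (rule ccontr)
      assume "v \<noteq> 0" then have "v ^ 2 > 0" by simp
      then show False using \<open>2 = u^2 + 27 * v ^ 2\<close> by (smt (verit) zero_le_power2)
    qed
    ultimately have "u^2 = 2" by simp
    then have "even u" by (metis even_power dvd_refl)
    then obtain k where "u = 2 * k" by blast
    then show False using \<open>u^2 = 2\<close> by (simp add: power2_eq_square) presburger
  qed
  then have "odd (u^2 + 27 * v ^ 2)" using assms(2) by (metis even_of_nat)
  then have "odd (u + v)" by simp
  moreover have "e = 1 \<or> e = -1" using e by simp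
  ultimately have "odd (A * u + 27 * e * B * v)" using \<open>odd A\<close> \<open>odd B\<close> by auto
  then have "odd A'" using A' by simp
  then show ?thesis using eq by blast
qed

lemma descent_base: "4 = A^2 + 27 * (B::int)^2 \<Longrightarrow> even A"
proof (rule ccontr)
  assume *: "4 = A^2 + 27 * B^2" "odd A"
  have "B = 0"
    proof (rule ccontr)
      assume "B \<noteq> 0" then have "B^2 > 0" by simp
      then show False using * by (smt (verit) zero_le_power2)
    qed
  then show False using * by (metis add.right_neutral even_numeral even_power mult_zero_right power_zero_numeral)
qed


section \<open>Orbit counting and substitutions in sums over residues\<close>

lemma card_dvd_3_if_fixpoint_free:
  assumes "finite S" "\<And>x. x \<in> S \<Longrightarrow> f x \<in> S" "\<And>x. x \<in> S \<Longrightarrow> f (f (f x)) = x"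
    "\<And>x. x \<in> S \<Longrightarrow> f x \<noteq> x"
  shows "3 dvd card S"
  using assms
proof (induction "card S" arbitrary: S rule: less_induct)
  case less
  show ?case
  proof (cases "S = {}")
    case False
    then obtain x where x: "x \<in> S" by blast
    have ne: "f x \<noteq> x" "f (f x) \<noteq> f x" "f (f x) \<noteq> x"
      using less.prems x by (metis, metis, metis)
    let ?O = "{x, f x, f (f x)}"
    have sub: "?O \<subseteq> S" using less.prems x by blast
    have 3: "card ?O = 3" using ne by (simp add: eq_commute)
    have eq: "card S = card (S - ?O) + 3"
      using card_Diff_subset[of ?O S] sub 3 card_mono[OF less.prems(1) sub] by simp
    have "3 dvd card (S - ?O)"
    proof (rule less.hyps)
      show "card (S - ?O) < card S" using eq by simp
      fix y assume y: "y \<in> S - ?O"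
      show "f y \<in> S - ?O"
      proof
        show "f y \<in> S" using y less.prems(2) by simp
        show "f y \<notin> ?O"
        proof
          assume "f y \<in> ?O"
          then have "f (f (f y)) \<in> ?O" using less.prems(3)[OF x] by auto
          then show False using y less.prems(3) by auto
        qed
      qed
      show "f (f (f y)) = y" "f y \<noteq> y" using y less.prems by auto
    qed (use less.prems in auto)
    then show ?thesis using eq by simp
  qed simp
qed

lemma even_card_if_fixpoint_free:
  assumes "finite S" "\<And>x. x \<in> S \<Longrightarrow> f x \<in> S" "\<And>x. x \<in> S \<Longrightarrow> f (f x) = x"
    "\<And>x. x \<in> S \<Longrightarrow> f x \<noteq> x"
  shows "even (card S)"
  using assms
proof (induction "card S" arbitrary: S rule: less_induct)
  case less
  show ?case
  proof (cases "S = {}")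
    case False
    then obtain x where x: "x \<in> S" by blast
    let ?O = "{x, f x}"
    have sub: "?O \<subseteq> S" using less.prems x by blast
    have 3: "card ?O = 2" using less.prems(4)[OF x] by (simp add: eq_commute)
    have eq: "card S = card (S - ?O) + 2"
      using card_Diff_subset[of ?O S] sub 3 card_mono[OF less.prems(1) sub] by simp
    have "even (card (S - ?O))"
    proof (rule less.hyps)
      show "card (S - ?O) < card S" using eq by simp
      fix y assume y: "y \<in> S - ?O"
      show "f y \<in> S - ?O"
      proof
        show "f y \<in> S" using y less.prems(2) by simp
        show "f y \<notin> ?O"
        proof
          assume "f y \<in> ?O"
          then have "f (f y) \<in> ?O" using less.prems(3)[OF x] by auto
          then show False using y less.prems(3) by auto
        qed
      qed
      show "f (f y) = y" "f y \<noteq> y" using y less.prems by auto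
    qed (use less.prems in auto)
    then show ?thesis using eq by simp
  qed simp
qed

lemma sum_residues_affine:
  fixes F :: "int \<Rightarrow> 'b::comm_monoid_add"
  assumes p: "prime p" and F: "\<And>x y. [x = y] (mod int p) \<Longrightarrow> F x = F y" and a: "\<not> int p dvd a"
  shows "(\<Sum>x\<in>{0..<int p}. F (a * x + b)) = (\<Sum>x\<in>{0..<int p}. F x)"
proof -
  have p0: "int p > 0" using p prime_gt_0_nat by simp
  let ?f = "\<lambda>x. (a * x + b) mod int p"
  have inj: "inj_on ?f {0..<int p}"
  proof
    fix x y assume xy: "x \<in> {0..<int p}" "y \<in> {0..<int p}" "?f x = ?f y"
    then have "[a * x + b = a * y + b] (mod int p)" by (simp add: unique_euclidean_semiring_class.cong_def)
    then have "[a * x = a * y] (mod int p)" by (simp add: cong_add_rcancel)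
    moreover have "coprime a (int p)" using p a
      by (metis coprime_commute prime_imp_coprime prime_nat_int_transfer)
    ultimately have "[x = y] (mod int p)" by (simp add: cong_mult_lcancel)
    then show "x = y" using xy by (simp add: unique_euclidean_semiring_class.cong_def)
  qed
  have "?f ` {0..<int p} = {0..<int p}"
    by (rule endo_inj_surj) (use inj p0 in auto)
  then have "(\<Sum>x\<in>{0..<int p}. F x) = (\<Sum>x\<in>?f ` {0..<int p}. F x)" by simp
  also have "\<dots> = (\<Sum>x\<in>{0..<int p}. F (?f x))" using inj by (simp add: sum.reindex)
  also have "\<dots> = (\<Sum>x\<in>{0..<int p}. F (a * x + b))"
    by (intro sum.cong refl F) (simp add: unique_euclidean_semiring_class.cong_def)
  finally show ?thesis by simp
qed

lemma sum_units_inverse: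
  fixes F :: "int \<Rightarrow> 'b::comm_monoid_add"
  assumes p: "prime p" and F: "\<And>x y. [x = y] (mod int p) \<Longrightarrow> F x = F y"
    and i: "\<And>x. \<not> int p dvd x \<Longrightarrow> [x * i x = 1] (mod int p)"
  shows "(\<Sum>x\<in>{1..<int p}. F (i x)) = (\<Sum>x\<in>{1..<int p}. F x)"
proof -
  have p0: "int p > 1" using p prime_gt_1_nat by simp
  have nd: "\<not> int p dvd x" if "x \<in> {1..<int p}" for x using that zdvd_not_zless by auto
  let ?f = "\<lambda>x. i x mod int p"
  have inj: "inj_on ?f {1..<int p}"
  proof
    fix x y assume xy: "x \<in> {1..<int p}" "y \<in> {1..<int p}" "?f x = ?f y"
    then have "[i x = i y] (mod int p)" by (simp add: unique_euclidean_semiring_class.cong_def)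
    then have "[y * (x * i x) = x * (y * i y)] (mod int p)"
      by (metis cong_scalar_left mult.left_commute)
    moreover have "[y * (x * i x) = y * 1] (mod int p)" "[x * (y * i y) = x * 1] (mod int p)"
      using i nd xy by (blast intro: cong_scalar_left)+
    ultimately have "[x = y] (mod int p)" by (metis cong_sym cong_trans mult.right_neutral)
    then show "x = y" using xy by (simp add: unique_euclidean_semiring_class.cong_def)
  qed
  have "?f x \<in> {1..<int p}" if "x \<in> {1..<int p}" for x
  proof -
    have "\<not> int p dvd i x"
    proof
      assume "int p dvd i x"
      then have "int p dvd x * i x" by simp
      then have "int p dvd 1" using cong_dvd_iff[OF i[OF nd[OF that]]] by simp
      then show False using p0 by simp
    qed
    then have "?f x \<noteq> 0" by auto
    moreover have "?f x \<ge> 0" "?f x < int p" using p0 by auto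
    ultimately show ?thesis by simp
  qed
  then have "?f ` {1..<int p} = {1..<int p}"
    by (intro endo_inj_surj) (use inj in auto)
  then have "(\<Sum>x\<in>{1..<int p}. F x) = (\<Sum>x\<in>?f ` {1..<int p}. F x)" by simp
  also have "\<dots> = (\<Sum>x\<in>{1..<int p}. F (?f x))" using inj by (simp add: sum.reindex)
  also have "\<dots> = (\<Sum>x\<in>{1..<int p}. F (i x))"
    by (intro sum.cong refl F) (simp add: unique_euclidean_semiring_class.cong_def)
  finally show ?thesis by simp
qed

lemma prime_generator:
  assumes "prime p"
  obtains g :: nat where "\<And>x. \<not> int p dvd x \<Longrightarrow> \<exists>k. [x = int g ^ k] (mod int p)"
    and "\<And>k. [int g ^ k = 1] (mod int p) \<longleftrightarrow> p - 1 dvd k"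
proof -
  have p1: "p > 1" using assms prime_gt_1_nat by simp
  obtain g where g: "residue_primroot p g"
    using prime_primitive_root_exists[of p] assms p1 by auto
  show thesis
  proof
    fix k
    have "[int g ^ k = 1] (mod int p) \<longleftrightarrow> [g ^ k = 1] (mod p)"
      using cong_int_iff[of "g ^ k" 1 p] by simp
    also have "\<dots> \<longleftrightarrow> p - 1 dvd k" using g assms
      by (simp add: ord_divides' residue_primroot_def totient_prime)
    finally show "[int g ^ k = 1] (mod int p) \<longleftrightarrow> p - 1 dvd k" .
  next
    fix x assume x: "\<not> int p dvd x"
    define a where "a = nat (x mod int p)"
    have a: "int a = x mod int p" using p1 by (simp add: a_def)
    then have "\<not> p dvd a" using x by (metis dvd_mod_iff dvd_refl int_dvd_int_iff)
    moreover have "int a < int p" unfolding a using p1 by simp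
    ultimately have "a \<in> totatives p" using assms
      by (auto simp: totatives_prime intro!: Nat.gr0I)
    then obtain i where "a = g ^ i mod p"
      using residue_primroot_is_generator[OF p1 g] by (auto simp: bij_betw_def)
    then have "[a = g ^ i] (mod p)" by (simp add: unique_euclidean_semiring_class.cong_def)
    then have "[int a = int g ^ i] (mod int p)" by (metis cong_int_iff of_nat_power)
    then show "\<exists>k. [x = int g ^ k] (mod int p)" unfolding a by (auto simp: unique_euclidean_semiring_class.cong_def)
  qed
qed

section \<open>The cubic residue character modulo p\<close>

locale cubic_character =
  fixes p m :: nat and w :: int and \<omega> :: complex
  assumes prime_p: "prime p" and p_eq: "p = 3 * m + 1"
    and w_cong: "[w^2 + w + 1 = 0] (mod int p)"
    and w_power: "\<exists>g. [g ^ m = w] (mod int p)"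
    and omega: "\<omega>^2 + \<omega> + 1 = 0"
begin

lemma p_gt_3: "p > 3"
  using p_eq prime_gt_1_nat[OF prime_p] by presburger

lemma m_pos: "m > 0" using p_gt_3 p_eq by simp

lemma omega_cubed: "\<omega>^3 = 1"
proof -
  have "\<omega>^3 - 1 = (\<omega> - 1) * (\<omega>^2 + \<omega> + 1)" by Groebner_Basis.algebra
  then show ?thesis using omega by simp
qed

lemma omega_ne_1: "\<omega> \<noteq> 1" "\<omega>^2 \<noteq> 1"
proof -
  show "\<omega> \<noteq> 1" using omega by auto
  then show "\<omega>^2 \<noteq> 1" using omega_cubed by (metis mult.left_neutral power2_eq_square power3_eq_cube)
qed

lemma omega_ne: "\<omega> \<noteq> \<omega>^2" "\<omega> \<noteq> 0"
proof -
  show "\<omega> \<noteq> 0" using omega_cubed by (metis power_zero_numeral zero_neq_one)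
  then show "\<omega> \<noteq> \<omega>^2" using omega_ne_1(1) by (simp add: power2_eq_square)
qed

lemma pdvd_mult: "int p dvd x * y \<longleftrightarrow> int p dvd x \<or> int p dvd y"
  using prime_p by (simp add: prime_dvd_mult_iff)

lemma w_cubed: "[w^3 = 1] (mod int p)"
proof -
  have "int p dvd w^2 + w + 1" using w_cong by (simp add: cong_0_iff)
  then have "int p dvd (w - 1) * (w^2 + w + 1)" by simp
  also have "(w - 1) * (w^2 + w + 1) = w^3 - 1" by Groebner_Basis.algebra
  finally show ?thesis by (simp add: cong_iff_dvd_diff)
qed

lemma w_nondvd: "\<not> int p dvd w" "\<not> [w = 1] (mod int p)" "\<not> [w^2 = 1] (mod int p)" "\<not> [w = w^2] (mod int p)"
proof -
  have d: "int p dvd w^2 + w + 1" using w_cong by (simp add: cong_0_iff)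
  have p3: "\<not> int p dvd 3" using p_gt_3 by (auto dest: zdvd_imp_le)
  have p1: "\<not> int p dvd 1" using p_gt_3 by (auto dest: zdvd_imp_le)
  show a: "\<not> int p dvd w"
  proof
    assume "int p dvd w"
    then have "int p dvd (w^2 + w + 1) - (w + 1) * w" using d by (meson dvd_diff dvd_mult)
    then show False using p1 by (simp add: power2_eq_square algebra_simps)
  qed
  show b: "\<not> [w = 1] (mod int p)"
  proof
    assume "[w = 1] (mod int p)"
    then have "int p dvd w - 1" by (simp add: cong_iff_dvd_diff)
    then have "int p dvd (w^2 + w + 1) - (w + 2) * (w - 1)" using d by (meson dvd_diff dvd_mult)
    then show False using p3 by (simp add: power2_eq_square algebra_simps)
  qed
  show c: "\<not> [w = w^2] (mod int p)"
  proof
    assume "[w = w^2] (mod int p)"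
    then have "int p dvd w * (1 - w)" by (simp add: cong_iff_dvd_diff power2_eq_square algebra_simps)
    then have "int p dvd 1 - w" using a pdvd_mult by blast
    then have "[1 = w] (mod int p)" by (simp add: cong_iff_dvd_diff)
    then show False using b by (simp add: cong_sym_eq)
  qed
  show "\<not> [w^2 = 1] (mod int p)"
  proof
    assume "[w^2 = 1] (mod int p)"
    then have "[w * w^2 = w * 1] (mod int p)" by (rule cong_scalar_left)
    then have "[w^3 = w] (mod int p)" by (simp add: power3_eq_cube power2_eq_square mult.assoc)
    then show False using w_cubed b by (metis cong_sym cong_trans)
  qed
qed

lemma power_m_cases:
  assumes "\<not> int p dvd x"
  shows "[x ^ m = 1] (mod int p) \<or> [x ^ m = w] (mod int p) \<or> [x ^ m = w^2] (mod int p)"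
proof -
  let ?y = "x ^ m"
  have "[x ^ (p - 1) = 1] (mod int p)"
    using fermat_int prime_p assms .
  then have "[?y^3 = 1] (mod int p)" using p_eq by (simp add: power_mult mult.commute)
  then have *: "int p dvd ?y^3 - 1" by (simp add: cong_iff_dvd_diff)
  have d: "int p dvd w^2 + w + 1" using w_cong by (simp add: cong_0_iff)
  \<comment> \<open>Modulo w^2 + w + 1 this is the factorisation of Y^3 - 1 over the cube roots of
    unity 1, w, w^2.\<close>
  have "(?y - 1) * ((?y - w) * (?y - w^2)) = (?y^3 - 1) + (w^2+w+1) * (?y - 1) * (w - 1 - ?y)"
    by Groebner_Basis.algebra
  then have "int p dvd (?y - 1) * ((?y - w) * (?y - w^2))"
    using d * by simp
  then show ?thesis unfolding pdvd_mult by (auto simp: cong_iff_dvd_diff)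
qed

text \<open>Euler's criterion turned into a complex character. By \<open>power_m_cases\<close> the
  last branch is reached only for x^m = w^2.\<close>

definition chi :: "int \<Rightarrow> complex" where
  "chi x = (if int p dvd x then 0 else if [x ^ m = 1] (mod int p) then 1
            else if [x ^ m = w] (mod int p) then \<omega> else \<omega>^2)"

lemma chi_cong: "[x = y] (mod int p) \<Longrightarrow> chi x = chi y"
proof -
  assume xy: "[x = y] (mod int p)"
  then have "[x^m = y^m] (mod int p)" by (rule cong_pow)
  then have "[x^m = c] (mod int p) \<longleftrightarrow> [y^m = c] (mod int p)" for c
    by (metis cong_sym cong_trans)
  then show ?thesis unfolding chi_def using cong_dvd_iff[OF xy] by simp
qed

text \<open>Both w and \<omega> have order 3, so \<open>k\<close> may be reduced modulo 3; the three
  remaining cases are told apart by \<open>w_nondvd\<close>.\<close>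

lemma chi_eqI:
  assumes "\<not> int p dvd x" "[x ^ m = w ^ k] (mod int p)"
  shows "chi x = \<omega> ^ k"
proof -
  have w3: "[w ^ (3 * q) = 1] (mod int p)" for q
    using cong_pow[OF w_cubed, of q] by (simp add: power_mult)
  have "w ^ k = w ^ (3 * (k div 3) + k mod 3)" by simp
  then have "w ^ k = w ^ (3 * (k div 3)) * w ^ (k mod 3)" unfolding power_add .
  then have "[w ^ k = w ^ (k mod 3)] (mod int p)"
    using cong_scalar_right[OF w3, of "k div 3" "w ^ (k mod 3)"] by simp
  then have *: "[x ^ m = w ^ (k mod 3)] (mod int p)" using assms(2) cong_trans by blast
  have "\<omega> ^ k = \<omega> ^ (3 * (k div 3) + k mod 3)" by simp
  then have "\<omega> ^ k = \<omega> ^ (3 * (k div 3)) * \<omega> ^ (k mod 3)" unfolding power_add .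
  then have **: "\<omega> ^ k = \<omega> ^ (k mod 3)" by (simp add: power_mult omega_cubed)
  consider "k mod 3 = 0" | "k mod 3 = 1" | "k mod 3 = 2" by linarith
  then show ?thesis
  proof cases
    case 1 then show ?thesis using * ** assms(1) by (simp add: chi_def)
  next
    case 2
    then have "\<not> [x ^ m = 1] (mod int p)" using * w_nondvd(2) by (simp) (metis cong_sym cong_trans)
    then show ?thesis using * ** assms(1) 2 by (simp add: chi_def)
  next
    case 3
    then have "\<not> [x ^ m = 1] (mod int p)" "\<not> [x ^ m = w] (mod int p)"
      using * w_nondvd(3,4) by (metis cong_sym cong_trans)+
    then show ?thesis using * ** assms(1) 3 by (simp add: chi_def)
  qed
qed

lemma chi_obtain:
  assumes "\<not> int p dvd x"
  obtains k where "[x ^ m = w ^ k] (mod int p)" "chi x = \<omega> ^ k"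
proof -
  have "\<exists>k. [x ^ m = w ^ k] (mod int p)"
    using power_m_cases[OF assms] by (metis power_0 power_one_right)
  then show ?thesis using that chi_eqI[OF assms] by blast
qed

lemma chi_mult: "chi (x * y) = chi x * chi y"
proof (cases "int p dvd x * y")
  case True
  then show ?thesis unfolding pdvd_mult by (auto simp: chi_def)
next
  case False
  then have x: "\<not> int p dvd x" and y: "\<not> int p dvd y" by auto
  obtain k where k: "[x ^ m = w ^ k] (mod int p)" "chi x = \<omega> ^ k" using chi_obtain[OF x] .
  obtain l where l: "[y ^ m = w ^ l] (mod int p)" "chi y = \<omega> ^ l" using chi_obtain[OF y] .
  have "[(x * y) ^ m = w ^ (k + l)] (mod int p)"
    using cong_mult[OF k(1) l(1)] by (simp add: power_mult_distrib power_add)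
  from chi_eqI[OF False this] k l show ?thesis by (simp add: power_add)
qed

lemma chi_dvd [simp]: "int p dvd x \<Longrightarrow> chi x = 0" by (simp add: chi_def)

lemma chi_1 [simp]: "chi 1 = 1"
  using p_gt_3 by (auto simp: chi_def dest: zdvd_imp_le)

lemma chi_cubed: "\<not> int p dvd x \<Longrightarrow> chi x ^ 3 = 1"
  by (erule chi_obtain) (metis omega_cubed mult.commute power_mult power_one)

lemma cnj_omega: "cnj \<omega> = \<omega>^2"
proof -
  have "norm \<omega> ^ 3 = 1" using omega_cubed by (metis norm_one norm_power)
  then have "norm \<omega> = 1" by (metis norm_ge_zero power_eq_1_iff zero_neq_numeral abs_norm_cancel real_norm_def)
  then have "\<omega> * cnj \<omega> = 1" by (simp add: complex_norm_square[symmetric])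
  moreover have "\<omega> * \<omega>^2 = 1" using omega_cubed by (simp add: power3_eq_cube power2_eq_square mult.assoc)
  ultimately show ?thesis using omega_ne by (metis mult_cancel_left)
qed

lemma cnj_chi: "cnj (chi x) = chi x ^ 2"
proof (cases "int p dvd x")
  case False
  then obtain k where "chi x = \<omega> ^ k" using chi_obtain by metis
  then show ?thesis using cnj_omega by (simp add: power_mult[symmetric] mult.commute)
qed simp

lemma chi_cnj_chi: "\<not> int p dvd x \<Longrightarrow> chi x * cnj (chi x) = 1"
  using cnj_chi chi_cubed by (simp add: power3_eq_cube power2_eq_square mult.assoc)

text \<open>Multiplication by an element of character value \<omega> permutes the residues and
  multiplies the sum by \<omega>. Such an element is provided by \<open>w_power\<close>.\<close>

lemma sum_chi: "(\<Sum>x\<in>{0..<int p}. chi x) = 0"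
proof -
  obtain g where g: "[g ^ m = w] (mod int p)" using w_power by blast
  have gnd: "\<not> int p dvd g"
  proof
    assume "int p dvd g"
    then have "int p dvd g ^ m" using m_pos by (simp add: dvd_power_le dvd_trans[OF _ dvd_power])
    then show False using g w_nondvd(1) cong_dvd_iff by blast
  qed
  have "chi g = \<omega>" using chi_eqI[OF gnd, of 1] g by simp
  have "(\<Sum>x\<in>{0..<int p}. chi x) = (\<Sum>x\<in>{0..<int p}. chi (g * x + 0))"
    using sum_residues_affine[OF prime_p, of chi g 0] chi_cong gnd by simp
  also have "\<dots> = \<omega> * (\<Sum>x\<in>{0..<int p}. chi x)"
    using \<open>chi g = \<omega>\<close> by (simp add: chi_mult sum_distrib_left)
  finally have "(1 - \<omega>) * (\<Sum>x\<in>{0..<int p}. chi x) = 0" by (simp add: algebra_simps)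
  then show ?thesis using omega_ne_1(1) by simp
qed


section \<open>The Jacobi sum and its norm\<close>

definition jacobi_sum :: complex where
  "jacobi_sum = (\<Sum>x\<in>{0..<int p}. chi (x * (1 - x)))"

definition inv_p :: "int \<Rightarrow> int" where "inv_p x = x ^ (p - 2)"

lemma inv_p: "\<not> int p dvd x \<Longrightarrow> [x * inv_p x = 1] (mod int p)"
proof -
  assume "\<not> int p dvd x"
  moreover have "x * inv_p x = x ^ (p - 1)"
  proof -
    have "p - 1 = Suc (p - 2)" using p_gt_3 by simp
    then show ?thesis unfolding inv_p_def by (metis power_Suc)
  qed
  ultimately show ?thesis using fermat_int[OF prime_p] by simp
qed

lemma cnj_chi_inv: "\<not> int p dvd x \<Longrightarrow> cnj (chi x) = chi (inv_p x)"
proof -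
  assume x: "\<not> int p dvd x"
  have "chi x * chi (inv_p x) = 1" using chi_cong[OF inv_p[OF x]] by (simp add: chi_mult)
  then show ?thesis using chi_cnj_chi[OF x] by (metis mult_cancel_left mult_zero_left zero_neq_one)
qed

lemma residues_split: "{0..<int p} = insert 0 {1..<int p}"
  using p_gt_3 by auto

lemma nondvd_residue: "x \<in> {1..<int p} \<Longrightarrow> \<not> int p dvd x"
  using zdvd_not_zless by auto

text \<open>With z = 1 - y the quotient of the two character values is \<open>chi\<close> at (1 -
  t)/z + t, and inverting z gives an affine sum over the nonzero residues. For t = 1 its terms are
  constant; otherwise it is a complete sum of \<open>chi\<close>, hence 0, except for the missing
  value \<open>chi t\<close> at z = 0.\<close>

lemma mobius_sum:
  "(\<Sum>y\<in>{0..<int p}. chi (1 - y * t) * cnj (chi (1 - y)))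
     = (if [t = 1] (mod int p) then of_nat p - 1 else - chi t)"
proof -
  let ?R = "{0..<int p}" and ?S = "{1..<int p}"
  let ?F = "\<lambda>z. chi (1 - (1 - z) * t) * cnj (chi z)"
  have F: "?F x = ?F y" if "[x = y] (mod int p)" for x y
  proof -
    have "[1 - (1 - x) * t = 1 - (1 - y) * t] (mod int p)"
      by (intro cong_diff cong_mult cong_refl that)
    then show ?thesis using chi_cong that by metis
  qed
  have pm: "\<not> int p dvd -1" using p_gt_3 by (auto dest: zdvd_imp_le)
  have "(\<Sum>y\<in>?R. chi (1 - y * t) * cnj (chi (1 - y))) = (\<Sum>y\<in>?R. ?F ((-1) * y + 1))"
    by simp
  also have "\<dots> = (\<Sum>z\<in>?R. ?F z)"
    by (rule sum_residues_affine[OF prime_p _ pm]) (rule F)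
  also have "\<dots> = (\<Sum>z\<in>?S. ?F z)" by (simp add: residues_split)
  also have "\<dots> = (\<Sum>z\<in>?S. chi ((1 - t) * inv_p z + t))"
  proof (rule sum.cong[OF refl])
    fix z assume "z \<in> ?S"
    then have z: "\<not> int p dvd z" by (rule nondvd_residue)
    have "?F z = chi ((1 - (1 - z) * t) * inv_p z)" using cnj_chi_inv[OF z] by (simp add: chi_mult)
    also have "(1 - (1 - z) * t) * inv_p z = (1 - t) * inv_p z + t * (z * inv_p z)"
      by (simp add: algebra_simps)
    also have "chi \<dots> = chi ((1 - t) * inv_p z + t * 1)"
      by (rule chi_cong) (intro cong_add cong_mult cong_refl inv_p[OF z])
    finally show "?F z = chi ((1 - t) * inv_p z + t)" by simp
  qed
  also have "\<dots> = (\<Sum>z\<in>?S. chi ((1 - t) * z + t))"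
    by (rule sum_units_inverse[where F = "\<lambda>z. chi ((1 - t) * z + t)", OF prime_p])
      (auto intro!: chi_cong inv_p cong_add cong_mult)
  also have "\<dots> = (\<Sum>z\<in>?R. chi ((1 - t) * z + t)) - chi t"
    by (simp add: residues_split)
  also have "\<dots> = (if [t = 1] (mod int p) then of_nat p - 1 else - chi t)"
  proof (cases "[t = 1] (mod int p)")
    case True
    have "chi ((1 - t) * z + t) = 1" for z
    proof -
      have "[(1 - t) * z + t = (1 - 1) * z + 1] (mod int p)"
        by (intro cong_add cong_mult cong_diff cong_refl True)
      from chi_cong[OF this] show ?thesis by simp
    qed
    moreover have "chi t = 1" using chi_cong[OF True] by simp
    ultimately show ?thesis using True by simp
  next
    case False
    then have "\<not> int p dvd 1 - t" by (metis cong_iff_dvd_diff cong_sym)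
    then have "(\<Sum>z\<in>?R. chi ((1 - t) * z + t)) = (\<Sum>z\<in>?R. chi z)"
      by (intro sum_residues_affine[OF prime_p]) (auto intro: chi_cong)
    then show ?thesis using False by (simp add: sum_chi)
  qed
  finally show ?thesis .
qed

lemma sum_chi_square: "(\<Sum>x\<in>{0..<int p}. chi x ^ 2) = 0"
proof -
  have "(\<Sum>x\<in>{0..<int p}. chi x ^ 2) = cnj (\<Sum>x\<in>{0..<int p}. chi x)"
    by (simp add: cnj_chi)
  then show ?thesis by (simp add: sum_chi)
qed

text \<open>In the double sum over x and y put x = y t: the factor \<open>chi y\<close> cancels
  against its conjugate, and the sum over y is the one of \<open>mobius_sum\<close>. Since
  \<open>chi\<close> and its square sum to 0, only a contribution from t = 1 survives.\<close>

lemma jacobi_sum_norm: "jacobi_sum * cnj jacobi_sum = of_nat p"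
proof -
  let ?R = "{0..<int p}" and ?S = "{1..<int p}"
  let ?K = "\<lambda>t. \<Sum>y\<in>?S. chi (1 - y * t) * cnj (chi (1 - y))"
  have inner: "(\<Sum>x\<in>?R. chi (x * (1 - x))) * cnj (chi (y * (1 - y)))
       = (\<Sum>t\<in>?R. chi t * (chi (1 - y * t) * cnj (chi (1 - y))))" if "y \<in> ?S" for y
  proof -
    have y: "\<not> int p dvd y" using that by (rule nondvd_residue)
    have "(\<Sum>x\<in>?R. chi (x * (1 - x))) = (\<Sum>t\<in>?R. chi ((y * t + 0) * (1 - (y * t + 0))))"
      by (rule sum_residues_affine[OF prime_p _ y, symmetric])
        (auto intro!: chi_cong cong_mult cong_diff)
    then have "(\<Sum>x\<in>?R. chi (x * (1 - x))) * cnj (chi (y * (1 - y)))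
      = (\<Sum>t\<in>?R. (chi y * cnj (chi y)) * (chi t * (chi (1 - y * t) * cnj (chi (1 - y)))))"
      by (simp only: sum_distrib_right) (intro sum.cong refl, simp add: chi_mult mult_ac)
    then show ?thesis using chi_cnj_chi[OF y] by simp
  qed
  \<comment> \<open>The subtracted 1 is the term y = 0, which belongs to \<open>mobius_sum\<close>
    but not to \<open>?S\<close>.\<close>
  have K: "?K t = (if [t = 1] (mod int p) then of_nat p - 1 else - chi t) - 1" for t
    using mobius_sum[of t] by (simp add: residues_split algebra_simps)
  have "jacobi_sum * cnj jacobi_sum
      = (\<Sum>y\<in>?R. jacobi_sum * cnj (chi (y * (1 - y))))"
    unfolding jacobi_sum_def by (simp add: sum_distrib_left)
  also have "\<dots> = (\<Sum>y\<in>?S. (\<Sum>x\<in>?R. chi (x * (1 - x))) * cnj (chi (y * (1 - y))))"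
    by (simp add: residues_split jacobi_sum_def)
  also have "\<dots> = (\<Sum>y\<in>?S. \<Sum>t\<in>?R. chi t * (chi (1 - y * t) * cnj (chi (1 - y))))"
    by (rule sum.cong[OF refl inner])
  also have "\<dots> = (\<Sum>t\<in>?R. chi t * ?K t)"
    by (subst sum.swap) (simp add: sum_distrib_left)
  also have "\<dots> = (\<Sum>t\<in>?R. - (chi t ^ 2) - chi t + (if t = 1 then of_nat p else 0))"
  proof (rule sum.cong[OF refl])
    fix t assume t: "t \<in> ?R"
    have "[t = 1] (mod int p) \<longleftrightarrow> t = 1" using t p_gt_3 by (simp add: unique_euclidean_semiring_class.cong_def)
    then show "chi t * ?K t = - (chi t ^ 2) - chi t + (if t = 1 then of_nat p else 0)"
      unfolding K by (simp add: power2_eq_square algebra_simps)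
  qed
  also have "\<dots> = of_nat p"
    using p_gt_3 by (simp add: sum.distrib sum_subtractf sum_negf sum_chi sum_chi_square)
  finally show ?thesis .
qed

section \<open>Divisibility of the value counts and the criterion for 2\<close>

definition fibre :: "nat \<Rightarrow> int set" where
  "fibre k = {x \<in> {0..<int p}. chi (x * (1 - x)) = \<omega> ^ k}"

lemma finite_fibre [simp]: "finite (fibre k)"
  by (rule finite_subset[of _ "{0..<int p}"]) (auto simp: fibre_def)

lemma chi_range: "chi x = 0 \<or> chi x = \<omega> ^ 0 \<or> chi x = \<omega> ^ 1 \<or> chi x = \<omega> ^ 2"
  by (simp add: chi_def)

lemma sum_fibre:
  "(\<Sum>x\<in>{0..<int p}. if x \<in> fibre k then c else 0) = of_nat (card (fibre k)) * (c :: complex)"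
proof -
  have "{0..<int p} \<inter> fibre k = fibre k" by (auto simp: fibre_def)
  then show ?thesis by (simp add: sum.If_cases)
qed

lemma jacobi_sum_eq:
  "jacobi_sum = of_nat (card (fibre 0)) + of_nat (card (fibre 1)) * \<omega> + of_nat (card (fibre 2)) * \<omega>^2"
proof -
  have "jacobi_sum = (\<Sum>x\<in>{0..<int p}. (if x \<in> fibre 0 then 1 else 0) + (if x \<in> fibre 1 then \<omega> else 0)
     + (if x \<in> fibre 2 then \<omega>^2 else 0))"
    unfolding jacobi_sum_def
  proof (rule sum.cong[OF refl])
    fix x assume x: "x \<in> {0..<int p}"
    show "chi (x * (1 - x)) = (if x \<in> fibre 0 then 1 else 0) + (if x \<in> fibre 1 then \<omega> else 0)
     + (if x \<in> fibre 2 then \<omega>^2 else 0)"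
      using chi_range[of "x * (1 - x)"] x omega_ne omega_ne_1 by (auto simp: fibre_def)
  qed
  also have "\<dots> = (\<Sum>x\<in>{0..<int p}. if x \<in> fibre 0 then 1 else 0) +
    (\<Sum>x\<in>{0..<int p}. if x \<in> fibre 1 then \<omega> else 0) + (\<Sum>x\<in>{0..<int p}. if x \<in> fibre 2 then \<omega>^2 else 0)"
    by (simp add: sum.distrib)
  also have "\<dots> = of_nat (card (fibre 0)) + of_nat (card (fibre 1)) * \<omega> + of_nat (card (fibre 2)) * \<omega>^2"
    by (simp only: sum_fibre mult_1_right)
  finally show ?thesis .
qed

text \<open>Eliminating \<omega>^2 = -1 - \<omega> writes the Jacobi sum as a + b \<omega>, and a^2
  - a b + b^2 is the norm of such an element.\<close>

lemma p_eq_norm: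
  "int p = (int (card (fibre 0)) - int (card (fibre 2)))^2
     - (int (card (fibre 0)) - int (card (fibre 2))) * (int (card (fibre 1)) - int (card (fibre 2)))
     + (int (card (fibre 1)) - int (card (fibre 2)))^2"
  (is "_ = ?a^2 - ?a * ?b + ?b^2")
proof -
  have "\<omega>^2 = (\<omega>^2 + \<omega> + 1) - 1 - \<omega>" by simp
  then have w2: "\<omega>^2 = - 1 - \<omega>" unfolding omega by simp
  have J: "jacobi_sum = of_int ?a + of_int ?b * \<omega>"
    unfolding jacobi_sum_eq w2 by (simp add: algebra_simps)
  have "complex_of_int (int p) = jacobi_sum * cnj jacobi_sum" using jacobi_sum_norm by simp
  also have "\<dots> = (of_int ?a + of_int ?b * \<omega>) * (of_int ?a + of_int ?b * (- 1 - \<omega>))"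
    unfolding J by (simp add: cnj_omega w2)
  also have "\<dots> = of_int (?a^2 - ?a * ?b + ?b^2) - of_int ?b^2 * (\<omega>^2 + \<omega> + 1)"
    by (simp add: power2_eq_square algebra_simps)
  also have "\<dots> = of_int (?a^2 - ?a * ?b + ?b^2)" by (simp add: omega)
  finally show ?thesis by (metis of_int_eq_iff)
qed

lemma fibre_residue: "x \<in> fibre k \<Longrightarrow> x \<in> {1..<int p} \<and> \<not> int p dvd x \<and> \<not> int p dvd 1 - x"
proof -
  assume x: "x \<in> fibre k"
  then have "chi (x * (1 - x)) \<noteq> 0" using omega_ne(2) by (simp add: fibre_def)
  then have "\<not> int p dvd x \<and> \<not> int p dvd 1 - x" by (metis chi_dvd pdvd_mult)
  then show ?thesis using x by (cases "x = 0") (auto simp: fibre_def)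
qed

lemma chi_minus_1: "chi (-1) = 1"
proof -
  have "chi (-1) = chi (-1) * (chi (-1) * chi (-1))"
    unfolding chi_mult[symmetric] by simp
  also have "\<dots> = chi (-1) ^ 3" by (simp add: power3_eq_cube mult.assoc)
  also have "\<dots> = 1" by (rule chi_cubed) (use p_gt_3 in \<open>auto dest: zdvd_imp_le\<close>)
  finally show ?thesis .
qed

lemma chi_minus [simp]: "chi (- x) = chi x"
  using chi_mult[of "-1" x] chi_minus_1 by simp

text \<open>The map \<open>x \<mapsto> 1/(1 - x)\<close> has order 3 and multiplies \<open>x (1 - x)\<close> by a cube; its fixed points
  satisfy \<open>x (1 - x) = 1\<close>.\<close>

lemma three_dvd_fibre:
  assumes "k \<in> {1, 2}"
  shows "3 dvd card (fibre k)"
proof (rule card_dvd_3_if_fixpoint_free)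
  define f where "f x = inv_p (1 - x) mod int p" for x
  have fc: "[f x * (1 - x) = 1] (mod int p)" if "\<not> int p dvd 1 - x" for x
  proof -
    have "[f x * (1 - x) = inv_p (1 - x) * (1 - x)] (mod int p)"
      unfolding f_def by (intro cong_mult cong_refl) (simp add: unique_euclidean_semiring_class.cong_def)
    then show ?thesis using inv_p[OF that] by (metis cong_trans mult.commute)
  qed
  have frange: "f x \<in> {0..<int p}" for x using p_gt_3 by (simp add: f_def)
  have step: "\<not> int p dvd f x \<and> [(1 - f x) * (1 - x) = - x] (mod int p)" if "\<not> int p dvd 1 - x" for x
  proof -
    have "int p dvd f x * (1 - x) - 1" using fc[OF that] by (simp add: cong_iff_dvd_diff)
    moreover have "\<not> int p dvd 1" using p_gt_3 by (auto dest: zdvd_imp_le)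
    ultimately have "\<not> int p dvd f x" by (metis dvd_mult2 dvd_diff_right_iff)
    moreover have "(1 - f x) * (1 - x) - (- x) = - (f x * (1 - x) - 1)" by (simp add: algebra_simps)
    then have "[(1 - f x) * (1 - x) = - x] (mod int p)"
      using \<open>int p dvd f x * (1 - x) - 1\<close> by (simp only: cong_iff_dvd_diff dvd_minus_iff)
    ultimately show ?thesis by simp
  qed
  fix x assume x: "x \<in> fibre k"
  note r = fibre_residue[OF x]
  have r1: "\<not> int p dvd 1 - x" using r by simp
  have r2: "\<not> int p dvd 1 - f x"
  proof
    assume "int p dvd 1 - f x"
    then have "int p dvd (1 - f x) * (1 - x)" by simp
    then have "int p dvd - x" using step[OF r1] cong_dvd_iff by blast
    then show False using r by simp
  qed
  show "f x \<in> fibre k"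
  proof -
    have "[(f x * (1 - f x)) * (1 - x) ^ 3 = (f x * (1 - x)) * ((1 - f x) * (1 - x)) * (1 - x)] (mod int p)"
      by (simp add: power3_eq_cube algebra_simps)
    also have "[(f x * (1 - x)) * ((1 - f x) * (1 - x)) * (1 - x) = 1 * (- x) * (1 - x)] (mod int p)"
      by (intro cong_mult cong_refl fc[OF r1]) (use step[OF r1] in blast)
    finally have "chi ((f x * (1 - f x)) * (1 - x) ^ 3) = chi (-1 * (x * (1 - x)))"
      by (intro chi_cong) (simp add: algebra_simps)
    then have "chi (f x * (1 - f x)) * chi (1 - x) ^ 3 = chi (x * (1 - x))"
      by (simp add: chi_mult power3_eq_cube)
    then have "chi (f x * (1 - f x)) = chi (x * (1 - x))" using chi_cubed[OF r1] by simp
    then show ?thesis using x frange by (simp add: fibre_def)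
  qed
  show "f (f (f x)) = x"
  proof -
    have s1: "[f x * (1 - x) = 1] (mod int p)" by (rule fc[OF r1])
    have s2: "[f (f x) * (1 - f x) = 1] (mod int p)" by (rule fc[OF r2])
    have "[(f (f x) * (1 - f x)) * (1 - x) = 1 * (1 - x)] (mod int p)"
      by (intro cong_mult cong_refl s2)
    moreover have "[f (f x) * ((1 - f x) * (1 - x)) = f (f x) * (- x)] (mod int p)"
      by (intro cong_mult cong_refl) (use step[OF r1] in blast)
    ultimately have "[f (f x) * (- x) = 1 - x] (mod int p)"
      by (metis cong_sym cong_trans mult.assoc mult_1)
    then have "int p dvd f (f x) * (- x) - (1 - x)" by (simp add: cong_iff_dvd_diff)
    then have "int p dvd (1 - f (f x)) * x - 1" by (simp add: algebra_simps)
    then have s3: "[(1 - f (f x)) * x = 1] (mod int p)" by (simp add: cong_iff_dvd_diff)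
    have r3: "\<not> int p dvd 1 - f (f x)"
    proof
      assume "int p dvd 1 - f (f x)"
      then have "int p dvd (1 - f (f x)) * x" by simp
      then have "int p dvd 1" using s3 cong_dvd_iff by blast
      then show False using p_gt_3 by (auto dest: zdvd_imp_le)
    qed
    let ?g = "1 - f (f x)"
    have "[f (f (f x)) * (?g * x) = f (f (f x)) * 1] (mod int p)"
      by (intro cong_mult cong_refl s3)
    moreover have "[(f (f (f x)) * ?g) * x = 1 * x] (mod int p)"
      by (intro cong_mult cong_refl fc[OF r3])
    ultimately have "[f (f (f x)) = x] (mod int p)"
      by (metis cong_sym cong_trans mult.assoc mult_1 mult_1_right)
    then show ?thesis using frange[of "f (f x)"] r by (simp add: unique_euclidean_semiring_class.cong_def)
  qed
  show "f x \<noteq> x"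
  proof
    assume "f x = x"
    then have "chi (x * (1 - x)) = 1" using chi_cong[OF fc[OF r1]] by simp
    then show False using x assms omega_ne_1 by (auto simp: fibre_def)
  qed
qed simp

text \<open>The involution x -> 1 - x preserves x (1 - x), and its only fixed point is h = 1/2.
  Since 8 h (1 - h) = 2 and 8 is a cube, h lies in the fibre of the value \<open>chi 2\<close>,
  which is therefore the only fibre of odd size.\<close>

lemma even_fibre_iff:
  assumes "k < 3"
  shows "even (card (fibre k)) \<longleftrightarrow> chi 2 \<noteq> \<omega> ^ k"
proof -
  have podd: "odd p" using prime_p p_gt_3 prime_odd_nat by simp
  define h where "h = (int p + 1) div 2"
  have h2: "2 * h = int p + 1" unfolding h_def using podd by (intro dvd_mult_div_cancel) simp
  have h: "h \<in> {0..<int p}" using h2 p_gt_3 by simp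
  have p2: "\<not> int p dvd 2" using p_gt_3 by (auto dest: zdvd_imp_le)
  have "chi (h * (1 - h)) = chi 2"
  proof -
    have "[8 * (h * (1 - h)) = 2] (mod int p)"
    proof -
      have "8 * (h * (1 - h)) - 2 = (2 * h) * (4 - 2 * (2 * h)) - 2" by (simp add: algebra_simps)
      also have "\<dots> = int p * (- 2 * int p)" unfolding h2 by (simp add: algebra_simps)
      finally show ?thesis by (simp add: cong_iff_dvd_diff)
    qed
    from chi_cong[OF this] have "chi (2 * (2 * 2)) * chi (h * (1 - h)) = chi 2" by (simp add: chi_mult)
    moreover have "chi (2 * (2 * 2)) = chi 2 ^ 3" unfolding chi_mult by (simp add: power3_eq_cube)
    ultimately show ?thesis using chi_cubed[OF p2] by simp
  qed
  then have hf: "h \<in> fibre k \<longleftrightarrow> chi 2 = \<omega> ^ k" using h by (simp add: fibre_def)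
  have "even (card (fibre k - {h}))"
  proof (rule even_card_if_fixpoint_free)
    fix x assume x: "x \<in> fibre k - {h}"
    then have r: "x \<in> {1..<int p}" "\<not> int p dvd x" "\<not> int p dvd 1 - x" using fibre_residue[of x k] by auto
    then have "x \<noteq> 1" by auto
    \<comment> \<open>This representative of 1 - x stays in the range of residues because x is
      neither 0 nor 1.\<close>
    define x' where "x' = int p + 1 - x"
    have x': "x' \<in> {0..<int p}" using r \<open>x \<noteq> 1\<close> by (auto simp: x'_def)
    have "[x' * (1 - x') = x * (1 - x)] (mod int p)"
    proof -
      have "x' * (1 - x') - x * (1 - x) = int p * (2 * x - int p - 1)"
        unfolding x'_def by (simp add: algebra_simps)
      then show ?thesis by (simp add: cong_iff_dvd_diff)
    qed
    then have "x' \<in> fibre k" using x x' chi_cong by (simp add: fibre_def)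
    moreover have "x' \<noteq> h" using x h2 by (auto simp: x'_def)
    ultimately show "int p + 1 - x \<in> fibre k - {h}" by (simp add: x'_def)
    show "int p + 1 - (int p + 1 - x) = x" by simp
    show "int p + 1 - x \<noteq> x" using x h2 by auto
  qed simp
  then show ?thesis using hf by (cases "h \<in> fibre k") (auto simp: card_Diff_singleton_if card_gt_0_iff)
qed

text \<open>Gauss's criterion for 2 to be a cubic residue. The coefficient b of \<omega> in the
  Jacobi sum is divisible by 3, which gives 4 p = (2 a - b)^2 + 27 (b/3)^2, and the parities of the
  fibres show that b is even exactly if \<open>chi 2 = 1\<close>. An even b yields a representation
  of p itself; conversely, a representation of p forces b to be even by the descent with n =
  1.\<close>

lemma chi_2_iff: "chi 2 = 1 \<longleftrightarrow> (\<exists>u v :: int. int p = u^2 + 27 * v ^ 2)"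
proof -
  define a b where "a = int (card (fibre 0)) - int (card (fibre 2))"
    and "b = int (card (fibre 1)) - int (card (fibre 2))"
  have p: "int p = a^2 - a * b + b^2" using p_eq_norm by (simp add: a_def b_def)
  have "3 dvd b" using three_dvd_fibre[of 1] three_dvd_fibre[of 2]
    by (auto simp: b_def intro!: dvd_diff)
  then obtain c where c: "b = 3 * c" by blast
  have p4: "4 * int p * int 1 = (2 * a - b)^2 + 27 * c^2"
    using p c by (simp add: power2_eq_square algebra_simps)
  show ?thesis
  proof
    assume "chi 2 = 1"
    then have "even b" using even_fibre_iff[of 1] even_fibre_iff[of 2] omega_ne_1
      by (simp add: b_def)
    then have "even c" using c by simp
    then obtain v where v: "c = 2 * v" by blast
    have "int p = (a - 3 * v)^2 + 27 * v ^ 2"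
      using p c v by (simp add: power2_eq_square algebra_simps)
    then show "\<exists>u v :: int. int p = u^2 + 27 * v ^ 2" by blast
  next
    assume "\<exists>u v :: int. int p = u^2 + 27 * v ^ 2"
    then obtain u v where uv: "int p = u^2 + 27 * v ^ 2" by blast
    have "even (2 * a - b)"
    proof (rule ccontr)
      assume "odd (2 * a - b)"
      from descent_odd[OF prime_p uv p4 this] show False using descent_base by fastforce
    qed
    then have "even b" by simp
    have p2: "\<not> int p dvd 2" using p_gt_3 by (auto dest: zdvd_imp_le)
    show "chi 2 = 1"
    proof (rule ccontr)
      assume "chi 2 \<noteq> 1"
      then have "chi 2 = \<omega> \<or> chi 2 = \<omega>^2"
        using chi_range[of 2] chi_cubed[of 2] p2 by auto
      then have "odd b" using even_fibre_iff[of 1] even_fibre_iff[of 2] omega_ne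
        by (auto simp: b_def)
      then show False using \<open>even b\<close> by simp
    qed
  qed
qed


section \<open>Counting the cube roots of 2 modulo p\<close>

lemma card_cube_roots_2:
  "card {r \<in> {0..<int p}. [r^3 = 2] (mod int p)} = (if chi 2 = 1 then 3 else 0)"
proof (cases "chi 2 = 1")
  case False
  have p2: "\<not> int p dvd 2" using p_gt_3 by (auto dest: zdvd_imp_le)
  have "\<not> [r^3 = 2] (mod int p)" for r
  proof
    assume r: "[r^3 = 2] (mod int p)"
    then have "\<not> int p dvd r^3" using p2 cong_dvd_iff by blast
    then have "\<not> int p dvd r" by (meson dvd_power_iff_le dvd_power dvd_trans zero_less_numeral)
    then have "chi (r * r * r) = 1" using chi_cubed[of r] by (simp add: chi_mult power3_eq_cube)
    then show False using False chi_cong[OF r] by (simp add: power3_eq_cube)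
  qed
  then show ?thesis using False by simp
next
  case True
  have p2: "\<not> int p dvd 2" using p_gt_3 by (auto dest: zdvd_imp_le)
  obtain g :: nat where g: "\<And>x. \<not> int p dvd x \<Longrightarrow> \<exists>k. [x = int g ^ k] (mod int p)"
    "\<And>k. [int g ^ k = 1] (mod int p) \<longleftrightarrow> p - 1 dvd k"
    using prime_generator[OF prime_p] by metis
  obtain k where k: "[2 = int g ^ k] (mod int p)" using g(1) p2 by blast
  have "[2 ^ m = 1] (mod int p)"
  proof (rule ccontr)
    assume "\<not> [2 ^ m = 1] (mod int p)"
    then show False using True p2 omega_ne_1 by (auto simp: chi_def split: if_splits)
  qed
  moreover have "[2 ^ m = int g ^ (k * m)] (mod int p)"
    using cong_pow[OF k, of m] by (simp add: power_mult)
  ultimately have "[int g ^ (k * m) = 1] (mod int p)" using cong_sym cong_trans by blast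
  then have "p - 1 dvd k * m" using g(2) by blast
  then have "3 dvd k" using p_eq m_pos by simp
  then obtain j where j: "k = 3 * j" by blast
  define r where "r = int g ^ j"
  have r3: "[r^3 = 2] (mod int p)" using k j by (simp add: r_def power_mult[symmetric] mult.commute cong_sym_eq)
  have rnd: "\<not> int p dvd r"
  proof
    assume "int p dvd r"
    then have "int p dvd r^3" by (simp add: power3_eq_cube)
    then show False using r3 p2 cong_dvd_iff by blast
  qed
  have s: "int p dvd w^2 + w + 1" using w_cong by (simp add: cong_0_iff)
  have p0: "int p > 0" using p_gt_3 by simp
  have cop: "coprime r (int p)" using prime_p rnd
    by (metis coprime_commute prime_imp_coprime prime_nat_int_transfer)
  have "{x \<in> {0..<int p}. [x^3 = 2] (mod int p)} = {r mod int p, (r * w) mod int p, (r * w^2) mod int p}"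
    (is "?A = ?B")
  proof (intro equalityI subsetI)
    fix x assume x: "x \<in> ?A"
    then have "[x^3 = r^3] (mod int p)" using r3 cong_sym cong_trans by blast
    then have d: "int p dvd x^3 - r^3" by (simp add: cong_iff_dvd_diff)
    have "(x - r) * ((x - r * w) * (x - r * w^2))
        = (x^3 - r^3) + (w^2 + w + 1) * (w * r^2 * x - r * x^2 - (w - 1) * r^3)"
      by Groebner_Basis.algebra
    then have "int p dvd (x - r) * ((x - r * w) * (x - r * w^2))" using s d by simp
    then have "[x = r] (mod int p) \<or> [x = r * w] (mod int p) \<or> [x = r * w^2] (mod int p)"
      unfolding pdvd_mult by (auto simp: cong_iff_dvd_diff)
    then show "x \<in> ?B" using x by (auto simp: unique_euclidean_semiring_class.cong_def)
  next
    fix x assume "x \<in> ?B"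
    then obtain e where e: "x = (r * w ^ e) mod int p"
      by (metis insert_iff empty_iff mult_1_right power_0 power_one_right)
    have "[x^3 = (r * w ^ e)^3] (mod int p)" unfolding e by (intro cong_pow) (simp add: unique_euclidean_semiring_class.cong_def)
    also have "(r * w ^ e)^3 = r^3 * (w^3) ^ e" by (simp add: power_mult_distrib power_mult[symmetric] mult.commute)
    also have "[r^3 * (w^3) ^ e = 2 * 1 ^ e] (mod int p)" by (intro cong_mult cong_pow r3 w_cubed)
    finally show "x \<in> ?A" using p0 by (simp add: e)
  qed
  moreover have "card ?B = 3"
  proof -
    have ne: "(r * a) mod int p \<noteq> (r * b) mod int p" if "\<not> [a = b] (mod int p)" for a b
      using that cop cong_mult_lcancel[of r "int p" a b] by (auto simp: unique_euclidean_semiring_class.cong_def)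
    have "r mod int p \<noteq> (r * w) mod int p" "r mod int p \<noteq> (r * w^2) mod int p"
      "(r * w) mod int p \<noteq> (r * w^2) mod int p"
      using ne[of 1 w] ne[of 1 "w^2"] ne[of w "w^2"] w_nondvd by (simp_all add: cong_sym_eq)
    then show ?thesis by simp
  qed
  ultimately show ?thesis using True by simp
qed

end

text \<open>For a primitive root g the power w = g^m has order 3, so w - 1 is invertible and w^2 + w
  + 1 vanishes modulo p.\<close>

lemma cubic_character_exists:
  assumes "prime p" "[p = 1] (mod 3)"
  obtains m w \<omega> where "cubic_character p m w \<omega>"
proof -
  define m where "m = p div 3"
  have p: "p = 3 * m + 1" using assms(2) by (simp add: unique_euclidean_semiring_class.cong_def m_def) presburger
  obtain g :: nat where g: "\<And>k. [int g ^ k = 1] (mod int p) \<longleftrightarrow> p - 1 dvd k"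
    using prime_generator[OF assms(1)] by metis
  have "m > 0" using p prime_gt_1_nat[OF assms(1)] by presburger
  have "cubic_character p m (int g ^ m) (Complex (-1/2) (sqrt 3 / 2))"
  proof
    show "prime p" "p = 3 * m + 1" by fact+
    show "\<exists>h. [h ^ m = int g ^ m] (mod int p)" by (rule exI[of _ "int g"]) simp
    show "(Complex (-1/2) (sqrt 3 / 2))^2 + Complex (-1/2) (sqrt 3 / 2) + 1 = 0"
      by (simp add: complex_eq_iff power2_eq_square)
    have "[int g ^ (3 * m) = 1] (mod int p)" using g p by simp
    then have "int p dvd int g ^ (3 * m) - 1" by (simp add: cong_iff_dvd_diff)
    also have "int g ^ (3 * m) - 1 = (int g ^ m)^3 - 1" by (simp add: power_mult[symmetric] mult.commute)
    also have "\<dots> = (int g ^ m - 1) * ((int g ^ m)^2 + int g ^ m + 1)" by Groebner_Basis.algebra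
    finally have "int p dvd int g ^ m - 1 \<or> int p dvd (int g ^ m)^2 + int g ^ m + 1"
      using assms(1) by (simp add: prime_dvd_mult_iff)
    moreover have "\<not> int p dvd int g ^ m - 1"
    proof
      assume "int p dvd int g ^ m - 1"
      then have "p - 1 dvd m" using g by (simp add: cong_iff_dvd_diff)
      then show False using \<open>m > 0\<close> p by (auto dest: dvd_imp_le)
    qed
    ultimately show "[(int g ^ m)^2 + int g ^ m + 1 = 0] (mod int p)" by (simp add: cong_0_iff)
  qed
  then show thesis using that by blast
qed

theorem card_cube_roots_2_one_mod_3:
  assumes "prime p" "[p = 1] (mod 3)"
  shows "card {r \<in> {0..<int p}. [r^3 = 2] (mod int p)}
    = (if \<exists>u v :: int. int p = u^2 + 27 * v ^ 2 then 3 else 0)"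
proof -
  obtain m w \<omega> where "cubic_character p m w \<omega>" using cubic_character_exists[OF assms] .
  then interpret cubic_character p m w \<omega> .
  show ?thesis using card_cube_roots_2 chi_2_iff by simp
qed

theorem card_cube_roots_2_two_mod_3:
  assumes "prime p" "[p = 2] (mod 3)"
  shows "card {r \<in> {0..<int p}. [r^3 = 2] (mod int p)} = 1"
proof -
  have "p mod 3 = 2" using assms(2) by (simp add: unique_euclidean_semiring_class.cong_def)
  then obtain k where k: "p = 3 * k + 2" by (metis div_mult_mod_eq mult.commute)
  \<comment> \<open>Cubing is inverted by the e-th power, because 3 e is 1 modulo p - 1.\<close>
  define e where "e = 2 * k + 1"
  have e: "3 * e = 2 * (p - 1) + 1" unfolding e_def k by simp
  have p0: "int p > 0" using assms(1) prime_gt_0_nat by simp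
  have pw: "[x ^ (3 * e) = x] (mod int p)" for x
  proof (cases "int p dvd x")
    case True
    moreover have "int p dvd x ^ (3 * e)" using True e by simp
    ultimately show ?thesis by (metis cong_0_iff cong_sym cong_trans)
  next
    case False
    have "[(x ^ (p - 1))^2 * x = 1^2 * x] (mod int p)"
      by (intro cong_mult cong_pow cong_refl fermat_int assms False)
    moreover have "x ^ (3 * e) = (x ^ (p - 1))^2 * x"
      unfolding e by (simp add: power_mult[symmetric] mult.commute)
    ultimately show ?thesis by simp
  qed
  have "{r \<in> {0..<int p}. [r^3 = 2] (mod int p)} = {2 ^ e mod int p}"
  proof (intro equalityI subsetI)
    fix r assume r: "r \<in> {r \<in> {0..<int p}. [r^3 = 2] (mod int p)}"
    then have "[(r^3) ^ e = 2 ^ e] (mod int p)" by (intro cong_pow) simp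
    then have "[r = 2 ^ e] (mod int p)" using pw[of r] by (metis cong_sym cong_trans power_mult)
    then show "r \<in> {2 ^ e mod int p}" using r by (simp add: unique_euclidean_semiring_class.cong_def)
  next
    fix r assume "r \<in> {2 ^ e mod int p}"
    then have r: "r = 2 ^ e mod int p" by simp
    have "[r^3 = (2 ^ e)^3] (mod int p)" unfolding r by (intro cong_pow) (simp add: unique_euclidean_semiring_class.cong_def)
    also have "(2 ^ e)^3 = (2 :: int) ^ (3 * e)" by (simp add: power_mult[symmetric] mult.commute)
    also have "[\<dots> = 2] (mod int p)" by (rule pw)
    finally show "r \<in> {r \<in> {0..<int p}. [r^3 = 2] (mod int p)}" using r p0 by simp
  qed
  then show ?thesis by simp
qed

section \<open>Cyclotomic norms and primes with prescribed cubic residuacity\<close>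

text \<open>The target ring is arbitrary because the same integer polynomial is evaluated at complex
  roots of unity and at roots of unity in characteristic 2; the polynomial carries statements from
  one side to the other.\<close>

definition ev :: "int poly \<Rightarrow> 'a :: comm_ring_1 \<Rightarrow> 'a" where
  "ev P z = poly (map_poly of_int P) z"

lemma ev_0 [simp]: "ev 0 z = 0" by (simp add: ev_def)

lemma ev_pCons [simp]: "ev (pCons a P) z = of_int a + z * ev P z"
  by (simp add: ev_def map_poly_pCons)

lemma ev_1 [simp]: "ev 1 z = 1" by (simp add: one_pCons)

lemma ev_add [simp]: "ev (P + Q) z = ev P z + ev Q z"
proof (induction P arbitrary: Q)
  case (pCons a P)
  obtain b R where Q: "Q = pCons b R" by (cases Q)
  have "ev (pCons a P + Q) z = of_int (a + b) + z * ev (P + R) z" unfolding Q by simp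
  then show ?case unfolding Q pCons.IH by (simp add: algebra_simps)
qed simp

lemma ev_uminus [simp]: "ev (- P) z = - ev P z"
  by (metis add.right_inverse add_eq_0_iff ev_0 ev_add)

lemma ev_diff [simp]: "ev (P - Q) z = ev P z - ev Q z"
  using ev_add[of P "- Q" z] by simp

lemma ev_smult [simp]: "ev (smult a P) z = of_int a * ev P z"
  by (induction P) (simp_all add: algebra_simps)

lemma ev_mult [simp]: "ev (P * Q) z = ev P z * ev Q z"
  by (induction P) (simp_all add: algebra_simps)

lemma ev_power [simp]: "ev (P ^ n) z = ev P z ^ n"
  by (induction n) simp_all

lemma ev_prod [simp]: "ev (\<Prod>i\<in>A. f i) z = (\<Prod>i\<in>A. ev (f i) z)"
  by (induction A rule: infinite_finite_induct) simp_all

lemma ev_sum [simp]: "ev (\<Sum>i\<in>A. f i) z = (\<Sum>i\<in>A. ev (f i) z)"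
  by (induction A rule: infinite_finite_induct) simp_all

lemma ev_monom [simp]: "ev (monom a n) z = of_int a * z ^ n"
  by (induction n) (simp_all add: monom_Suc monom_0 algebra_simps)

lemma ev_of_int [simp]: "ev (of_int a) z = of_int a"
  by (simp add: of_int_poly)

lemma ev_of_nat [simp]: "ev (of_nat a) z = of_nat a"
  by (simp add: of_nat_poly)

lemma ev_numeral [simp]: "ev (numeral n) z = numeral n"
  using ev_of_int[of "numeral n" z] by simp

lemma ev_cnj: "ev P (cnj z) = cnj (ev P z)"
  by (induction P) simp_all

lemma ev_altdef: "ev P z = (\<Sum>k\<le>degree P. of_int (coeff P k) * z ^ k)"
proof -
  have "ev P z = ev (\<Sum>k\<le>degree P. monom (coeff P k) k) z"
    by (simp only: poly_as_sum_of_monoms)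
  then show ?thesis by simp
qed

text \<open>On values at a root of unity z this is the conjugation z -> z^k; for a prime k it is
  also the Frobenius lift on Z[X].\<close>

definition subst_power :: "nat \<Rightarrow> int poly \<Rightarrow> int poly" where
  "subst_power k P = pcompose P (monom 1 k)"

lemma ev_subst_power [simp]: "ev (subst_power k P) z = ev P (z ^ k)"
  unfolding subst_power_def
  by (induction P) (simp_all add: pcompose_pCons)

lemma subst_power_pCons: "subst_power k (pCons a P) = [:a:] + monom 1 k * subst_power k P"
  by (simp add: subst_power_def pcompose_pCons)

lemma subst_power_add_of_nat_mult:
  "subst_power k (P + of_nat p * Q) - subst_power k P = of_nat p * subst_power k Q"
  by (simp add: subst_power_def pcompose_add of_nat_poly pcompose_smult)

section \<open>Congruences for products and the Frobenius lift\<close>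

lemma dvd_prod_diff:
  fixes f g :: "'b \<Rightarrow> 'a :: comm_ring_1"
  assumes "\<And>i. i \<in> A \<Longrightarrow> k dvd f i - g i"
  shows "k dvd prod f A - prod g A"
  using assms
proof (induction A rule: infinite_finite_induct)
  case (insert x A)
  have "prod f (insert x A) - prod g (insert x A)
      = (f x - g x) * prod f A + g x * (prod f A - prod g A)"
    using insert by (simp add: algebra_simps)
  also have "k dvd \<dots>" using insert by (intro dvd_add dvd_mult dvd_mult2) auto
  finally show ?case .
qed simp_all

lemma dvd_power_diff:
  fixes a b :: "'a :: comm_ring_1"
  assumes "k dvd a - b"
  shows "k dvd a ^ n - b ^ n"
  using dvd_prod_diff[of "{..<n}" k "\<lambda>_. a" "\<lambda>_. b"] assms by simp

lemma prime_dvd_power_add: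
  fixes a b :: "'a :: comm_ring_1"
  assumes "prime p"
  shows "of_nat p dvd (a + b) ^ p - (a ^ p + b ^ p)"
proof -
  have p1: "p > 1" using assms prime_gt_1_nat by simp
  have "(a + b) ^ p = (\<Sum>k\<le>p. of_nat (p choose k) * a ^ k * b ^ (p - k))"
    by (rule binomial_ring)
  also have "{..p} = insert 0 (insert p {1..<p})" using p1 by auto
  also have "(\<Sum>k\<in>\<dots>. of_nat (p choose k) * a ^ k * b ^ (p - k))
     = b ^ p + (a ^ p + (\<Sum>k\<in>{1..<p}. of_nat (p choose k) * a ^ k * b ^ (p - k)))"
    using p1 by (subst sum.insert; simp)+
  finally have "(a + b) ^ p - (a ^ p + b ^ p)
     = (\<Sum>k\<in>{1..<p}. of_nat (p choose k) * a ^ k * b ^ (p - k))" by simp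
  also have "of_nat p dvd \<dots>"
  proof (rule dvd_sum)
    fix k assume "k \<in> {1..<p}"
    then have "p dvd p choose k" using assms by (intro dvd_choose_prime) auto
    then have "(of_nat p :: 'a) dvd of_nat (p choose k)" by (auto simp: dvd_def)
    then show "(of_nat p :: 'a) dvd of_nat (p choose k) * a ^ k * b ^ (p - k)" by simp
  qed
  finally show ?thesis .
qed

lemma fermat_dvd:
  assumes "prime p"
  shows "int p dvd a ^ p - a"
proof -
  have nat: "int p dvd int n ^ p - int n" for n
  proof (induction n)
    case 0 then show ?case using assms prime_gt_0_nat by (simp add: power_0_left)
  next
    case (Suc n)
    have "int p dvd ((int n + 1) ^ p - (int n ^ p + 1 ^ p)) + (int n ^ p - int n)"
      using prime_dvd_power_add[OF assms, of "int n" 1] Suc by (intro dvd_add) simp_all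
    then show ?case by (simp add: algebra_simps)
  qed
  have p0: "int p > 0" using assms prime_gt_0_nat by simp
  have r: "a mod int p = int (nat (a mod int p))" using p0 by simp
  have 1: "int p dvd a - a mod int p" by (metis dvd_minus_mod)
  have 2: "int p dvd a ^ p - (a mod int p) ^ p" by (rule dvd_power_diff) (rule 1)
  have 3: "int p dvd (a mod int p) ^ p - a mod int p" using nat[of "nat (a mod int p)"] r by simp
  show ?thesis using dvd_diff[OF dvd_add[OF 2 3] 1] by simp
qed

text \<open>Induction on the coefficients: the p-th power is additive modulo p and fixes constants
  modulo p by Fermat.\<close>

lemma frobenius_poly:
  assumes "prime p"
  shows "of_nat p dvd P ^ p - subst_power p P"
proof (induction P)
  case 0
  then show ?case using assms prime_gt_0_nat by (simp add: subst_power_def power_0_left)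
next
  case (pCons a P)
  let ?X = "monom 1 1 :: int poly"
  have eq: "pCons a P = [:a:] + ?X * P" by (simp add: monom_altdef)
  have "of_nat p dvd ([:a:] + ?X * P) ^ p - ([:a:] ^ p + (?X * P) ^ p)"
    by (rule prime_dvd_power_add[OF assms])
  moreover have "of_nat p dvd [:a:] ^ p - [:a:]"
  proof -
    obtain k where "a ^ p - a = int p * k" using fermat_dvd[OF assms] by (auto simp: dvd_def)
    then have "[:a:] ^ p - [:a:] = of_nat p * [:k:]"
      by (simp add: poly_const_pow of_nat_poly)
    then show ?thesis by (metis dvd_triv_left)
  qed
  moreover have "of_nat p dvd monom 1 p * (P ^ p - subst_power p P)" using pCons.IH by simp
  ultimately have "of_nat p dvd (([:a:] + ?X * P) ^ p - ([:a:] ^ p + (?X * P) ^ p))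
     + ([:a:] ^ p - [:a:]) + monom 1 p * (P ^ p - subst_power p P)"
    by (intro dvd_add)
  also have "\<dots> = pCons a P ^ p - subst_power p (pCons a P)"
    unfolding eq[symmetric] subst_power_pCons
    by (simp add: power_mult_distrib monom_power algebra_simps)
  finally show ?case .
qed

text \<open>A monic divisor allows division without leaving the coefficient ring. Over Z this keeps
  the quotient an integer polynomial, which can then be evaluated in characteristic 2.\<close>

lemma monic_division:
  fixes g :: "'a :: comm_ring_1 poly"
  assumes "lead_coeff g = 1" "degree g > 0"
  shows "\<exists>q r. f = g * q + r \<and> degree r < degree g"
proof (induction "degree f" arbitrary: f rule: less_induct)
  case less
  show ?case
  proof (cases "degree f < degree g")
    case True
    then show ?thesis by (intro exI[of _ 0] exI[of _ f]) simp
  next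
    case False
    define t where "t = monom (lead_coeff f) (degree f - degree g)"
    have "degree (g * t) \<le> degree f"
      using degree_mult_le[of g t] degree_monom_le[of "lead_coeff f" "degree f - degree g"] False
      by (simp add: t_def)
    moreover have "coeff (g * t) (degree f) = lead_coeff f"
      using False assms(1) by (simp add: t_def coeff_monom_mult mult.commute[of g])
    ultimately have d: "degree (f - g * t) \<le> degree f" "coeff (f - g * t) (degree f) = 0"
      by (simp_all add: degree_diff_le)
    have "degree (f - g * t) < degree f"
    proof (rule ccontr)
      assume "\<not> degree (f - g * t) < degree f"
      then have "degree (f - g * t) = degree f" using d(1) by simp
      then have "f - g * t = 0" using d(2) by (metis leading_coeff_0_iff)
      then show False using \<open>degree (f - g * t) = degree f\<close> False assms(2) by simp
    qed
    from less[OF this] obtain q r where "f - g * t = g * q + r" "degree r < degree g" by blast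
    then show ?thesis by (intro exI[of _ "t + q"] exI[of _ r]) (simp add: algebra_simps)
  qed
qed

section \<open>Roots of unity of odd order in characteristic 2\<close>

lemma card_roots_of_unity_char_2:
  fixes n :: nat
  assumes char2: "(2 :: 'e :: alg_closed_field) = 0" and "odd n"
  shows "card {x :: 'e. x ^ n = 1} = n"
proof -
  have n0: "n > 0" using assms(2) by (rule odd_pos)
  let ?p = "monom 1 n - 1 :: 'e poly"
  have cn: "coeff ?p n = 1" using n0 by (simp add: coeff_1)
  have deg: "degree ?p = n"
  proof (rule antisym)
    show "degree ?p \<le> n" by (rule degree_diff_le) (simp_all add: degree_monom_le)
    show "n \<le> degree ?p" using cn by (metis le_degree zero_neq_one)
  qed
  have p0: "?p \<noteq> 0" using cn by (metis coeff_0 zero_neq_one)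
  obtain A where A: "size A = n" "?p = (\<Prod>x\<in>#A. [:-x, 1:])"
    using alg_closed_imp_factorization[OF p0] deg cn by auto
  have odd1: "(of_nat n :: 'e) = 1"
  proof -
    obtain k where "n = 2 * k + 1" using assms(2) by (elim oddE)
    then show ?thesis using char2 by simp
  qed
  have ev: "poly ?p x = x ^ n - 1" for x by (simp add: poly_monom)
  \<comment> \<open>A multiple root would be a root of the derivative n X^(n-1); but n is 1 in the
    field, and 0 is not a root of X^n - 1.\<close>
  have count: "count A x \<le> 1" for x
  proof (rule ccontr)
    assume "\<not> count A x \<le> 1"
    then have "x \<in># A" by (metis count_inI le0)
    then obtain A' where A': "A = add_mset x A'" by (metis mset_add)
    then have "count A' x \<noteq> 0" using \<open>\<not> count A x \<le> 1\<close> by simp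
    then have "x \<in># A'" by (metis not_in_iff)
    then obtain B where "A' = add_mset x B" by (metis mset_add)
    then have "A = add_mset x (add_mset x B)" using A' by simp
    then have eq: "?p = [:-x, 1:] * ([:-x, 1:] * (\<Prod>x\<in>#B. [:-x, 1:]))" using A(2) by simp
    have "poly ?p x = 0" unfolding eq by simp
    then have "x ^ n = 1" unfolding ev by simp
    then have "x \<noteq> 0" using n0 by (metis power_0_left less_not_refl zero_neq_one)
    have D: "poly (pderiv (l * (l * Q))) x = 0" if "poly l x = 0" for l Q :: "'e poly"
      using that by (simp add: pderiv_mult)
    have "poly (pderiv ?p) x = 0" unfolding eq by (rule D) simp
    then have "of_nat n * x ^ (n - 1) = 0"
      by (simp add: pderiv_diff pderiv_monom poly_monom pderiv_1)
    then show False using odd1 \<open>x \<noteq> 0\<close> by simp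
  qed
  have "A = mset_set (set_mset A)"
  proof (rule multiset_eqI)
    fix x
    show "count A x = count (mset_set (set_mset A)) x"
    proof (cases "x \<in># A")
      case True
      then have "count A x > 0" by (simp only: count_greater_zero_iff)
      then have "count A x = 1" using count[of x] by linarith
      then show ?thesis using True by (simp only: count_mset_set finite_set_mset)
    qed (simp add: not_in_iff)
  qed
  then have "size A = card (set_mset A)" by (metis size_mset_set)
  moreover have "set_mset A = {x. x ^ n = 1}"
  proof -
    have "poly ?p x = 0 \<longleftrightarrow> x \<in># A" for x
      unfolding A(2) by (simp add: poly_prod_mset prod_mset_zero_iff image_iff)
    then show ?thesis unfolding ev by auto
  qed
  ultimately show ?thesis using A(1) by simp
qed

lemma power_gcd_eq_1:
  fixes x :: "'e :: field"
  assumes "x ^ a = 1" "x ^ b = 1"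
  shows "x ^ gcd a b = 1"
proof (cases "a = 0")
  case False
  then obtain u v where "a * u = b * v + gcd a b" using bezout_nat by blast
  then have "x ^ (a * u) = x ^ (b * v) * x ^ gcd a b" by (metis power_add)
  then show ?thesis using assms by (simp add: power_mult)
qed (use assms in simp)

text \<open>By counting, some root of X^(q^k) - 1 is not a root of X^(q^(k-1)) - 1, and its order
  can only be q^k.\<close>

lemma exact_order_prime_power_char_2:
  assumes "(2 :: 'e :: alg_closed_field) = 0" "prime q" "odd q"
  shows "\<exists>b :: 'e. \<forall>j. b ^ j = 1 \<longleftrightarrow> q ^ k dvd j"
proof (cases "k = 0")
  case False
  let ?A = "\<lambda>i. {x :: 'e. x ^ (q ^ i) = 1}"
  have card: "card (?A i) = q ^ i" for i using card_roots_of_unity_char_2[OF assms(1)] assms(3) by simp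
  have "q > 1" using assms(2) prime_gt_1_nat by simp
  have "card (?A (k - 1)) < card (?A k)" unfolding card using False \<open>q > 1\<close> by simp
  moreover have "finite (?A (k - 1))" using card[of "k - 1"] \<open>q > 1\<close> by (intro card_ge_0_finite) simp
  ultimately have "\<not> ?A k \<subseteq> ?A (k - 1)" using card_mono leD by blast
  then obtain b :: 'e where b: "b ^ (q ^ k) = 1" "b ^ (q ^ (k - 1)) \<noteq> 1" by auto
  have "q ^ k dvd j" if j: "b ^ j = 1" for j
  proof -
    have g: "b ^ gcd j (q ^ k) = 1" using power_gcd_eq_1[OF j b(1)] .
    have "gcd j (q ^ k) dvd q ^ k" by simp
    then obtain i where i: "gcd j (q ^ k) = q ^ i" "i \<le> k"
      using divides_primepow_nat[OF assms(2)] by blast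
    have "i = k"
    proof (rule ccontr)
      assume "i \<noteq> k"
      then have "i \<le> k - 1" using i(2) by simp
      then obtain r where "q ^ (k - 1) = q ^ i * r" using le_imp_power_dvd[of i "k - 1" q] unfolding dvd_def by blast
      then have "b ^ (q ^ (k - 1)) = 1" using g i(1) by (simp add: power_mult)
      then show False using b(2) by simp
    qed
    then show ?thesis using i(1) by (metis gcd_dvd1)
  qed
  moreover have "b ^ j = 1" if "q ^ k dvd j" for j
    using that b(1) by (auto simp: dvd_def power_mult)
  ultimately show ?thesis by blast
qed (auto intro: exI[of _ 1])

text \<open>One prime power is split off at a time: the product of elements of coprime orders has
  the product of the orders as its order.\<close>

lemma exact_order_char_2:
  assumes "(2 :: 'e :: alg_closed_field) = 0" "odd n"
  shows "\<exists>b :: 'e. \<forall>j. b ^ j = 1 \<longleftrightarrow> n dvd j"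
  using assms(2)
proof (induction n rule: less_induct)
  case (less n)
  show ?case
  proof (cases "n = 1")
    case False
    then obtain q where q: "prime q" "q dvd n" using prime_factor_nat by blast
    have n0: "n > 0" using less.prems by (rule odd_pos)
    have "odd q" using q(2) less.prems by (meson dvd_trans)
    define k where "k = multiplicity q n"
    obtain m where m: "n = q ^ k * m" "\<not> q dvd m"
      using multiplicity_decompose'[of n q] n0 q(1) by (metis k_def not_prime_unit not_gr0)
    have "k > 0" using q m by (metis gr0I mult_1 power_0)
    have cop: "coprime (q ^ k) m" using m(2) q(1) by (simp add: prime_imp_coprime)
    have "q ^ k > 1" using \<open>k > 0\<close> q(1) by (intro one_less_power prime_gt_1_nat)
    moreover have "m > 0" using n0 m(1) by simp
    ultimately have "m < n" unfolding m(1) by simp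
    moreover have "odd m" using less.prems m(1) by simp
    ultimately obtain c :: 'e where c: "\<And>j. c ^ j = 1 \<longleftrightarrow> m dvd j" using less.IH by blast
    obtain b :: 'e where b: "\<And>j. b ^ j = 1 \<longleftrightarrow> q ^ k dvd j"
      using exact_order_prime_power_char_2[OF assms(1) q(1) \<open>odd q\<close>] by blast
    have "(b * c) ^ j = 1 \<longleftrightarrow> n dvd j" for j
    proof
      assume "n dvd j"
      then have "q ^ k dvd j" "m dvd j" using m(1) by (metis dvd_mult_left dvd_mult_right)+
      then show "(b * c) ^ j = 1" using b c by (metis mult_1 power_mult_distrib)
    next
      assume j: "(b * c) ^ j = 1"
      have "b ^ (j * m) = 1"
      proof -
        have "((b * c) ^ j) ^ m = b ^ (j * m) * c ^ (j * m)"
          by (simp add: power_mult_distrib power_mult)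
        then show ?thesis using j c[of "j * m"] by simp
      qed
      then have "q ^ k dvd j" using b cop by (simp add: coprime_dvd_mult_left_iff)
      have "c ^ (j * q ^ k) = 1"
      proof -
        have "((b * c) ^ j) ^ (q ^ k) = b ^ (j * q ^ k) * c ^ (j * q ^ k)"
          by (simp add: power_mult_distrib power_mult)
        then show ?thesis using j b[of "j * q ^ k"] by simp
      qed
      then have "m dvd j" using c cop by (simp add: coprime_dvd_mult_left_iff coprime_commute)
      then show "n dvd j" using \<open>q ^ k dvd j\<close> cop m(1) by (simp add: divides_mult)
    qed
    then show ?thesis by blast
  qed (auto intro: exI[of _ 1])
qed

lemma sum_power_root_of_unity:
  fixes x :: complex
  assumes "x ^ m = 1"
  shows "(\<Sum>i<m. x ^ i) = (if x = 1 then of_nat m else 0)"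
  using assms geometric_sum[of x m] by auto

section \<open>Primitive roots of unity: weighted averages in place of traces, and norms\<close>

locale cyclotomic =
  fixes N :: nat and z :: complex
  assumes N_ge_2: "N \<ge> 2" and z_order: "\<And>k. z ^ k = 1 \<longleftrightarrow> N dvd k"
begin

definition units :: "nat set" where
  "units = {t \<in> {1..<N}. coprime t N}"

lemma finite_units [simp]: "finite units" by (simp add: units_def)

lemma one_in_units [simp]: "1 \<in> units" "Suc 0 \<in> units" using N_ge_2 by (simp_all add: units_def)

lemma z_N [simp]: "z ^ N = 1" by (simp add: z_order)

lemma z_mod [simp]: "z ^ (a mod N) = z ^ a"
proof -
  have "z ^ a = z ^ (N * (a div N) + a mod N)" by simp
  also have "\<dots> = z ^ (a mod N)" unfolding power_add power_mult by simp
  finally show ?thesis by simp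
qed

lemma z_nonzero [simp]: "z \<noteq> 0"
  using z_N N_ge_2 by (metis not_numeral_le_zero power_0_left zero_neq_one)

lemma norm_z [simp]: "norm z = 1"
proof -
  have "norm z ^ N = 1" using z_N by (metis norm_one norm_power)
  then show ?thesis using N_ge_2 by (metis norm_ge_zero power_eq_1_iff abs_norm_cancel not_numeral_le_zero real_norm_def)
qed

lemma z_eq_iff: "z ^ a = z ^ b \<longleftrightarrow> [a = b] (mod N)"
proof -
  have *: "z ^ a = z ^ b \<longleftrightarrow> [a = b] (mod N)" if "a \<le> b" for a b
  proof -
    have "z ^ b = z ^ a * z ^ (b - a)" using that by (simp add: power_add[symmetric])
    then have "z ^ a = z ^ b \<longleftrightarrow> z ^ (b - a) = 1" by auto
    also have "\<dots> \<longleftrightarrow> [a = b] (mod N)" unfolding z_order using that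
      by (metis cong_altdef_nat cong_sym_eq)
    finally show ?thesis .
  qed
  show ?thesis using *[of a b] *[of b a] by (metis cong_sym_eq nat_le_linear)
qed

lemma cnj_z: "cnj (z ^ t) = z ^ (t * (N - 1))"
proof -
  have "z * cnj z = 1" by (simp add: complex_norm_square[symmetric])
  then have "(z * cnj z) ^ t = 1" by simp
  then have "z ^ t * cnj (z ^ t) = 1" by (simp add: power_mult_distrib)
  moreover have "z ^ t * z ^ (t * (N - 1)) = 1"
  proof -
    have "z ^ t * z ^ (t * (N - 1)) = z ^ (t * Suc (N - 1))" unfolding power_add[symmetric] by simp
    also have "\<dots> = 1" using N_ge_2 by (simp add: z_order)
    finally show ?thesis .
  qed
  ultimately show ?thesis by (metis mult_left_cancel power_not_zero z_nonzero)
qed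

lemma units_mult: "t \<in> units \<Longrightarrow> j \<in> units \<Longrightarrow> (t * j) mod N \<in> units"
proof -
  assume a: "t \<in> units" "j \<in> units"
  then have "coprime ((t * j) mod N) N" by (simp add: units_def)
  moreover have "(t * j) mod N \<noteq> 0" using calculation N_ge_2 by (intro notI) simp
  ultimately show ?thesis using N_ge_2 by (simp add: units_def)
qed

lemma prod_units_permute:
  assumes t: "coprime t N" and S: "S \<subseteq> units" "\<And>j. j \<in> S \<Longrightarrow> (t * j) mod N \<in> S"
  shows "(\<Prod>j\<in>S. f (z ^ (t * j))) = (\<Prod>j\<in>S. f (z ^ j))"
proof -
  have fin: "finite S" using S(1) finite_subset finite_units by blast
  let ?f = "\<lambda>j. (t * j) mod N"
  have inj: "inj_on ?f S"
  proof
    fix a b assume ab: "a \<in> S" "b \<in> S" "?f a = ?f b"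
    then have "[t * a = t * b] (mod N)" by (simp add: unique_euclidean_semiring_class.cong_def)
    then have "[a = b] (mod N)" using t by (simp add: cong_mult_lcancel_nat)
    moreover have "a < N" "b < N" using ab S(1) by (auto simp: units_def)
    ultimately show "a = b" by (simp add: unique_euclidean_semiring_class.cong_def)
  qed
  have "?f ` S = S" by (rule endo_inj_surj[OF fin _ inj]) (use S(2) in auto)
  then have "(\<Prod>j\<in>S. f (z ^ j)) = (\<Prod>j\<in>?f ` S. f (z ^ j))" by simp
  also have "\<dots> = (\<Prod>j\<in>S. f (z ^ (t * j)))" using inj by (simp add: prod.reindex)
  finally show ?thesis by simp
qed

lemma prod_all_units_permute:
  "t \<in> units \<Longrightarrow> (\<Prod>j\<in>units. f (z ^ (t * j))) = (\<Prod>j\<in>units. f (z ^ j))"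
  by (rule prod_units_permute) (auto simp: units_mult, simp add: units_def)

text \<open>The substitution of X^(N-1) acts as complex conjugation on powers of z, so the value at
  z^t is a squared absolute value. It is positive at the primitive roots and 0 at the others.
  Multiplication by the weight thus turns a sum over all t < N, which is an integer by
  orthogonality, into a positively weighted sum over the primitive roots alone.\<close>

definition weight :: "int poly" where
  "weight = (\<Prod>d\<in>{1..<N}. monom 1 d - 1) * subst_power (N - 1) (\<Prod>d\<in>{1..<N}. monom 1 d - 1)"

lemma ev_weight:
  "ev weight (z ^ t) = of_real ((norm (\<Prod>d\<in>{1..<N}. z ^ (t * d) - 1))\<^sup>2)"
proof -
  have "ev weight (z ^ t) = (\<Prod>d\<in>{1..<N}. z ^ (t * d) - 1) * (\<Prod>d\<in>{1..<N}. cnj (z ^ t) ^ d - 1)"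
    unfolding cnj_z by (simp add: weight_def power_mult)
  also have "(\<Prod>d\<in>{1..<N}. cnj (z ^ t) ^ d - 1) = cnj (\<Prod>d\<in>{1..<N}. z ^ (t * d) - 1)"
    by (simp add: power_mult)
  finally show ?thesis by (simp only: complex_norm_square)
qed

lemma ev_weight_units:
  assumes "coprime t N"
  shows "Re (ev weight (z ^ t)) > 0"
proof -
  have "z ^ (t * d) \<noteq> 1" if "d \<in> {1..<N}" for d
  proof
    assume "z ^ (t * d) = 1"
    then have "N dvd d" using assms by (simp add: z_order coprime_dvd_mult_right_iff coprime_commute)
    then show False using that by (auto dest: dvd_imp_le)
  qed
  then have "(\<Prod>d\<in>{1..<N}. z ^ (t * d) - 1) \<noteq> 0" by simp
  then show ?thesis unfolding ev_weight by simp
qed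

lemma ev_weight_nonunit:
  assumes "\<not> coprime t N"
  shows "ev weight (z ^ t) = 0"
proof -
  define g where "g = gcd t N"
  have g: "g > 1" using assms N_ge_2 unfolding g_def coprime_iff_gcd_eq_1
    by (metis gcd_eq_0_iff less_one linorder_neqE_nat not_numeral_le_zero)
  have "g dvd N" "g dvd t" by (simp_all add: g_def)
  then obtain d s where d: "N = g * d" "t = g * s" by (auto simp: dvd_def)
  have "d > 0" using d(1) N_ge_2 by (cases d) auto
  then have "d \<in> {1..<N}" using g by (simp add: d(1))
  moreover have "z ^ (t * d) = 1" unfolding z_order using d by (simp add: mult_ac)
  ultimately have "(\<Prod>d\<in>{1..<N}. z ^ (t * d) - 1) = 0" by (intro prod_zero) auto
  then show ?thesis unfolding ev_weight by simp
qed

definition tau :: "int poly \<Rightarrow> complex" where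
  "tau P = (\<Sum>t<N. ev (weight * P) (z ^ t))"

text \<open>Monomial by monomial, the sum of (z^k)^t over t < N is N or 0.\<close>

lemma sum_ev_Ints: "(\<Sum>t<N. ev P (z ^ t)) \<in> \<int>"
proof -
  have "(\<Sum>t<N. ev P (z ^ t)) = (\<Sum>k\<le>degree P. of_int (coeff P k) * (\<Sum>t<N. (z ^ k) ^ t))"
    unfolding ev_altdef sum_distrib_left
    by (subst sum.swap) (simp add: power_mult[symmetric] mult.commute)
  also have "\<dots> \<in> \<int>"
  proof (rule Ints_sum, rule Ints_mult[OF Ints_of_int])
    fix k
    have "(z ^ k) ^ N = 1" by (simp add: power_mult[symmetric] z_order)
    then show "(\<Sum>t<N. (z ^ k) ^ t) \<in> \<int>" by (simp add: sum_power_root_of_unity)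
  qed
  finally show ?thesis .
qed

lemma tau_Ints: "tau P \<in> \<int>"
  unfolding tau_def by (rule sum_ev_Ints)

lemma sum_weight_eq: "tau P = (\<Sum>t\<in>units. ev weight (z ^ t) * ev P (z ^ t))"
  unfolding tau_def
proof (rule sum.mono_neutral_cong_right)
  show "\<forall>t\<in>{..<N} - units. ev (weight * P) (z ^ t) = 0"
  proof
    fix t assume t: "t \<in> {..<N} - units"
    then have "\<not> coprime t N" using N_ge_2 by (cases "t = 0") (auto simp: units_def)
    then show "ev (weight * P) (z ^ t) = 0" by (simp add: ev_weight_nonunit)
  qed
qed (auto simp: units_def)

definition w :: int where "w = (THE k. of_int k = tau 1)"

lemma of_int_w: "of_int w = tau 1"
proof -
  obtain k where "tau 1 = of_int k" using tau_Ints by (auto elim: Ints_cases)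
  then show ?thesis unfolding w_def by (metis (mono_tags, lifting) of_int_eq_iff theI)
qed

lemma w_pos: "w > 0"
proof -
  have "Re (tau 1) = (\<Sum>t\<in>units. Re (ev weight (z ^ t)))" by (simp add: sum_weight_eq)
  also have "\<dots> > 0"
    by (intro sum_pos) (auto simp: ev_weight_units units_def intro!: exI[of _ 1] N_ge_2, use N_ge_2 in auto)
  finally have "Re (of_int w) > 0" using of_int_w by simp
  then show ?thesis by simp
qed

text \<open>Since \<open>tau P\<close> is an integer, a value common to all primitive roots becomes
  an integer after multiplication by \<open>w\<close>, which acts as a universal
  denominator.\<close>

lemma tau_const:
  assumes "\<And>t. t \<in> units \<Longrightarrow> ev P (z ^ t) = c"
  shows "tau P = of_int w * c"
  unfolding of_int_w sum_weight_eq by (simp add: assms sum_distrib_right)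

text \<open>Evaluating at all primitive roots of unity at once replaces the ring of integers of the
  cyclotomic field; \<open>tau\<close> plays the role of the trace.\<close>

lemma int_dvd_of_ev_dvd:
  assumes "\<And>t. t \<in> units \<Longrightarrow> x = of_nat p * ev P (z ^ t)" and k: "of_int k = of_int w * x"
  shows "int p dvd k"
proof -
  obtain r where r: "tau P = of_int r" using tau_Ints by (auto elim: Ints_cases)
  have "of_int w * x = (\<Sum>t\<in>units. ev weight (z ^ t) * x)"
    unfolding of_int_w sum_weight_eq by (simp add: sum_distrib_right)
  also have "\<dots> = of_nat p * tau P"
    unfolding sum_weight_eq sum_distrib_left
  proof (rule sum.cong[OF refl])
    fix t assume "t \<in> units"
    from assms(1)[OF this] show "ev weight (z ^ t) * x = of_nat p * (ev weight (z ^ t) * ev P (z ^ t))"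
      by (metis mult.left_commute)
  qed
  also have "\<dots> = of_int (int p * r)" by (simp add: r)
  finally have "k = int p * r" unfolding k[symmetric] by (simp only: of_int_eq_iff)
  then show ?thesis by simp
qed

text \<open>As a polynomial the norm is 1 + w c R. The value of R is the same at all primitive
  roots, but recovering an integer from it costs a factor \<open>w\<close>; this is why the
  coefficient w c gives only 1 modulo c.\<close>

lemma norm_form_integer:
  "\<exists>r. (\<Prod>j\<in>units. 1 + of_int (w * c) * ev G (z ^ j)) = of_int (1 + c * r)"
proof (cases "c = 0")
  case False
  let ?F = "\<Prod>j\<in>units. 1 + of_int (w * c) * subst_power j G"
  have "of_int (w * c) dvd ?F - (\<Prod>j\<in>units. 1)"
    by (rule dvd_prod_diff) simp
  then obtain R where R: "?F - 1 = of_int (w * c) * R" by (auto simp: dvd_def)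
  obtain r where r: "tau R = of_int r" using tau_Ints by (auto elim: Ints_cases)
  let ?n = "\<Prod>j\<in>units. 1 + of_int (w * c) * ev G (z ^ j)"
  have n: "?n - 1 = of_int (w * c) * ev R (z ^ t)" if "t \<in> units" for t
  proof -
    have "ev (?F - 1) (z ^ t) = (\<Prod>j\<in>units. 1 + of_int (w * c) * ev G (z ^ (t * j))) - 1"
      by (simp add: power_mult)
    also have "\<dots> = ?n - 1"
      using prod_all_units_permute[OF that, of "\<lambda>x. 1 + of_int (w * c) * ev G x"] by simp
    finally show ?thesis unfolding R by simp
  qed
  have "ev R (z ^ t) = (?n - 1) / of_int (w * c)" if "t \<in> units" for t
    using n[OF that] False w_pos by (simp add: field_simps)
  then have "tau R = of_int w * ((?n - 1) / of_int (w * c))" by (rule tau_const)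
  also have "\<dots> = (?n - 1) / of_int c" using w_pos by (simp add: divide_simps)
  finally have "of_int r = (?n - 1) / of_int c" using r by simp
  then have "?n - 1 = of_int c * of_int r" using False by (metis nonzero_eq_divide_eq mult.commute of_int_eq_0_iff)
  then have "?n = of_int (1 + c * r)" by (simp add: algebra_simps)
  then show ?thesis by blast
qed (auto intro: exI[of _ 0])


lemma coprime_prime_mod_units:
  assumes "prime p" "\<not> p dvd N"
  shows "p mod N \<in> units"
proof -
  have "coprime p N" using assms by (simp add: prime_imp_coprime)
  then have "coprime (p mod N) N" using N_ge_2 by (subst coprime_mod_left_iff) auto
  moreover from this have "p mod N \<noteq> 0" using N_ge_2 by (intro notI) simp
  ultimately show ?thesis using N_ge_2 by (simp add: units_def)
qed

text \<open>A prime divisor of the norm of \<open>1 + c G(z)\<close> has residue degree 1: the Frobenius map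
  \<open>z \<mapsto> z^p\<close> fixes \<open>G(z)\<close> modulo a prime above \<open>p\<close>, hence fixes \<open>z\<close> unless \<open>p\<close> divides \<open>c\<close> or a
  difference of conjugates of \<open>G(z)\<close>. Here \<open>D\<close> collects these differences.\<close>

lemma norm_form_prime_divisors:
  assumes inj: "inj_on (\<lambda>t. ev G (z ^ t)) units"
  obtains D :: int where "D \<noteq> 0"
    and "\<And>p c n. prime p \<Longrightarrow> \<not> int p dvd D \<Longrightarrow> \<not> int p dvd c \<Longrightarrow> int p dvd n \<Longrightarrow>
      of_int n = (\<Prod>j\<in>units. 1 + of_int c * ev G (z ^ j)) \<Longrightarrow> [p = 1] (mod N)"
proof -
  \<comment> \<open>The norm of G(X^a) - G(X), kept as a polynomial; it takes the same value
    \<open>\<delta> a\<close> at every primitive root.\<close>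
  define \<Delta> where "\<Delta> a = (\<Prod>j\<in>units. subst_power j (subst_power a G - G))" for a
  define \<delta> where "\<delta> a = (\<Prod>j\<in>units. ev G (z ^ (a * j)) - ev G (z ^ j))" for a
  have ev_Delta: "ev (\<Delta> a) (z ^ t) = \<delta> a" if "t \<in> units" for a t
  proof -
    have "ev (\<Delta> a) (z ^ t) = (\<Prod>j\<in>units. ev G ((z ^ (t * j)) ^ a) - ev G (z ^ (t * j)))"
      by (simp add: \<Delta>_def power_mult)
    also have "\<dots> = (\<Prod>j\<in>units. ev G ((z ^ j) ^ a) - ev G (z ^ j))"
      using prod_all_units_permute[OF that, of "\<lambda>x. ev G (x ^ a) - ev G x"] .
    finally show ?thesis by (simp add: \<delta>_def power_mult[symmetric] mult.commute)
  qed
  have delta_nz: "\<delta> a \<noteq> 0" if a: "a \<in> units" "a \<noteq> 1" for a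
  proof -
    have "ev G (z ^ (a * j)) \<noteq> ev G (z ^ j)" if j: "j \<in> units" for j
    proof
      assume eq: "ev G (z ^ (a * j)) = ev G (z ^ j)"
      have "ev G (z ^ ((a * j) mod N)) = ev G (z ^ j)" using eq by simp
      then have "(a * j) mod N = j" by (rule inj_onD[OF inj _ units_mult[OF a(1) j] j])
      then have "[a * j = 1 * j] (mod N)" using j by (simp add: unique_euclidean_semiring_class.cong_def units_def)
      then have "[a = 1] (mod N)" using cong_mult_rcancel_nat[of j N a 1] j unfolding units_def by blast
      then show False using a N_ge_2 by (simp add: unique_euclidean_semiring_class.cong_def units_def)
    qed
    then show ?thesis by (simp add: \<delta>_def)
  qed
  have "\<exists>d. tau (\<Delta> a) = of_int d" for a using tau_Ints by (auto elim: Ints_cases)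
  then obtain d where d: "\<And>a. tau (\<Delta> a) = of_int (d a)" by metis
  have wd: "of_int (d a) = of_int w * \<delta> a" for a
    using tau_const[of "\<Delta> a" "\<delta> a"] ev_Delta d by simp
  \<comment> \<open>The factor N ensures that p mod N is a unit. Each \<open>d a\<close> is w times
    the norm of a difference of conjugates.\<close>
  define D where "D = int N * (\<Prod>a\<in>units - {1}. d a)"
  show thesis
  proof (rule that)
    have "d a \<noteq> 0" if "a \<in> units - {1}" for a
    proof -
      have "of_int (d a) \<noteq> (0 :: complex)" unfolding wd using w_pos delta_nz[of a] that by simp
      then show ?thesis by simp
    qed
    then show "D \<noteq> 0" using N_ge_2 by (simp add: D_def)
    fix p c n
    assume p: "prime p" "\<not> int p dvd D" "\<not> int p dvd c" "int p dvd n"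
      and n: "of_int n = (\<Prod>j\<in>units. 1 + of_int c * ev G (z ^ j))"
    have pN: "\<not> p dvd N" using p(2) by (auto simp: D_def)
    define a where "a = p mod N"
    have a: "a \<in> units" unfolding a_def using coprime_prime_mod_units p(1) pN by blast
    show "[p = 1] (mod N)"
    proof (rule ccontr)
      assume "\<not> [p = 1] (mod N)"
      then have a1: "a \<noteq> 1" using N_ge_2 by (simp add: a_def unique_euclidean_semiring_class.cong_def)
      define h where "h = 1 + of_int c * G"
      obtain R where R: "h ^ p - subst_power p h = of_nat p * R"
        using frobenius_poly[OF p(1), of h] by (auto simp: dvd_def)
      have p0: "p > 0" using p(1) prime_gt_0_nat by blast
      \<comment> \<open>Modulo p the power h^p is h(x^p), so h (h^(p-1) - 1) equals c (G(x^p) -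
        G(x)). In the product over all conjugates the left side contains the norm n of h, which p
        divides, and the right side is a power of c times \<open>\<delta> a\<close>.\<close>
      have frob: "ev h x * (ev h x ^ (p - 1) - 1) = of_int c * (ev G (x ^ p) - ev G x) + of_nat p * ev R x"
        for x :: complex
      proof -
        have "ev (h ^ p - subst_power p h) x = of_nat p * ev R x" unfolding R by simp
        then have "ev h x ^ p = ev h (x ^ p) + of_nat p * ev R x" by (simp add: algebra_simps)
        moreover have "ev h x ^ p = ev h x * ev h x ^ (p - 1)" using p0 by (metis power_eq_if not_gr0)
        moreover have "ev h (x ^ p) - ev h x = of_int c * (ev G (x ^ p) - ev G x)"
          by (simp add: h_def algebra_simps)
        ultimately show ?thesis by (simp add: algebra_simps)
      qed
      let ?A = "\<lambda>j. subst_power j (of_int c * (subst_power p G - G) + of_nat p * R)"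
      let ?B = "\<lambda>j. subst_power j (of_int c * (subst_power p G - G))"
      have "of_nat p dvd prod ?A units - prod ?B units"
        by (rule dvd_prod_diff) (simp only: subst_power_add_of_nat_mult dvd_triv_left)
      then obtain S where S: "prod ?A units - prod ?B units = of_nat p * S" by (auto simp: dvd_def)
      obtain n' where n': "n = int p * n'" using p(4) by (auto simp: dvd_def)
      let ?T = "of_int n' * (\<Prod>j\<in>units. subst_power j (h ^ (p - 1) - 1)) - S"
      have T: "of_int c ^ card units * \<delta> a = of_nat p * ev ?T (z ^ t)" if t: "t \<in> units" for t
      proof -
        have "ev (prod ?A units) (z ^ t) = (\<Prod>j\<in>units. ev h ((z ^ t) ^ j) * (ev h ((z ^ t) ^ j) ^ (p - 1) - 1))"
          unfolding frob by simp
        also have "\<dots> = (\<Prod>j\<in>units. ev h ((z ^ t) ^ j)) * (\<Prod>j\<in>units. ev h ((z ^ t) ^ j) ^ (p - 1) - 1)"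
          by (rule prod.distrib)
        also have "(\<Prod>j\<in>units. ev h ((z ^ t) ^ j)) = of_int n"
          using prod_all_units_permute[OF t, of "ev h"] unfolding n by (simp add: h_def power_mult)
        finally have 1: "ev (prod ?A units) (z ^ t) = of_int n * (\<Prod>j\<in>units. ev h ((z ^ t) ^ j) ^ (p - 1) - 1)" .
        have "ev (prod ?B units) (z ^ t) = (\<Prod>j\<in>units. of_int c * (ev G ((z ^ (t * j)) ^ p) - ev G (z ^ (t * j))))"
          by (simp add: power_mult)
        also have "\<dots> = (\<Prod>j\<in>units. of_int c * (ev G ((z ^ j) ^ p) - ev G (z ^ j)))"
          using prod_all_units_permute[OF t, of "\<lambda>x. of_int c * (ev G (x ^ p) - ev G x)"] .
        also have "\<dots> = of_int c ^ card units * \<delta> a"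
        proof -
          have "(z ^ j) ^ p = z ^ (a * j)" for j
            unfolding power_mult[symmetric] z_eq_iff a_def by (simp add: unique_euclidean_semiring_class.cong_def mod_mult_left_eq mod_mult_right_eq mult.commute)
          then show ?thesis by (simp add: prod.distrib \<delta>_def)
        qed
        finally have 2: "ev (prod ?B units) (z ^ t) = of_int c ^ card units * \<delta> a" .
        have "ev (prod ?A units - prod ?B units) (z ^ t) = of_nat p * ev S (z ^ t)" unfolding S by simp
        then show "of_int c ^ card units * \<delta> a = of_nat p * ev ?T (z ^ t)"
          using 1 2 by (simp add: n' algebra_simps)
      qed
      have "int p dvd c ^ card units * d a"
        by (rule int_dvd_of_ev_dvd[OF T]) (simp_all add: wd mult_ac)
      moreover have "\<not> int p dvd d a"
      proof
        assume "int p dvd d a"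
        also have "d a dvd (\<Prod>a\<in>units - {1}. d a)" using a a1 by (intro dvd_prodI) auto
        finally have "int p dvd (\<Prod>a\<in>units - {1}. d a)" .
        then show False using p(2) by (simp add: D_def)
      qed
      moreover have "\<not> int p dvd c ^ card units" using p(1,3) prime_dvd_power[of "int p" c] by auto
      ultimately show False using p(1) by (simp add: prime_dvd_mult_iff)
    qed
  qed
qed

end

section \<open>Primes modulo which 2 is a cube\<close>

context cyclotomic begin

text \<open>Modulo a prime above p that divides 1 - 2 (K g)^3, the number 2 is the inverse of a
  cube. As p is 1 modulo N the residue field has only p elements, so the (p-1)/3-th power of 2 is 1.
  The argument is carried out with values at the primitive roots instead of in a residue
  field.\<close>

lemma prime_with_cubic_residue_2:
  assumes "3 dvd N" "B \<noteq> 0"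
  obtains p where "prime p" "[p = 1] (mod N)" "\<not> int p dvd B" "[2 ^ ((p - 1) div 3) = 1] (mod int p)"
proof -
  \<comment> \<open>The constant 4 dominates the unit circle: 48 > 12 * 2 + 3 separates the
    conjugates of g^3, and |g| >= 3 makes the norm of the element larger than 1 in absolute value,
    so that it has a prime divisor.\<close>
  define g :: "int poly" where "g = [:4, 1:]"
  have ev_g: "ev g x = 4 + x" for x :: complex by (simp add: g_def)
  define G where "G = - (g ^ 3)"
  have "inj_on (\<lambda>t. ev G (z ^ t)) units"
  proof
    fix s t assume st: "s \<in> units" "t \<in> units" and eq: "ev G (z ^ s) = ev G (z ^ t)"
    define a b where "a = z ^ s" and "b = z ^ t"
    have nab: "norm a = 1" "norm b = 1" by (simp_all add: a_def b_def norm_power)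
    have "(4 + a) ^ 3 = (4 + b) ^ 3" using eq by (simp add: G_def ev_g a_def b_def)
    then have "(a - b) * (48 + (12 * (a + b) + (a\<^sup>2 + a * b + b\<^sup>2))) = 0" by Groebner_Basis.algebra
    moreover have "48 + (12 * (a + b) + (a\<^sup>2 + a * b + b\<^sup>2)) \<noteq> 0"
    proof
      assume "48 + (12 * (a + b) + (a\<^sup>2 + a * b + b\<^sup>2)) = 0"
      then have "12 * (a + b) + (a\<^sup>2 + a * b + b\<^sup>2) = - 48" by (simp add: eq_neg_iff_add_eq_0 add.commute)
      then have "norm (12 * (a + b) + (a\<^sup>2 + a * b + b\<^sup>2)) = norm (- 48 :: complex)" by (rule arg_cong)
      moreover have "norm (12 * (a + b) + (a\<^sup>2 + a * b + b\<^sup>2)) \<le> 12 * (1 + 1) + (1 + 1 + 1)"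
      proof -
        have "norm (a + b) \<le> 1 + 1" using norm_triangle_ineq[of a b] nab by simp
        moreover have "norm (a\<^sup>2 + a * b + b\<^sup>2) \<le> 1 + 1 + 1"
          using norm_triangle_ineq[of "a\<^sup>2 + a * b" "b\<^sup>2"] norm_triangle_ineq[of "a\<^sup>2" "a * b"] nab
          by (simp add: norm_mult norm_power)
        moreover have "norm (12 * (a + b)) \<le> 12 * (1 + 1)"
          unfolding norm_mult using calculation(1) by simp
        ultimately show ?thesis
          by (auto simp: nab norm_mult norm_power intro!: order_trans[OF norm_triangle_ineq] add_mono)
      qed
      ultimately show False by simp
    qed
    ultimately have "a = b" by simp
    then have "[s = t] (mod N)" unfolding a_def b_def z_eq_iff .
    then show "s = t" using st by (simp add: unique_euclidean_semiring_class.cong_def units_def)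
  qed
  then obtain D where D: "D \<noteq> 0"
    "\<And>p c n. prime p \<Longrightarrow> \<not> int p dvd D \<Longrightarrow> \<not> int p dvd c \<Longrightarrow> int p dvd n \<Longrightarrow>
      of_int n = (\<Prod>j\<in>units. 1 + of_int c * ev G (z ^ j)) \<Longrightarrow> [p = 1] (mod N)"
    using norm_form_prime_divisors by metis
  define K where "K = w * (int N * D * B)"
  have K0: "K \<noteq> 0" using w_pos N_ge_2 D(1) assms(2) by (simp add: K_def)
  \<comment> \<open>Chosen so that w c = 2 K^3, while c itself is divisible by K, N, D and B. A
    prime divisor of 1 + c r avoids all of these.\<close>
  define c where "c = 2 * K^2 * (int N * D * B)"
  have wc: "w * c = 2 * K^3" by (simp add: c_def K_def power2_eq_square power3_eq_cube mult_ac)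
  obtain r where "(\<Prod>j\<in>units. 1 + of_int (w * c) * ev G (z ^ j)) = of_int (1 + c * r)"
    using norm_form_integer by blast
  then have n: "of_int (1 + c * r) = (\<Prod>j\<in>units. 1 + of_int (w * c) * ev G (z ^ j))" by simp
  define V where "V = of_int (2 * K^3) * g ^ 3"
  have evG: "1 + of_int (w * c) * ev G x = 1 - ev V x" for x :: complex
    by (simp add: wc G_def V_def)
  have "norm (complex_of_int (1 + c * r)) > 1"
  proof -
    have "norm (1 - ev V (z ^ j)) > 1" for j
    proof -
      have "norm (4 + z ^ j) \<ge> 3" using norm_diff_ineq[of 4 "z ^ j"] by (simp add: norm_power)
      then have "norm (4 + z ^ j) ^ 3 \<ge> 3 ^ 3" by (rule power_mono) simp
      moreover have "real_of_int \<bar>K\<bar> ^ 3 \<ge> 1 ^ 3" by (rule power_mono) (use K0 in simp_all)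
      ultimately have "1 * 27 \<le> real_of_int \<bar>K\<bar> ^ 3 * norm (4 + z ^ j) ^ 3" by (intro mult_mono) simp_all
      moreover have "norm (ev V (z ^ j)) = 2 * (real_of_int \<bar>K\<bar> ^ 3 * norm (4 + z ^ j) ^ 3)"
        by (simp add: V_def ev_g norm_mult norm_power)
      ultimately have "norm (ev V (z ^ j)) \<ge> 54" by simp
      then show ?thesis using norm_triangle_ineq2[of "ev V (z ^ j)" 1] by (simp add: norm_minus_commute)
    qed
    then have "1 < (\<Prod>j\<in>units. norm (1 - ev V (z ^ j)))"
      by (intro less_1_prod) (auto intro: one_in_units)
    then show ?thesis unfolding n evG by (simp add: prod_norm)
  qed
  then have "\<bar>1 + c * r\<bar> > 1" by (simp add: of_int_abs[symmetric] del: of_int_abs of_int_add of_int_mult)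
  then have "nat \<bar>1 + c * r\<bar> \<noteq> 1" by linarith
  then obtain p where p: "prime p" "p dvd nat \<bar>1 + c * r\<bar>" using prime_factor_nat by blast
  then have pn: "int p dvd 1 + c * r" by (simp add: dvd_nat_abs_iff)
  have pc: "\<not> int p dvd c"
  proof
    assume "int p dvd c"
    then have "int p dvd (1 + c * r) - c * r" using pn by (meson dvd_diff dvd_mult2)
    then have "int p dvd 1" by simp
    then show False using p(1) by (metis not_prime_unit prime_nat_int_transfer)
  qed
  have pK: "\<not> int p dvd K" using pc by (auto simp: c_def power2_eq_square)
  then have pw: "\<not> int p dvd w" "\<not> int p dvd D" "\<not> int p dvd B" by (auto simp: K_def)
  then have pwc: "\<not> int p dvd w * c" using pc p(1) by (simp add: prime_dvd_mult_iff)
  have p1N: "[p = 1] (mod N)" by (rule D(2)[OF p(1) pw(2) pwc pn n])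
  then have "[p = 1] (mod 3)" using assms(1) cong_dvd_modulus_nat by blast
  then have "p mod 3 = 1" by (simp add: unique_euclidean_semiring_class.cong_def)
  define m where "m = (p - 1) div 3"
  have pm: "p = 3 * m + 1" using \<open>p mod 3 = 1\<close> unfolding m_def by (metis Suc_eq_plus1 add_diff_cancel_right' div_mult_mod_eq mult.commute nonzero_mult_div_cancel_left zero_neq_numeral)
  have fixed: "(z ^ j) ^ p = z ^ j" for j
    unfolding power_mult[symmetric] z_eq_iff using cong_scalar_left[OF p1N, of j] by simp
  obtain R where R: "g ^ p - subst_power p g = of_nat p * R"
    using frobenius_poly[OF p(1), of g] by (auto simp: dvd_def)
  obtain k where k: "K ^ (p - 1) = 1 + int p * k"
  proof -
    have "int p dvd K ^ (p - 1) - 1" using fermat_int[OF p(1) pK] by (simp add: cong_iff_dvd_diff)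
    then obtain k where "K ^ (p - 1) - 1 = int p * k" by (auto simp: dvd_def)
    then show thesis using that[of k] by simp
  qed
  define E where "E = 2 ^ m * (of_int k * g + R + of_nat p * of_int k * R)"
  define Q where "Q = (\<Sum>i<m. V ^ i)"
  define A where "A = Q * V - of_int (2 ^ m - 1)"
  define A' where "A' = - E * of_int (2 * K^3) * g ^ 2"
  \<comment> \<open>If x^p = x, then V^m g = 2^m K^(p-1) g^p is 2^m g modulo p. Multiplying by 2 K^3
    g^2 replaces the factor g by V, and V is 1 modulo V - 1.\<close>
  have key: "of_int (2 ^ m - 1) = (ev V x - 1) * ev A x + of_nat p * ev A' x" if x: "x ^ p = x" for x :: complex
  proof -
    have gp: "ev g x ^ p = ev g x + of_nat p * ev R x"
    proof -
      have "ev (g ^ p - subst_power p g) x = of_nat p * ev R x" unfolding R by simp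
      then show ?thesis using x by (simp add: algebra_simps)
    qed
    have Kp: "(of_int K :: complex) ^ (3 * m) = 1 + of_nat p * of_int k"
    proof -
      have "(of_int K :: complex) ^ (3 * m) = of_int (K ^ (p - 1))" by (simp add: pm)
      then show ?thesis unfolding k by simp
    qed
    have "ev V x ^ m * ev g x = 2 ^ m * of_int K ^ (3 * m) * ev g x ^ (3 * m + 1)"
      by (simp add: V_def power_mult_distrib power_mult[symmetric])
    also have "ev g x ^ (3 * m + 1) = ev g x ^ p" by (simp add: pm)
    finally have "ev V x ^ m * ev g x = 2 ^ m * ev g x + of_nat p * ev E x"
      unfolding gp Kp by (simp add: E_def algebra_simps)
    then have "(2 ^ m - 1) * ev g x = (ev V x ^ m - 1) * ev g x - of_nat p * ev E x"
      by (simp add: algebra_simps)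
    also have "ev V x ^ m - 1 = (ev V x - 1) * ev Q x"
      unfolding Q_def by (simp add: power_diff_1_eq)
    finally have "(2 ^ m - 1) * ev g x = (ev V x - 1) * ev Q x * ev g x - of_nat p * ev E x" .
    then have "(2 ^ m - 1) * ev g x * (of_int (2 * K^3) * ev g x ^ 2)
        = ((ev V x - 1) * ev Q x * ev g x - of_nat p * ev E x) * (of_int (2 * K^3) * ev g x ^ 2)" by simp
    moreover have "ev V x = ev g x * (of_int (2 * K^3) * ev g x ^ 2)"
      by (simp add: V_def power2_eq_square power3_eq_cube)
    ultimately show ?thesis unfolding A_def A'_def by (simp add: algebra_simps)
  qed
  let ?A = "\<lambda>j. subst_power j ((V - 1) * A + of_nat p * A')"
  let ?B = "\<lambda>j. subst_power j ((V - 1) * A)"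
  have "of_nat p dvd prod ?A units - prod ?B units"
    by (rule dvd_prod_diff) (simp only: subst_power_add_of_nat_mult dvd_triv_left)
  then obtain S where S: "prod ?A units - prod ?B units = of_nat p * S" by (auto simp: dvd_def)
  obtain n' where n': "1 + c * r = int p * n'" using pn by (auto simp: dvd_def)
  let ?T = "(-1) ^ card units * of_int n' * (\<Prod>j\<in>units. subst_power j A) + S"
  \<comment> \<open>In the product of \<open>key\<close> over all conjugates, the factors V - 1
    multiply up to sign to the norm 1 + c r, a multiple of p.\<close>
  have T: "of_int (2 ^ m - 1) ^ card units = of_nat p * ev ?T (z ^ t)" if t: "t \<in> units" for t
  proof -
    define q where "q = (\<Prod>j\<in>units. ev A (z ^ (t * j)))"
    have "of_int (2 ^ m - 1) ^ card units = ev (prod ?A units) (z ^ t)"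
      using key[OF fixed] by (simp add: power_mult[symmetric])
    moreover have "ev (prod ?A units - prod ?B units) (z ^ t) = of_nat p * ev S (z ^ t)" unfolding S by simp
    moreover have "ev (prod ?B units) (z ^ t)
       = (\<Prod>j\<in>units. (-1) * (1 - ev V (z ^ (t * j)))) * q"
      by (simp add: power_mult prod.distrib q_def)
    moreover have "(\<Prod>j\<in>units. (-1) * (1 - ev V (z ^ (t * j)))) = (-1) ^ card units * of_int (1 + c * r)"
      unfolding n evG using prod_all_units_permute[OF t, of "\<lambda>x. (-1) * (1 - ev V x)"]
      by (simp only: prod.distrib prod_constant)
    ultimately have "of_int (2 ^ m - 1) ^ card units
        = (-1) ^ card units * of_int (1 + c * r) * q + of_nat p * ev S (z ^ t)"
      by (simp only: ev_diff) (simp only: diff_eq_eq add.commute)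
    moreover have "ev ?T (z ^ t) = (-1) ^ card units * of_int n' * q + ev S (z ^ t)"
      by (simp add: q_def power_mult)
    ultimately show ?thesis unfolding n' by (simp only: of_int_mult of_int_of_nat_eq) (simp only: algebra_simps)
  qed
  have "int p dvd w * (2 ^ m - 1) ^ card units"
    by (rule int_dvd_of_ev_dvd[OF T]) simp_all
  then have "int p dvd (2 ^ m - 1) ^ card units" using pw(1) p(1) by (simp add: prime_dvd_mult_iff)
  then have "int p dvd 2 ^ m - 1" using p(1) prime_dvd_power[of "int p"] by auto
  then have "[2 ^ ((p - 1) div 3) = 1] (mod int p)" by (simp add: m_def cong_iff_dvd_diff)
  then show thesis using that p(1) p1N pw(3) by blast
qed

end

text \<open>Each prime factor of the form u^2 + 27 v^2 can be divided out by
  \<open>descent_odd\<close>, which keeps \<open>A\<close> odd. If all prime factors had this form,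
  this would end at 4 = A^2 + 27 B^2 with \<open>A\<close> odd.\<close>

lemma not_all_prime_factors_of_form:
  fixes A B :: int
  assumes "4 * int n = A^2 + 27 * B^2" "odd A" "n > 0"
  shows "\<exists>p. prime p \<and> p dvd n \<and> \<not> (\<exists>u v :: int. int p = u^2 + 27 * v ^ 2)"
  using assms
proof (induction n arbitrary: A B rule: less_induct)
  case (less n)
  show ?case
  proof (cases "n = 1")
    case True
    then show ?thesis using less.prems descent_base[of A B] by simp
  next
    case False
    then obtain p where p: "prime p" "p dvd n" using prime_factor_nat by blast
    show ?thesis
    proof (cases "\<exists>u v :: int. int p = u^2 + 27 * v ^ 2")
      case True
      then obtain u v where uv: "int p = u^2 + 27 * v ^ 2" by blast
      obtain k where k: "n = p * k" using p(2) by (auto simp: dvd_def)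
      have "4 * int p * int k = A^2 + 27 * B^2" using less.prems(1) k by simp
      from descent_odd[OF p(1) uv this less.prems(2)]
      obtain A' B' where "4 * int k = A'^2 + 27 * B'^2" "odd A'" by blast
      moreover have "k < n" "k > 0" using k less.prems(3) prime_gt_1_nat[OF p(1)] by auto
      ultimately obtain q where "prime q" "q dvd k" "\<not> (\<exists>u v :: int. int q = u^2 + 27 * v ^ 2)"
        using less.IH by blast
      then show ?thesis using k by (meson dvd_mult)
    qed (use p in blast)
  qed
qed

section \<open>Reduction to characteristic 2\<close>

lemma of_int_char_2:
  assumes "(2 :: 'e :: comm_ring_1) = 0"
  shows "(of_int n :: 'e) = (if even n then 0 else 1)"
proof (cases "even n")
  case True
  then obtain k where "n = 2 * k" by blast
  then show ?thesis using assms by simp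
next
  case False
  then obtain k where "n = 2 * k + 1" by (elim oddE)
  then show ?thesis using assms False by simp
qed

lemma sum_square_char_2:
  assumes "(2 :: 'e :: comm_ring_1) = 0"
  shows "(\<Sum>i\<in>A. f i :: 'e)^2 = (\<Sum>i\<in>A. f i ^ 2)"
proof (induction A rule: infinite_finite_induct)
  case (insert x A)
  then show ?case using assms by (simp add: power2_sum)
qed simp_all

text \<open>The coefficient of \<open>X^k\<close> is the trace of \<open>b^(-k)\<close> down to the prime field; the polynomial
  is the idempotent of the factor of \<open>X^M - 1\<close> modulo 2 with root \<open>b\<close>.\<close>

lemma idempotent_char_2:
  fixes b :: "'e :: field"
  assumes char2: "(2 :: 'e) = 0" and f: "f > 0" and M: "M + 1 = 4 ^ f"
    and b: "\<And>k. b ^ k = 1 \<longleftrightarrow> M dvd k"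
  obtains e :: "int poly" where
    "\<And>j. ev e (b ^ j) = (if \<exists>i<2 * f. [j = 2 ^ i] (mod M) then 1 else 0)"
proof -
  have M4: "4 ^ f = (2::nat) ^ (2 * f)" by (simp add: power_mult)
  have odd_M: "odd M" using M f by (metis M4 even_Suc even_power gr0_implies_Suc mult_is_0 neq0_conv Suc_eq_plus1 even_numeral zero_neq_numeral)
  have "(4::nat) ^ 1 \<le> 4 ^ f" using f by (intro power_increasing) auto
  then have M3: "M \<ge> 3" unfolding M[symmetric] by simp
  \<comment> \<open>The exponent M - 1 stands for -1, since b^M = 1; so these are the conjugates of
    b^(-k) under repeated squaring.\<close>
  define x where "x k i = b ^ ((M - 1) * k * 2 ^ i)" for k i
  define T where "T k = (\<Sum>i<2 * f. x k i)" for k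
  have T01: "T k = 0 \<or> T k = 1" for k
  proof -
    have sq: "x k i ^ 2 = x k (Suc i)" for i
      by (simp add: x_def power_mult[symmetric] mult_ac)
    have wrap: "x k (2 * f) = x k 0"
    proof -
      have "q * 2 ^ (2 * f) = M * q + q" for q
        unfolding M4[symmetric] M[symmetric] by (simp add: algebra_simps)
      from this[of "(M - 1) * k"] have "x k (2 * f) = b ^ (M * ((M - 1) * k)) * b ^ ((M - 1) * k)"
        unfolding x_def by (simp only: power_add)
      moreover have "b ^ (M * ((M - 1) * k)) = 1" unfolding b by simp
      ultimately show ?thesis by (simp add: x_def)
    qed
    have "T k ^ 2 = (\<Sum>i<2 * f. x k (Suc i))"
      unfolding T_def sum_square_char_2[OF char2] sq ..
    also have "\<dots> = (\<Sum>i<Suc (2 * f). x k i) - x k 0"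
      by (simp add: sum.lessThan_Suc_shift del: sum.lessThan_Suc)
    also have "\<dots> = T k" by (simp add: T_def wrap)
    finally have "T k * (T k - 1) = 0" by (simp add: power2_eq_square algebra_simps)
    then show ?thesis by simp
  qed
  \<comment> \<open>Every trace is 0 or 1 in the field and therefore lifts to an integer
    coefficient.\<close>
  define e :: "int poly" where "e = (\<Sum>k<M. monom (if T k = 1 then 1 else 0) k)"
  have ev_e: "ev e y = (\<Sum>k<M. T k * y ^ k)" for y
    unfolding e_def ev_sum ev_monom
  proof (rule sum.cong[OF refl])
    fix k show "of_int (if T k = 1 then 1 else 0) * y ^ k = T k * y ^ k" using T01[of k] by auto
  qed
  \<comment> \<open>Orthogonality: the base of the powers is 1 exactly if j = 2^i modulo M, and then
    the sum is M, which is 1 in the field because M is odd.\<close>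
  have inner: "(\<Sum>k<M. (b ^ ((M - 1) * 2 ^ i + j)) ^ k) = (if [j = 2 ^ i] (mod M) then 1 else 0)" for i j
  proof -
    let ?y = "b ^ ((M - 1) * 2 ^ i + j)"
    have M1: "M \<ge> 1" using odd_M by (cases M) auto
    have "?y = 1 \<longleftrightarrow> M dvd (M - 1) * 2 ^ i + j" by (rule b)
    also have "\<dots> \<longleftrightarrow> [(M - 1) * 2 ^ i + j = 0] (mod M)" by (simp add: cong_0_iff)
    also have "\<dots> \<longleftrightarrow> [((M - 1) * 2 ^ i + j) + 2 ^ i = 0 + 2 ^ i] (mod M)" by (simp only: cong_add_rcancel_nat)
    also have "((M - 1) * 2 ^ i + j) + 2 ^ i = j + M * 2 ^ i" using M1 by (cases M) (simp_all add: algebra_simps)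
    also have "[j + M * 2 ^ i = 0 + 2 ^ i] (mod M) \<longleftrightarrow> [j = 2 ^ i] (mod M)" by (simp add: unique_euclidean_semiring_class.cong_def)
    finally have y1: "?y = 1 \<longleftrightarrow> [j = 2 ^ i] (mod M)" .
    have "?y ^ M = 1" unfolding power_mult[symmetric] b by simp
    moreover have "(of_nat M :: 'e) = 1" using of_int_char_2[OF char2, of "int M"] odd_M by simp
    ultimately have "(\<Sum>k<M. ?y ^ k) = (if ?y = 1 then 1 else 0)"
      using geometric_sum[of ?y M] by auto
    then show ?thesis using y1 by simp
  qed
  have "ev e (b ^ j) = (if \<exists>i<2 * f. [j = 2 ^ i] (mod M) then 1 else 0)" for j
  proof -
    have "ev e (b ^ j) = (\<Sum>k<M. \<Sum>i<2 * f. (b ^ ((M - 1) * 2 ^ i + j)) ^ k)"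
      unfolding ev_e T_def x_def sum_distrib_right
      by (intro sum.cong refl) (simp add: power_add[symmetric] power_mult[symmetric] algebra_simps)
    also have "\<dots> = (\<Sum>i<2 * f. if [j = 2 ^ i] (mod M) then 1 else 0)"
      by (subst sum.swap) (simp only: inner)
    also have "\<dots> = (if \<exists>i<2 * f. [j = 2 ^ i] (mod M) then 1 else 0)"
    proof (cases "\<exists>i<2 * f. [j = 2 ^ i] (mod M)")
      case True
      then obtain i where i: "i < 2 * f" "[j = 2 ^ i] (mod M)" by blast
      have small: "(2::nat) ^ l < M" if "l < 2 * f" for l
      proof -
        have "(2::nat) ^ Suc l \<le> 2 ^ (2 * f)" using that by (intro power_increasing) auto
        moreover have "(2::nat) ^ l \<noteq> M" using odd_M M3 by (cases l) auto
        ultimately show ?thesis using M M4 by simp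
      qed
      have "[j = 2 ^ l] (mod M) \<longleftrightarrow> l = i" if "l \<in> {..<2 * f}" for l
      proof
        assume "[j = 2 ^ l] (mod M)"
        then have "[2 ^ l = 2 ^ i] (mod M)" using i(2) cong_sym cong_trans by blast
        then have "(2::nat) ^ l = 2 ^ i" using small[of l] small[of i] that i(1) by (simp add: unique_euclidean_semiring_class.cong_def)
        then show "l = i" by simp
      qed (use i in simp)
      then have "(\<Sum>l<2 * f. if [j = 2 ^ l] (mod M) then 1 else 0) = (\<Sum>l<2 * f. if l = i then 1 else 0 :: 'e)"
        by (intro sum.cong refl) simp
      then show ?thesis using True i(1) by simp
    qed auto
    finally show ?thesis .
  qed
  then show thesis using that by blast
qed

context cyclotomic begin

text \<open>This is the reduction of cyclotomic integers modulo a prime above 2, obtained without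
  cyclotomic polynomials. All powers of z with odd exponent are roots of X^H + 1, where H = N/2.
  After multiplication by \<open>U\<close>, which vanishes at the imprimitive ones among them,
  \<open>f\<close> vanishes at all roots of this monic polynomial and is a multiple of it over Z. In
  characteristic 2 the polynomial X^H + 1 vanishes at \<open>b\<close>, whereas \<open>U\<close>
  does not.\<close>

lemma ev_transfer:
  fixes b :: "'e :: field"
  assumes char2: "(2 :: 'e) = 0" and N: "N = 2 ^ Suc a * M" "odd M"
    and b: "\<And>k. b ^ k = 1 \<longleftrightarrow> M dvd k"
    and f: "\<And>t. t \<in> units \<Longrightarrow> ev f (z ^ t) = 0"
  shows "ev f b = 0"
proof -
  define H where "H = 2 ^ a * M"
  have NH: "N = 2 * H" by (simp add: N H_def)
  have H0: "H > 0" using N_ge_2 NH by simp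
  have zH: "z ^ H = -1"
  proof -
    have "(z ^ H)^2 = z ^ (2 * H)" by (simp add: power_mult[symmetric] mult.commute)
    then have "(z ^ H)^2 = 1" using z_N unfolding NH by simp
    moreover have "z ^ H \<noteq> 1" unfolding z_order using NH H0 by (auto dest: dvd_imp_le)
    ultimately show ?thesis by (metis power2_eq_1_iff)
  qed
  \<comment> \<open>An odd t that is not coprime to N shares a factor g with M, and d = M/g gives
    (z^t)^(2^a d) = -1.\<close>
  define U where "U = (\<Prod>d\<in>{1..<M}. monom 1 (2 ^ a * d) + 1 :: int poly)"
  let ?g = "monom 1 H + 1 :: int poly"
  have "degree ?g = H" using H0 by (simp add: degree_add_eq_left degree_monom_eq)
  moreover have "coeff ?g H = 1" using H0 by (simp add: coeff_1)
  ultimately obtain q r where qr: "f * U = ?g * q + r" "degree r < H"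
    using monic_division[of ?g "f * U"] H0 by auto
  have fU: "ev (f * U) (z ^ t) = 0" if t: "t < N" "odd t" for t
  proof (cases "coprime t N")
    case True
    then have "t \<in> units" using t by (cases "t = 0") (auto simp: units_def)
    then show ?thesis using f by simp
  next
    case False
    define g where "g = gcd t N"
    have g: "g > 1" using False N_ge_2 unfolding g_def coprime_iff_gcd_eq_1
      by (metis gcd_eq_0_iff less_one linorder_neqE_nat not_numeral_le_zero)
    have "g dvd N" "g dvd t" by (simp_all add: g_def)
    then have "odd g" using t(2) by (meson dvd_trans)
    then have "coprime g (2 ^ Suc a)" by simp
    then have "g dvd M" using \<open>g dvd N\<close> N(1) by (simp add: coprime_dvd_mult_right_iff)
    then obtain d s where d: "M = g * d" "t = g * s" using \<open>g dvd t\<close> by (auto simp: dvd_def)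
    have "d > 0" using d(1) N(2) by (cases d) auto
    then have dM: "d \<in> {1..<M}" using g by (simp add: d(1))
    have "odd s" using t(2) d(2) by simp
    have "(z ^ t) ^ (2 ^ a * d) = (z ^ H) ^ s"
      unfolding power_mult[symmetric] H_def d by (simp add: mult_ac)
    also have "\<dots> = - 1" unfolding zH using \<open>odd s\<close> by simp
    finally have "ev (monom 1 (2 ^ a * d) + 1) (z ^ t) = 0" by simp
    then have "ev U (z ^ t) = 0" unfolding U_def ev_prod using dM by (intro prod_zero bexI[of _ d]) auto
    then show ?thesis by simp
  qed
  have r0: "ev r (z ^ t) = 0" if t: "t < N" "odd t" for t
  proof -
    have "ev ?g (z ^ t) = 0" using t(2) zH by (simp add: power_mult[symmetric] mult.commute[of t] power_mult)
    then show ?thesis using fU[OF t] unfolding qr(1) by simp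
  qed
  have "map_poly of_int r = (0 :: complex poly)"
  proof (rule ccontr)
    let ?r = "map_poly of_int r :: complex poly"
    assume nz: "?r \<noteq> 0"
    let ?S = "(\<lambda>i. z ^ (2 * i + 1)) ` {..<H}"
    have "inj_on (\<lambda>i. z ^ (2 * i + 1)) {..<H}"
    proof
      fix i j assume ij: "i \<in> {..<H}" "j \<in> {..<H}" "z ^ (2 * i + 1) = z ^ (2 * j + 1)"
      then have "[2 * i + 1 = 2 * j + 1] (mod N)" unfolding z_eq_iff by simp
      then show "i = j" using ij NH by (simp add: unique_euclidean_semiring_class.cong_def)
    qed
    then have "card ?S = H" by (simp add: card_image)
    moreover have "?S \<subseteq> {x. poly ?r x = 0}"
    proof
      fix x assume "x \<in> ?S"
      then obtain i where i: "i < H" "x = z ^ (2 * i + 1)" by auto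
      then show "x \<in> {x. poly ?r x = 0}" using r0[of "2 * i + 1"] NH by (simp add: ev_def)
    qed
    moreover have "finite {x. poly ?r x = 0}" using nz by (rule poly_roots_finite)
    ultimately have "H \<le> card {x. poly ?r x = 0}" by (metis card_mono)
    also have "\<dots> \<le> degree ?r" using nz by (rule card_poly_roots_bound)
    also have "\<dots> \<le> degree r" by (rule map_poly_degree_leq)
    finally show False using qr(2) by simp
  qed
  then have "r = 0" by (metis coeff_0 coeff_map_poly of_int_0 of_int_eq_iff poly_eqI)
  have M_H: "M dvd H" by (simp add: H_def)
  have "ev ?g b = 0" using b[of H] M_H char2 by simp
  then have "ev f b * ev U b = 0" using qr(1) \<open>r = 0\<close> by (metis ev_mult add.right_neutral mult_zero_left)
  moreover have "ev U b \<noteq> 0"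
  proof -
    have "b ^ (2 ^ a * d) + 1 \<noteq> 0" if d: "d \<in> {1..<M}" for d
    proof
      assume "b ^ (2 ^ a * d) + 1 = 0"
      then have "b ^ (2 ^ a * d) = 1" using char2 by (metis add_right_cancel one_add_one)
      then have "M dvd 2 ^ a * d" using b by simp
      then have "M dvd d" using N(2) by (simp add: coprime_dvd_mult_right_iff)
      then show False using d by (auto dest: dvd_imp_le)
    qed
    then show ?thesis by (simp add: U_def)
  qed
  ultimately show ?thesis by simp
qed

end

section \<open>Partial norms and averages with values in the Eisenstein integers\<close>

locale cyclotomic_3 = cyclotomic +
  assumes three_dvd_N: "3 dvd N"
begin

definition \<omega> :: complex where "\<omega> = z ^ (N div 3)"

lemma omega: "\<omega>^2 = - 1 - \<omega>"
proof -
  have c: "\<omega> ^ 3 = 1" using three_dvd_N by (simp add: \<omega>_def power_mult[symmetric])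
  have "\<omega> \<noteq> 1" unfolding \<omega>_def z_order using three_dvd_N N_ge_2 by (auto dest: dvd_imp_le)
  moreover have "(\<omega> - 1) * (\<omega>^2 + \<omega> + 1) = \<omega>^3 - 1" by Groebner_Basis.algebra
  ultimately have s: "\<omega>^2 + \<omega> + 1 = 0" using c by simp
  have "\<omega>^2 = (\<omega>^2 + \<omega> + 1) - 1 - \<omega>" by simp
  then show ?thesis unfolding s by simp
qed

lemma omega_power_cases: "\<omega> ^ k = 1 \<or> \<omega> ^ k = \<omega> \<or> \<omega> ^ k = - 1 - \<omega>"
proof -
  have c: "\<omega> ^ 3 = 1" using three_dvd_N by (simp add: \<omega>_def power_mult[symmetric])
  have "\<omega> ^ k = \<omega> ^ (3 * (k div 3) + k mod 3)" by simp
  also have "\<dots> = \<omega> ^ (k mod 3)" unfolding power_add power_mult c by simp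
  finally have "\<omega> ^ k = \<omega> ^ (k mod 3)" .
  moreover have "k mod 3 = 0 \<or> k mod 3 = 1 \<or> k mod 3 = 2" by linarith
  ultimately show ?thesis using omega by auto
qed

lemma cnj_omega: "cnj \<omega> = - 1 - \<omega>"
proof -
  have "cnj \<omega> * \<omega> = 1" using complex_norm_square[of \<omega>] by (simp add: \<omega>_def norm_power mult.commute)
  moreover have "(- 1 - \<omega>) * \<omega> = - \<omega> - \<omega>^2" by (simp add: power2_eq_square algebra_simps)
  then have "(- 1 - \<omega>) * \<omega> = 1" unfolding omega by simp
  moreover have "\<omega> \<noteq> 0" by (simp add: \<omega>_def)
  ultimately show ?thesis by (metis mult_right_cancel)
qed

lemma Im_omega: "Im \<omega> \<noteq> 0"
proof
  assume "Im \<omega> = 0"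
  then have "cnj \<omega> = \<omega>" by (simp add: complex_eq_iff)
  then have "\<omega> = - 1 - \<omega>" using cnj_omega by simp
  then have "2 * \<omega> = -1" by (simp add: algebra_simps)
  then have "norm (2 * \<omega>) = norm (-1 :: complex)" by (rule arg_cong)
  then show False by (simp add: norm_mult \<omega>_def norm_power)
qed

definition eisenstein :: "complex set" where
  "eisenstein = {of_int A + of_int B * \<omega> | A B. True}"

lemma eisensteinI: "of_int A + of_int B * \<omega> \<in> eisenstein"
  by (auto simp: eisenstein_def)

lemma eisensteinE:
  assumes "x \<in> eisenstein"
  obtains A B where "x = of_int A + of_int B * \<omega>"
  using assms by (auto simp: eisenstein_def)

lemma eisenstein_add: "x \<in> eisenstein \<Longrightarrow> y \<in> eisenstein \<Longrightarrow> x + y \<in> eisenstein"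
proof (elim eisensteinE)
  fix A B C D assume "x = of_int A + of_int B * \<omega>" "y = of_int C + of_int D * \<omega>"
  then have "x + y = of_int (A + C) + of_int (B + D) * \<omega>" by (simp add: algebra_simps)
  then show ?thesis by (simp only: eisensteinI)
qed

lemma eisenstein_smult: "x \<in> eisenstein \<Longrightarrow> of_int k * x \<in> eisenstein"
proof (elim eisensteinE)
  fix A B assume "x = of_int A + of_int B * \<omega>"
  then have "of_int k * x = of_int (k * A) + of_int (k * B) * \<omega>" by (simp add: algebra_simps)
  then show ?thesis by (simp only: eisensteinI)
qed

lemma eisenstein_0: "0 \<in> eisenstein" using eisensteinI[of 0 0] by simp

lemma eisenstein_sum: "(\<And>i. i \<in> S \<Longrightarrow> f i \<in> eisenstein) \<Longrightarrow> sum f S \<in> eisenstein"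
  by (induction S rule: infinite_finite_induct) (auto simp: eisenstein_0 intro: eisenstein_add)

lemma eisenstein_omega_power: "\<omega> ^ k \<in> eisenstein"
  using omega_power_cases[of k] eisensteinI[of 1 0] eisensteinI[of 0 1] eisensteinI[of "-1" "-1"] by auto

text \<open>The exponents whose conjugation fixes \<omega>: the Galois group of the cyclotomic field
  over Q(\<omega>).\<close>

definition units1 :: "nat set" where "units1 = {t \<in> units. t mod 3 = 1}"

lemma units1: "units1 \<subseteq> units" "finite units1" "1 \<in> units1"
  using finite_subset[OF _ finite_units, of units1] by (auto simp: units1_def)

text \<open>The map t -> N - t is complex conjugation; as 3 divides N, it exchanges the residue
  classes 1 and 2 modulo 3.\<close>

lemma units_split: "units = units1 \<union> (\<lambda>t. N - t) ` units1" "units1 \<inter> (\<lambda>t. N - t) ` units1 = {}"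
  "inj_on (\<lambda>t. N - t) units1"
proof -
  obtain n where n: "N = 3 * n" using three_dvd_N by blast
  have neg: "N - t \<in> units" if "t \<in> units" for t
  proof -
    have t: "t \<ge> 1" "t < N" "coprime t N" using that by (auto simp: units_def)
    have "coprime (N - t) N"
    proof (rule coprimeI)
      fix c assume "c dvd N - t" "c dvd N"
      then have "c dvd t" using t by (metis dvd_diffD1 less_imp_le)
      then show "is_unit c" using t(3) \<open>c dvd N\<close> by (meson coprime_common_divisor)
    qed
    then show ?thesis using t by (simp add: units_def)
  qed
  have mod: "(N - t) mod 3 = 2 \<longleftrightarrow> t mod 3 = 1" if "t < N" for t
  proof -
    have "(N - t) + t = 3 * n" using that n by simp
    then have "((N - t) + t) mod 3 = 0" by simp
    then have "((N - t) mod 3 + t mod 3) mod 3 = 0" by (simp only: mod_add_eq)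
    moreover have "(N - t) mod 3 = 0 \<or> (N - t) mod 3 = 1 \<or> (N - t) mod 3 = 2"
      "t mod 3 = 0 \<or> t mod 3 = 1 \<or> t mod 3 = 2" by linarith+
    ultimately show ?thesis by (auto dest: dvd_imp_le)
  qed
  have m12: "t mod 3 = 1 \<or> t mod 3 = 2" if "t \<in> units" for t
  proof -
    have "\<not> 3 dvd t"
    proof
      assume "3 dvd t"
      then have "is_unit (3 :: nat)" using coprime_common_divisor[of t N 3] that three_dvd_N by (simp add: units_def)
      then show False by simp
    qed
    then show ?thesis by presburger
  qed
  show "units1 \<inter> (\<lambda>t. N - t) ` units1 = {}"
  proof (rule ccontr)
    assume "units1 \<inter> (\<lambda>t. N - t) ` units1 \<noteq> {}"
    then obtain s where "s \<in> units1" "N - s \<in> units1" by auto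
    then have "s < N" "s mod 3 = 1" "(N - s) mod 3 = 1" by (simp_all add: units1_def units_def)
    then show False using mod[of s] by simp
  qed
  show "inj_on (\<lambda>t. N - t) units1" by (auto simp: inj_on_def units1_def units_def)
  show "units = units1 \<union> (\<lambda>t. N - t) ` units1"
  proof (intro equalityI subsetI)
    fix t assume t: "t \<in> units"
    then have tN: "t < N" by (simp add: units_def)
    show "t \<in> units1 \<union> (\<lambda>t. N - t) ` units1"
    proof (cases "t mod 3 = 1")
      case False
      then have "t mod 3 = 2" using m12[OF t] by simp
      moreover have "N - (N - t) = t" "N - t < N" using tN t by (auto simp: units_def)
      ultimately have "(N - t) mod 3 = 1" using mod[of "N - t"] by simp
      then have "N - t \<in> units1" using neg[OF t] by (simp add: units1_def)
      then show ?thesis using \<open>N - (N - t) = t\<close> by (metis UnI2 imageI)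
    qed (use t in \<open>simp add: units1_def\<close>)
  qed (use neg in \<open>auto simp: units1_def\<close>)
qed

lemma z_minus: "t \<le> N \<Longrightarrow> z ^ (N - t) = cnj (z ^ t)"
proof -
  assume "t \<le> N"
  then have "z ^ (N - t) * z ^ t = 1" by (simp add: power_add[symmetric])
  moreover have "cnj (z ^ t) * z ^ t = 1"
    using complex_norm_square[of "z ^ t"] by (simp add: norm_power mult.commute)
  ultimately show ?thesis by (metis mult_right_cancel power_not_zero z_nonzero)
qed

text \<open>Transitivity of the norm through Q(\<omega>), whose nontrivial automorphism is complex
  conjugation.\<close>

lemma prod_units_split: "(\<Prod>j\<in>units. ev P (z ^ j)) = (\<Prod>j\<in>units1. ev P (z ^ j)) * cnj (\<Prod>j\<in>units1. ev P (z ^ j))"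
proof -
  have "(\<Prod>j\<in>units. ev P (z ^ j)) = (\<Prod>j\<in>units1. ev P (z ^ j)) * (\<Prod>j\<in>(\<lambda>t. N - t) ` units1. ev P (z ^ j))"
    unfolding units_split(1) by (rule prod.union_disjoint) (use units1 units_split(2) in auto)
  also have "(\<Prod>j\<in>(\<lambda>t. N - t) ` units1. ev P (z ^ j)) = (\<Prod>j\<in>units1. ev P (z ^ (N - j)))"
    using units_split(3) by (simp add: prod.reindex)
  also have "\<dots> = (\<Prod>j\<in>units1. cnj (ev P (z ^ j)))"
  proof (rule prod.cong[OF refl])
    fix j assume "j \<in> units1"
    then have "j \<le> N" by (simp add: units1_def units_def)
    then show "ev P (z ^ (N - j)) = cnj (ev P (z ^ j))" by (simp only: z_minus ev_cnj)
  qed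
  finally show ?thesis by simp
qed

lemma ev_units_0: "(\<And>t. t \<in> units1 \<Longrightarrow> ev P (z ^ t) = 0) \<Longrightarrow> t \<in> units \<Longrightarrow> ev P (z ^ t) = 0"
proof -
  assume 1: "\<And>t. t \<in> units1 \<Longrightarrow> ev P (z ^ t) = 0" and "t \<in> units"
  then consider "t \<in> units1" | s where "s \<in> units1" "t = N - s" using units_split(1) by blast
  then show ?thesis
  proof cases
    case 2
    then have "s \<le> N" by (simp add: units1_def units_def)
    then show ?thesis unfolding 2(2) using 1[OF 2(1)] by (simp only: z_minus ev_cnj complex_cnj_zero)
  qed (rule 1)
qed

lemma prod_units1_permute:
  assumes "t \<in> units1"
  shows "(\<Prod>j\<in>units1. f (z ^ (t * j))) = (\<Prod>j\<in>units1. f (z ^ j))"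
proof (rule prod_units_permute)
  show "coprime t N" using assms by (simp add: units1_def units_def)
  fix j assume j: "j \<in> units1"
  have "((t * j) mod N) mod 3 = (t * j) mod 3" using three_dvd_N by (rule mod_mod_cancel)
  also have "\<dots> = ((t mod 3) * (j mod 3)) mod 3" by (simp add: mod_mult_eq)
  also have "\<dots> = 1" using assms j by (simp add: units1_def)
  finally show "(t * j) mod N \<in> units1" using units_mult[of t j] assms j by (simp add: units1_def)
qed (rule units1)

definition tau1 :: "int poly \<Rightarrow> complex" where
  "tau1 P = (\<Sum>t\<in>units1. ev weight (z ^ t) * ev P (z ^ t))"

text \<open>The weight extends the sum to all t that are 1 modulo 3. On this progression
  orthogonality leaves only exponents k divisible by N/3, for which z^k is a power of
  \<omega>.\<close>

lemma tau1_eisenstein: "tau1 P \<in> eisenstein"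
proof -
  let ?Q = "weight * P"
  obtain n where n: "N = 3 * n" using three_dvd_N by blast
  then have wn: "\<omega> = z ^ n" unfolding \<omega>_def by simp
  have "tau1 P = (\<Sum>t\<in>{t\<in>{..<N}. t mod 3 = 1}. ev ?Q (z ^ t))"
    unfolding tau1_def
  proof (rule sum.mono_neutral_cong_left)
    show "\<forall>t\<in>{t\<in>{..<N}. t mod 3 = 1} - units1. ev ?Q (z ^ t) = 0"
    proof
      fix t assume t: "t \<in> {t\<in>{..<N}. t mod 3 = 1} - units1"
      then have "\<not> coprime t N" by (cases "t = 0") (auto simp: units1_def units_def)
      then show "ev ?Q (z ^ t) = 0" by (simp add: ev_weight_nonunit)
    qed
  qed (auto simp: units1_def units_def)
  also have "{t\<in>{..<N}. t mod 3 = 1} = (\<lambda>i. 1 + 3 * i) ` {..<n}"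
  proof (intro equalityI subsetI)
    fix t assume t: "t \<in> {t\<in>{..<N}. t mod 3 = 1}"
    then have "t = 1 + 3 * (t div 3)" by (simp add: mod_eq_nat1E) presburger
    moreover have "t div 3 < n" using t unfolding n by auto
    ultimately show "t \<in> (\<lambda>i. 1 + 3 * i) ` {..<n}" by blast
  qed (auto simp: n)
  also have "(\<Sum>t\<in>(\<lambda>i. 1 + 3 * i) ` {..<n}. ev ?Q (z ^ t)) = (\<Sum>i<n. ev ?Q (z ^ (1 + 3 * i)))"
    by (subst sum.reindex) (auto simp: inj_on_def)
  also have "\<dots> = (\<Sum>k\<le>degree ?Q. of_int (coeff ?Q k) * (z ^ k * (\<Sum>i<n. (z ^ (3 * k)) ^ i)))"
  proof -
    have "(z ^ (1 + 3 * i)) ^ k = z ^ k * (z ^ (3 * k)) ^ i" for i k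
      by (simp only: power_mult[symmetric] power_add[symmetric]) (simp add: algebra_simps)
    then show ?thesis unfolding ev_altdef sum_distrib_left by (simp only:) (rule sum.swap)
  qed
  also have "\<dots> \<in> eisenstein"
  proof (rule eisenstein_sum, rule eisenstein_smult)
    fix k
    have "3 * k * n = k * N" unfolding n by simp
    then have "(z ^ (3 * k)) ^ n = 1" unfolding power_mult[symmetric] z_order by (simp only: dvd_triv_right)
    then have s: "(\<Sum>i<n. (z ^ (3 * k)) ^ i) = (if z ^ (3 * k) = 1 then of_nat n else 0)"
      by (rule sum_power_root_of_unity)
    show "z ^ k * (\<Sum>i<n. (z ^ (3 * k)) ^ i) \<in> eisenstein"
    proof (cases "z ^ (3 * k) = 1")
      case True
      then have "3 * n dvd 3 * k" unfolding z_order n .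
      then have "n dvd k" by simp
      then obtain q where "k = n * q" by blast
      then have "z ^ k = \<omega> ^ q" by (simp add: wn power_mult)
      then show ?thesis unfolding s using True eisenstein_smult[OF eisenstein_omega_power[of q], of "int n"]
        by (simp add: mult.commute)
    qed (simp add: s eisenstein_0)
  qed
  finally show ?thesis .
qed

text \<open>The values of the weight are real, so the component along \<omega> vanishes; positivity
  is inherited from the weight.\<close>

lemma tau1_1_int: obtains w1 :: int where "w1 > 0" "tau1 1 = of_int w1"
proof -
  obtain A B where AB: "tau1 1 = of_int A + of_int B * \<omega>" by (rule eisensteinE[OF tau1_eisenstein])
  have "Im (tau1 1) = 0" by (simp add: tau1_def ev_weight)
  then have "B = 0" using AB Im_omega by simp
  have "Re (tau1 1) = (\<Sum>t\<in>units1. Re (ev weight (z ^ t)))" by (simp add: tau1_def)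
  also have "\<dots> > 0"
  proof (rule sum_pos)
    show "units1 \<noteq> {}" using units1(3) by blast
    fix t assume "t \<in> units1"
    then show "0 < Re (ev weight (z ^ t))" by (intro ev_weight_units) (simp add: units1_def units_def)
  qed (rule units1)
  finally have "A > 0" using AB \<open>B = 0\<close> by simp
  then show thesis using that AB \<open>B = 0\<close> by simp
qed

lemma omega_units1:
  assumes t: "t \<in> units1"
  shows "(z ^ t) ^ (N div 3) = \<omega>"
proof -
    have "(z ^ t) ^ (N div 3) = \<omega> ^ t" by (simp add: \<omega>_def power_mult[symmetric] mult.commute)
    also have "\<dots> = z ^ (N div 3 * t)" by (simp add: \<omega>_def power_mult)
    also have "\<dots> = z ^ (N div 3)" unfolding z_eq_iff
    proof -
      have "t mod 3 = 1" using t by (simp add: units1_def)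
      then obtain q where q: "t = 3 * q + 1" by (metis div_mult_mod_eq mult.commute)
      have "N div 3 * t = (3 * (N div 3)) * q + N div 3" unfolding q by (simp add: algebra_simps)
      also have "3 * (N div 3) = N" using three_dvd_N by simp
      finally show "[N div 3 * t = N div 3] (mod N)" by (simp add: unique_euclidean_semiring_class.cong_def)
    qed
    finally show ?thesis by (simp add: \<omega>_def)
qed

text \<open>The image of \<omega>, \<open>b ^ (N div 3)\<close>, is a nontrivial cube root of unity
  and so lies outside the prime field {0, 1}. An odd \<open>B\<close> would express it by elements
  of that field.\<close>

lemma eisenstein_char_2:
  fixes b :: "'e :: field"
  assumes char2: "(2 :: 'e) = 0" and N: "N = 2 ^ Suc a * M" "odd M"
    and b: "\<And>k. b ^ k = 1 \<longleftrightarrow> M dvd k"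
    and eq: "of_int A + of_int B * b ^ (N div 3) = c" and c: "c = 0 \<or> c = 1"
  shows "even B \<and> (c = 0 \<longrightarrow> even A)"
proof -
  let ?\<beta> = "b ^ (N div 3)"
  have "3 dvd M"
  proof -
    have "coprime 3 (2 :: nat)" by (simp add: coprime_iff_gcd_eq_1 gcd_non_0_nat)
    then have "coprime 3 ((2 :: nat) ^ Suc a)" using coprime_power_right_iff by blast
    then show ?thesis using three_dvd_N unfolding N(1) by (simp add: coprime_dvd_mult_right_iff)
  qed
  then obtain m where m: "M = 3 * m" by blast
  have "N div 3 = 2 ^ Suc a * m" unfolding N(1) m by simp
  moreover have "\<not> M dvd 2 ^ Suc a * m"
  proof
    assume "M dvd 2 ^ Suc a * m"
    then have "M dvd m" using N(2) by (simp add: coprime_dvd_mult_right_iff)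
    then show False using m N(2) by (auto dest: dvd_imp_le)
  qed
  ultimately have b1: "?\<beta> \<noteq> 1" unfolding b by simp
  have "b ^ M = 1" using b by simp
  then have "b \<noteq> 0" using odd_pos[OF N(2)] by (auto simp: power_0_left)
  then have b0: "?\<beta> \<noteq> 0" by simp
  have m1: "- x = x" for x :: 'e
  proof -
    have "x + x = 2 * x" by simp
    then have "x + x = 0" using char2 by simp
    then show ?thesis by (rule minus_unique)
  qed
  have "even B"
  proof (rule ccontr)
    assume "odd B"
    then have "(of_int B :: 'e) = 1" by (simp only: of_int_char_2[OF char2] if_False)
    then have "?\<beta> = c - of_int A" using eq by (simp add: algebra_simps)
    moreover have "(of_int A :: 'e) = 0 \<or> (of_int A :: 'e) = 1" unfolding of_int_char_2[OF char2] by simp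
    ultimately show False using c b0 b1 m1[of 1] by auto
  qed
  then have "(of_int A :: 'e) = c" using eq unfolding of_int_char_2[OF char2, of B] by simp
  then show ?thesis using \<open>even B\<close> unfolding of_int_char_2[OF char2, of A] by (auto split: if_splits)
qed

text \<open>Reduction modulo 2 removes the powers of 2 from the denominator of an average over \<open>units1\<close>,
  since it maps \<open>\<omega>\<close> to an element outside the prime field.\<close>

lemma odd_multiple_eisenstein:
  fixes b :: "'e :: field"
  assumes char2: "(2 :: 'e) = 0" and N: "N = 2 ^ Suc a * M" "odd M"
    and b: "\<And>k. b ^ k = 1 \<longleftrightarrow> M dvd k"
  obtains w' :: int where "odd w'" "w' \<noteq> 0"
    "\<And>P x. (\<And>t. t \<in> units1 \<Longrightarrow> ev P (z ^ t) = x) \<Longrightarrow> of_int w' * x \<in> eisenstein"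
proof -
  obtain w1 where w1: "w1 > 0" "tau1 1 = of_int w1" by (rule tau1_1_int)
  obtain e w' where w': "w1 = 2 ^ e * w'" "odd w'"
  proof -
    have "w1 \<noteq> 0" using w1 by simp
    then obtain y where "w1 = 2 ^ multiplicity 2 w1 * y" "\<not> 2 dvd y"
      using multiplicity_decompose'[of w1 2] by auto
    then show thesis using that by blast
  qed
  have "of_int w' * x \<in> eisenstein" if P: "\<And>t. t \<in> units1 \<Longrightarrow> ev P (z ^ t) = x" for P x
  proof -
    have "of_int w1 * x = tau1 P"
      unfolding w1(2)[symmetric] tau1_def by (simp add: P sum_distrib_right)
    then have *: "of_int (2 ^ e * w') * x \<in> eisenstein" using tau1_eisenstein w'(1) by simp
    \<comment> \<open>One factor 2 is removed at a time: a multiple by an even integer reduces to 0,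
      so both coordinates \<open>A\<close> and \<open>B\<close> are even and 2 can be
      cancelled.\<close>
    have "of_int (2 ^ i * w') * x \<in> eisenstein \<Longrightarrow> of_int w' * x \<in> eisenstein" for i
    proof (induction i)
      case (Suc i)
      obtain A B where AB: "of_int (2 ^ Suc i * w') * x = of_int A + of_int B * \<omega>"
        by (rule eisensteinE[OF Suc.prems])
      define F where "F = of_int (2 ^ Suc i * w') * P - of_int A - of_int B * monom 1 (N div 3)"
      have "ev F (z ^ t) = 0" if t: "t \<in> units1" for t
      proof -
        have "ev F (z ^ t) = of_int (2 ^ Suc i * w') * x - (of_int A + of_int B * \<omega>)"
          using P[OF t] by (simp add: F_def omega_units1[OF t] algebra_simps)
        then show ?thesis using AB by simp
      qed
      then have "\<And>t. t \<in> units \<Longrightarrow> ev F (z ^ t) = 0" by (rule ev_units_0)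
      from ev_transfer[OF char2 N b this]
      have F0: "of_int (2 ^ Suc i * w') * ev P b - of_int A - of_int B * b ^ (N div 3) = 0"
        by (simp add: F_def)
      have 0: "(of_int (2 ^ Suc i * w') :: 'e) = 0" by (simp only: of_int_char_2[OF char2]) simp
      have eqE: "of_int A + of_int B * b ^ (N div 3) = 0"
      proof -
        have "of_int A + of_int B * b ^ (N div 3)
            = 0 * ev P b - (0 * ev P b - of_int A - of_int B * b ^ (N div 3))" by simp
        also have "\<dots> = 0" unfolding F0[unfolded 0] by simp
        finally show ?thesis .
      qed
      have even: "even B \<and> even A"
        using eisenstein_char_2[OF char2 N b eqE] by simp
      then obtain A' B' where "A = 2 * A'" "B = 2 * B'" by (elim conjE evenE)
      then have "2 * (of_int (2 ^ i * w') * x) = 2 * (of_int A' + of_int B' * \<omega>)"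
        using AB by (simp add: algebra_simps)
      then have "of_int (2 ^ i * w') * x = of_int A' + of_int B' * \<omega>"
        by (simp only: mult_cancel_left) simp
      then have "of_int (2 ^ i * w') * x \<in> eisenstein" by (simp only: eisensteinI)
      then show ?case by (rule Suc.IH)
    qed simp
    then show ?thesis using * by blast
  qed
  moreover have "w' \<noteq> 0" using w'(2) by auto
  ultimately show thesis using that w'(2) by blast
qed

end

section \<open>Primes modulo which 2 is not a cube\<close>

lemma card_odd_shift: "card {q. q < 2 * n \<and> odd (c + q)} = (n :: nat)"
proof (induction n)
  case (Suc n)
  have "{q. q < 2 * Suc n \<and> odd (c + q)} = insert (if odd c then 2 * n else 2 * n + 1) {q. q < 2 * n \<and> odd (c + q)}"
    by (auto simp: less_Suc_eq)
  then show ?case using Suc by simp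
qed simp

lemma sum_powers_4: "3 * (\<Sum>l<f. 4 ^ l) + 1 = (4 :: nat) ^ f"
  by (induction f) simp_all

lemma power_4_mod_3: "(4 :: nat) ^ l mod 3 = 1"
proof (induction l)
  case (Suc l)
  have "(4 :: nat) ^ Suc l mod 3 = (4 * (4 ^ l mod 3)) mod 3" by (simp only: power_Suc mod_mult_right_eq)
  then show ?case unfolding Suc.IH by simp
qed simp

context cyclotomic_3 begin

text \<open>Only the j congruent to a power 2^i modulo M contribute, and j = 1 modulo 3 forces i = 2
  l. Each residue 4^l is met by 2^a elements of \<open>units1\<close>, so the exponent of b is 2^a
  times the sum of the 4^l, which is M/3. The product is thus a nontrivial cube root of
  unity.\<close>

lemma prod_units1_char_2:
  fixes b :: "'e :: field"
  assumes char2: "(2 :: 'e) = 0" and N: "N = 2 ^ Suc a * M" and f: "f > 0" and M: "M + 1 = 4 ^ f"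
    and b: "\<And>k. b ^ k = 1 \<longleftrightarrow> M dvd k"
    and h: "\<And>j. ev h (b ^ j) = (if \<exists>i<2 * f. [j = 2 ^ i] (mod M) then b ^ j else 1)"
  obtains k where "(\<Prod>j\<in>units1. ev h (b ^ j)) = b ^ k" "\<not> M dvd k"
proof -
  have "even (4 ^ f :: nat)" using f by simp
  then have odd_M: "odd M" unfolding M[symmetric] by simp
  have M3: "M = 3 * (\<Sum>l<f. 4 ^ l)" using sum_powers_4[of f] M by simp
  then have dvd3: "3 dvd M" by simp
  have small: "(4 :: nat) ^ l < M" if "l < f" for l
  proof -
    have "(4 :: nat) ^ l \<le> (\<Sum>l<f. 4 ^ l)" using that by (intro member_le_sum) auto
    moreover have "(4 :: nat) ^ l > 0" by simp
    ultimately show ?thesis unfolding M3 by linarith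
  qed
  \<comment> \<open>The units in the residue class 4^l modulo M are the odd numbers among 4^l + M q.
    As M is odd, parity selects half of the 2^(a+1) values q.\<close>
  define Q where "Q l = {q. q < 2 ^ Suc a \<and> odd (4 ^ l + M * q)}" for l :: nat
  have cardQ: "card (Q l) = 2 ^ a" for l
  proof -
    have "Q l = {q. q < 2 * 2 ^ a \<and> odd (4 ^ l + q)}" using odd_M by (auto simp: Q_def)
    then show ?thesis by (simp only: card_odd_shift)
  qed
  have finQ: "finite (Q l)" for l by (simp add: Q_def)
  let ?S = "{j \<in> units1. \<exists>i<2 * f. [j = 2 ^ i] (mod M)}"
  let ?F = "\<lambda>(l, q). 4 ^ l + M * q"
  have S: "?S = ?F ` (SIGMA l:{..<f}. Q l)"
  proof (intro equalityI subsetI)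
    fix j assume "j \<in> ?S"
    then obtain i where j: "j \<in> units1" and i: "i < 2 * f" "[j = 2 ^ i] (mod M)" by blast
    have jN: "j < N" "coprime j N" "j mod 3 = 1" using j by (auto simp: units1_def units_def)
    have "[j = 2 ^ i] (mod 3)" using i(2) dvd3 cong_dvd_modulus_nat by blast
    then have i3: "2 ^ i mod 3 = (1 :: nat)" using jN(3) by (simp add: unique_euclidean_semiring_class.cong_def)
    have "even i"
    proof (rule ccontr)
      assume "odd i"
      then obtain l where "i = 2 * l + 1" by (elim oddE)
      then have "(2 :: nat) ^ i = 2 * 4 ^ l" by (simp add: power_mult)
      then have "(2 :: nat) ^ i mod 3 = (2 * (4 ^ l mod 3)) mod 3" by (simp only: mod_mult_right_eq)
      then show False using i3 unfolding power_4_mod_3 by simp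
    qed
    then obtain l where l: "i = 2 * l" by blast
    have lf: "l < f" using i(1) l by simp
    have "j mod M = 4 ^ l" using i(2) small[OF lf] by (simp add: l unique_euclidean_semiring_class.cong_def power_mult)
    then have jq: "j = 4 ^ l + M * (j div M)" by (metis add.commute div_mult_mod_eq mult.commute)
    have "j div M < 2 ^ Suc a" using jN(1) unfolding N by (metis less_mult_imp_div_less)
    moreover have "odd j"
    proof
      assume "even j"
      moreover have "even N" unfolding N by simp
      ultimately have "is_unit (2 :: nat)" using jN(2) coprime_common_divisor by blast
      then show False by simp
    qed
    ultimately have "j div M \<in> Q l" unfolding Q_def by (simp only: jq[symmetric] mem_Collect_eq simp_thms)
    then show "j \<in> ?F ` (SIGMA l:{..<f}. Q l)" using jq lf
      by (intro image_eqI[of _ _ "(l, j div M)"]) auto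
  next
    fix j assume "j \<in> ?F ` (SIGMA l:{..<f}. Q l)"
    then obtain l q where lq: "l < f" "q \<in> Q l" "j = 4 ^ l + M * q" by auto
    have q: "q < 2 ^ Suc a" "odd j" using lq by (auto simp: Q_def)
    have "M * Suc q \<le> M * 2 ^ Suc a" using q(1) by (intro mult_le_mono2) simp
    then have "j < N" using small[OF lq(1)] lq(3) by (simp add: N mult.commute)
    moreover have "coprime j M"
    proof -
      have "coprime (2 ^ (2 * l)) M" using odd_M by simp
      then have "coprime (4 ^ l) M" by (simp add: power_mult)
      then show ?thesis unfolding lq(3) by (metis coprime_iff_gcd_eq_1 gcd.commute gcd_add_mult mult.commute add.commute)
    qed
    then have "coprime j N" unfolding N using q(2) by simp
    moreover have "j mod 3 = 1"
    proof -
      obtain m where "M = 3 * m" using dvd3 by blast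
      then have "j mod 3 = 4 ^ l mod 3" unfolding lq(3) by (simp add: mult.assoc)
      then show ?thesis by (simp only: power_4_mod_3)
    qed
    moreover have "[j = 2 ^ (2 * l)] (mod M)" unfolding lq(3) by (simp add: unique_euclidean_semiring_class.cong_def power_mult)
    moreover have "2 * l < 2 * f" "j \<noteq> 0" using lq by auto
    moreover from calculation have "\<exists>i<2 * f. [j = 2 ^ i] (mod M)" by blast
    ultimately show "j \<in> ?S" by (simp add: units1_def units_def)
  qed
  have inj: "inj_on ?F (SIGMA l:{..<f}. Q l)"
  proof
    fix x y assume xy: "x \<in> (SIGMA l:{..<f}. Q l)" "y \<in> (SIGMA l:{..<f}. Q l)" "?F x = ?F y"
    obtain l q l' q' where eq: "x = (l, q)" "y = (l', q')" by (cases x, cases y)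
    have "4 ^ l + M * q = 4 ^ l' + M * q'" "l < f" "l' < f" using xy eq by auto
    then have "(4 ^ l + M * q) mod M = (4 ^ l' + M * q') mod M" by simp
    then have "(4 :: nat) ^ l = 4 ^ l'" using small \<open>l < f\<close> \<open>l' < f\<close> by simp
    then have "l = l'" by simp
    then show "x = y" using \<open>4 ^ l + M * q = 4 ^ l' + M * q'\<close> odd_M eq by auto
  qed
  have "(\<Prod>j\<in>units1. ev h (b ^ j)) = (\<Prod>j\<in>?S. b ^ j)"
    unfolding h using units1(2) by (simp only: prod.inter_filter)
  also have "\<dots> = (\<Prod>x\<in>(SIGMA l:{..<f}. Q l). b ^ ?F x)" unfolding S using inj by (simp add: prod.reindex)
  also have "\<dots> = (\<Prod>(l, q)\<in>(SIGMA l:{..<f}. Q l). b ^ (4 ^ l))"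
  proof (rule prod.cong[OF refl])
    fix x :: "nat \<times> nat"
    have "b ^ (M * q) = 1" for q unfolding b by simp
    then show "b ^ ?F x = (case x of (l, q) \<Rightarrow> b ^ (4 ^ l))" by (cases x) (simp add: power_add)
  qed
  also have "\<dots> = (\<Prod>l<f. \<Prod>q\<in>Q l. b ^ (4 ^ l))" using finQ by (subst prod.Sigma) auto
  also have "\<dots> = (\<Prod>l<f. b ^ (4 ^ l * 2 ^ a))" by (simp add: cardQ power_mult)
  also have "\<dots> = b ^ (\<Sum>l<f. 4 ^ l * 2 ^ a)" by (simp only: power_sum)
  also have "(\<Sum>l<f. 4 ^ l * 2 ^ a) = 2 ^ a * (\<Sum>l<f. 4 ^ l :: nat)" by (simp add: sum_distrib_left mult.commute)
  finally have *: "(\<Prod>j\<in>units1. ev h (b ^ j)) = b ^ (2 ^ a * (\<Sum>l<f. 4 ^ l))" .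
  have "\<not> M dvd 2 ^ a * (\<Sum>l<f. 4 ^ l)"
  proof
    assume "M dvd 2 ^ a * (\<Sum>l<f. 4 ^ l)"
    then have "M dvd (\<Sum>l<f. 4 ^ l)" using odd_M by (simp add: coprime_dvd_mult_right_iff)
    moreover have "(\<Sum>l<f. (4 :: nat) ^ l) > 0" using odd_pos[OF odd_M] M3 by linarith
    ultimately have "M \<le> (\<Sum>l<f. 4 ^ l)" by (rule dvd_imp_le)
    then show False using \<open>(\<Sum>l<f. (4 :: nat) ^ l) > 0\<close> M3 by linarith
  qed
  then show thesis using that * by blast
qed

text \<open>In characteristic 2 the element 1 + c g becomes b^j if j is a power of 2 modulo M and 1
  otherwise, so its partial norm is a nontrivial cube root of unity. Hence the coordinate
  \<open>B1\<close> of the partial norm \<gamma> along \<omega> is odd. It is also divisible by 3,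
  and 4 n = (2 A1 - B1)^2 + 27 (B1/3)^2 is a representation to which
  \<open>not_all_prime_factors_of_form\<close> applies.\<close>

lemma prime_without_cubic_residue_2:
  assumes N: "N = 2 ^ Suc a * M" and f: "f > 0" and M: "M + 1 = 4 ^ f" and B: "B \<noteq> 0"
  obtains p where "prime p" "[p = 1] (mod N)" "\<not> int p dvd B" "p \<noteq> 2"
    "\<not> (\<exists>u v :: int. int p = u^2 + 27 * v ^ 2)"
proof -
  have char2: "(2 :: bit alg_closure) = 0"
    by (metis to_ac_0 to_ac_numeral bit_numeral_even)
  have "even (4 ^ f :: nat)" using f by simp
  then have odd_M: "odd M" unfolding M[symmetric] by simp
  obtain b :: "bit alg_closure" where b: "\<And>k. b ^ k = 1 \<longleftrightarrow> M dvd k"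
    using exact_order_char_2[OF char2 odd_M] by blast
  obtain e where e: "\<And>j. ev e (b ^ j) = (if \<exists>i<2 * f. [j = 2 ^ i] (mod M) then 1 else 0)"
    using idempotent_char_2[OF char2 f M b] by blast
  \<comment> \<open>With the idempotent e, the first summand makes 1 + g equal to b^j or 1 in
    characteristic 2. The second vanishes there and serves to separate the complex conjugates by a
    choice of K.\<close>
  define g where "g K = e * (monom 1 1 - 1) + of_nat (2 * K) * monom 1 1" for K :: nat
  have ev_g: "ev (g K) x = ev e x * (x - 1) + of_nat (2 * K) * x" for K and x :: complex
    by (simp add: g_def)
  have "\<exists>K. inj_on (\<lambda>t. ev (g K) (z ^ t)) units"
  proof -
    define bad where "bad s t = {K. ev (g K) (z ^ s) = ev (g K) (z ^ t)}" for s t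
    have "finite (bad s t)" if "s \<in> units" "t \<in> units" "s \<noteq> t" for s t
    proof -
      have ne: "z ^ s \<noteq> z ^ t" using that by (simp add: z_eq_iff unique_euclidean_semiring_class.cong_def units_def)
      have "K = K'" if "K \<in> bad s t" "K' \<in> bad s t" for K K'
      \<comment> \<open>Two bad values for the same pair would force z^s = z^t, so each pair
        excludes at most one K.\<close>
      proof -
        have "(of_nat (2 * K) - of_nat (2 * K')) * (z ^ s - z ^ t)
            = (ev (g K) (z ^ s) - ev (g K) (z ^ t)) - (ev (g K') (z ^ s) - ev (g K') (z ^ t))"
          unfolding ev_g by (simp add: algebra_simps)
        also have "\<dots> = 0" using that by (simp add: bad_def)
        finally have "(of_nat (2 * K) :: complex) = of_nat (2 * K')" using ne by simp
        then show ?thesis unfolding of_nat_eq_iff by simp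
      qed
      then show ?thesis by (metis finite.simps finite_subset subsetI singletonI empty_iff insertCI ex_in_conv)
    qed
    then have "finite (\<Union>s\<in>units. \<Union>t\<in>units - {s}. bad s t)" by (intro finite_UN_I) auto
    then obtain K where "K \<notin> (\<Union>s\<in>units. \<Union>t\<in>units - {s}. bad s t)"
      using ex_new_if_finite infinite_UNIV_nat by blast
    then have "inj_on (\<lambda>t. ev (g K) (z ^ t)) units" by (auto simp: bad_def inj_on_def)
    then show ?thesis by blast
  qed
  then obtain K where inj: "inj_on (\<lambda>t. ev (g K) (z ^ t)) units" by blast
  obtain D where D: "D \<noteq> 0"
    "\<And>p c n. prime p \<Longrightarrow> \<not> int p dvd D \<Longrightarrow> \<not> int p dvd c \<Longrightarrow> int p dvd n \<Longrightarrow>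
      of_int n = (\<Prod>j\<in>units. 1 + of_int c * ev (g K) (z ^ j)) \<Longrightarrow> [p = 1] (mod N)"
    using norm_form_prime_divisors[OF inj] by metis
  obtain w' :: int where w': "odd w'" "w' \<noteq> 0"
    "\<And>P x. (\<And>t. t \<in> units1 \<Longrightarrow> ev P (z ^ t) = x) \<Longrightarrow> of_int w' * x \<in> eisenstein"
    using odd_multiple_eisenstein[OF char2 N odd_M b] by metis
  \<comment> \<open>Here d is the odd part of w' D B: the coefficient of g has to be odd for the
    reduction modulo 2. The prime 2 is excluded by the oddness of n instead.\<close>
  obtain d where d: "odd d" "\<And>p. prime p \<Longrightarrow> p \<noteq> 2 \<Longrightarrow> int p dvd w' * D * B \<Longrightarrow> int p dvd d"
  proof -
    have nz: "w' * D * B \<noteq> 0" using w'(2) D(1) B by simp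
    obtain y where y: "w' * D * B = 2 ^ multiplicity 2 (w' * D * B) * y" "\<not> 2 dvd y"
      using multiplicity_decompose'[of "w' * D * B" 2] nz by auto
    have "int p dvd y" if p: "prime p" "p \<noteq> 2" "int p dvd w' * D * B" for p
    proof -
      have "\<not> int p dvd 2 ^ multiplicity 2 (w' * D * B)"
      proof
        assume "int p dvd 2 ^ multiplicity 2 (w' * D * B)"
        then have "int p dvd 2" using p(1) prime_dvd_power[of "int p"] by auto
        then have "p dvd 2" by (metis int_dvd_int_iff of_nat_numeral)
        then show False using p(1,2) primes_dvd_imp_eq two_is_prime_nat by blast
      qed
      moreover have "int p dvd 2 ^ multiplicity 2 (w' * D * B) * y" using p(3) y(1) by simp
      ultimately show ?thesis using p(1) by (simp add: prime_dvd_mult_iff)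
    qed
    then show thesis using that[of y] y(2) by blast
  qed
  \<comment> \<open>The factor 3 makes \<open>B1\<close> divisible by 3. The additional factor w' in
    c is used up when (\<gamma> - 1)/c is brought into Z[\<omega>].\<close>
  define c' where "c' = 3 * d"
  define c where "c = w' * c'"
  have odd_c: "odd c" using d(1) w'(1) by (simp add: c_def c'_def)
  have c0: "c \<noteq> 0" using odd_c by auto
  define h where "h = 1 + of_int c * g K"
  let ?H = "\<Prod>j\<in>units1. subst_power j h"
  define \<gamma> where "\<gamma> = (\<Prod>j\<in>units1. ev h (z ^ j))"
  have H: "ev ?H (z ^ t) = \<gamma>" if "t \<in> units1" for t
    using prod_units1_permute[OF that, of "ev h"] by (simp add: \<gamma>_def power_mult)
  have "of_int c dvd ?H - (\<Prod>j\<in>units1. 1)"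
  proof (rule dvd_prod_diff)
    fix j
    have "subst_power j h - 1 = of_int c * subst_power j (g K)"
      by (simp add: h_def subst_power_def pcompose_add pcompose_1 of_int_poly pcompose_smult)
    then show "of_int c dvd subst_power j h - 1" by simp
  qed
  then obtain R where R: "?H - 1 = of_int c * R" by (auto simp: dvd_def)
  have "ev R (z ^ t) = (\<gamma> - 1) / of_int c" if "t \<in> units1" for t
  proof -
    have "ev (?H - 1) (z ^ t) = of_int c * ev R (z ^ t)" unfolding R by simp
    then have "\<gamma> - 1 = of_int c * ev R (z ^ t)" using H[OF that] by simp
    then show ?thesis using c0 by simp
  qed
  then have "of_int w' * ((\<gamma> - 1) / of_int c) \<in> eisenstein" by (rule w'(3))
  then obtain A0 B0 where "of_int w' * ((\<gamma> - 1) / of_int c) = of_int A0 + of_int B0 * \<omega>"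
    by (rule eisensteinE)
  moreover have "of_int w' * ((\<gamma> - 1) / of_int c) = (\<gamma> - 1) / of_int c'"
    using w'(2) by (simp add: c_def)
  ultimately have "\<gamma> - 1 = of_int c' * (of_int A0 + of_int B0 * \<omega>)"
    using c0 by (simp add: c_def field_simps)
  define A1 B1 where "A1 = 1 + c' * A0" and "B1 = c' * B0"
  have gamma: "\<gamma> = of_int A1 + of_int B1 * \<omega>"
    using \<open>\<gamma> - 1 = _\<close> by (simp add: A1_def B1_def algebra_simps)
  have "odd B1"
  proof (rule ccontr)
    assume "\<not> odd B1"
    define F where "F = ?H - of_int A1 - of_int B1 * monom 1 (N div 3)"
    have "ev F (z ^ t) = 0" if t: "t \<in> units1" for t
      using H[OF t] gamma by (simp add: F_def omega_units1[OF t])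
    then have "\<And>t. t \<in> units \<Longrightarrow> ev F (z ^ t) = 0" by (rule ev_units_0)
    from ev_transfer[OF char2 N odd_M b this]
    have "ev ?H b = of_int A1 + of_int B1 * b ^ (N div 3)" by (simp add: F_def algebra_simps)
    then have HA: "ev ?H b = of_int A1" using \<open>\<not> odd B1\<close> by (simp add: of_int_char_2[OF char2])
    have evh: "ev h (b ^ j) = (if \<exists>i<2 * f. [j = 2 ^ i] (mod M) then b ^ j else 1)" for j
    proof -
      have "(of_int c :: bit alg_closure) = 1" using odd_c by (simp add: of_int_char_2[OF char2])
      then have "ev h (b ^ j) = 1 + (ev e (b ^ j) * (b ^ j - 1) + of_nat (2 * K) * b ^ j)"
        by (simp add: h_def g_def)
      also have "(of_nat (2 * K) :: bit alg_closure) = 0" using char2 by simp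
      finally have *: "ev h (b ^ j) = 1 + ev e (b ^ j) * (b ^ j - 1)" by simp
      show ?thesis
      proof (cases "\<exists>i<2 * f. [j = 2 ^ i] (mod M)")
        case True
        then have "ev e (b ^ j) = 1" unfolding e by (simp only: if_True)
        then show ?thesis using * True by (simp only: if_True) simp
      next
        case False
        then have "ev e (b ^ j) = 0" unfolding e by (simp only: if_False)
        then show ?thesis using * False by (simp only: if_False) simp
      qed
    qed
    obtain k where k: "(\<Prod>j\<in>units1. ev h (b ^ j)) = b ^ k" "\<not> M dvd k"
      using prod_units1_char_2[OF char2 N f M b evh] by blast
    have "b ^ M = 1" using b by simp
    then have "b \<noteq> 0" using odd_pos[OF odd_M] by (auto simp: power_0_left)
    then have "b ^ k \<noteq> 0" by simp
    moreover have "b ^ k \<noteq> 1" using k(2) b by simp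
    moreover have "b ^ k = of_int A1" using HA k(1) by simp
    ultimately show False using of_int_char_2[OF char2, of A1] by (auto split: if_splits)
  qed
  define n where "n = A1^2 - A1 * B1 + B1^2"
  have n_prod: "of_int n = (\<Prod>j\<in>units. 1 + of_int c * ev (g K) (z ^ j))"
  proof -
    have "(\<Prod>j\<in>units. 1 + of_int c * ev (g K) (z ^ j)) = (\<Prod>j\<in>units. ev h (z ^ j))" by (simp add: h_def)
    also have "\<dots> = \<gamma> * cnj \<gamma>" unfolding \<gamma>_def by (rule prod_units_split)
    also have "\<dots> = (of_int A1 + of_int B1 * \<omega>) * (of_int A1 + of_int B1 * (- 1 - \<omega>))"
      unfolding gamma by (simp add: cnj_omega)
    also have "\<dots> = of_int A1^2 - of_int A1 * of_int B1 - of_int B1^2 * (\<omega> + \<omega>^2)"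
      by (simp add: power2_eq_square algebra_simps)
    also have "\<dots> = of_int n" unfolding omega by (simp add: n_def)
    finally show ?thesis by simp
  qed
  obtain B2 where B2: "B1 = 3 * B2" by (auto simp: B1_def c'_def)
  have n4: "4 * n = (2 * A1 - B1)^2 + 27 * B2^2"
    unfolding n_def B2 by (simp add: power2_eq_square algebra_simps)
  have "odd (2 * A1 - B1)" using \<open>odd B1\<close> by simp
  have "odd n"
  proof -
    have "n = A1 * (A1 - B1) + B1^2" by (simp add: n_def power2_eq_square algebra_simps)
    then show ?thesis using \<open>odd B1\<close> by simp
  qed
  have "n \<ge> 0" using n4 zero_le_power2[of "2 * A1 - B1"] zero_le_power2[of B2] by linarith
  then have "n > 0" using \<open>odd n\<close> by (cases "n = 0") auto
  define n0 where "n0 = nat n"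
  have n0: "int n0 = n" "n0 > 0" using \<open>n > 0\<close> by (simp_all add: n0_def)
  obtain p where p: "prime p" "p dvd n0" "\<not> (\<exists>u v :: int. int p = u^2 + 27 * v ^ 2)"
    using not_all_prime_factors_of_form[of n0 "2 * A1 - B1" B2] n4 n0 \<open>odd (2 * A1 - B1)\<close> by auto
  have pn: "int p dvd n" using p(2) n0(1) by (metis int_dvd_int_iff)
  have p2: "p \<noteq> 2" using pn \<open>odd n\<close> by auto
  have pc': "\<not> int p dvd c'"
  proof
    assume "int p dvd c'"
    moreover have "n = c' * (2 * A0 + c' * A0^2 - B0 - c' * A0 * B0 + c' * B0^2) + 1"
      by (simp add: n_def A1_def B1_def power2_eq_square algebra_simps)
    ultimately have "int p dvd 1" using pn by (metis dvd_add_right_iff dvd_mult2)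
    then show False using p(1) by (metis not_prime_unit prime_nat_int_transfer)
  qed
  then have pd: "\<not> int p dvd w' * D * B" using d(2)[OF p(1) p2] by (auto simp: c'_def)
  then have "\<not> int p dvd w'" "\<not> int p dvd D" "\<not> int p dvd B" by auto
  moreover have "\<not> int p dvd c" using \<open>\<not> int p dvd w'\<close> pc' p(1) by (simp add: c_def prime_dvd_mult_iff)
  ultimately have "[p = 1] (mod N)" using D(2)[OF p(1) _ _ pn n_prod] by blast
  then show thesis using that p(1,3) p2 \<open>\<not> int p dvd B\<close> by blast
qed

end

section \<open>Choice of the order N, and infinitely many primes of both kinds\<close>

lemma cis_power_eq_1_iff:
  assumes "N > 0"
  shows "cis (2 * pi / real N) ^ k = 1 \<longleftrightarrow> N dvd k"
proof
  assume "cis (2 * pi / real N) ^ k = 1"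
  then have "cis (2 * pi * real k / real N) = 1" by (simp add: Complex.DeMoivre mult_ac)
  then have "cos (2 * pi * real k / real N) = 1" by (metis cis.sel(1) one_complex.sel(1))
  then obtain i :: int where "2 * pi * real k / real N = real_of_int i * (2 * pi)"
    using cos_one_2pi_int by auto
  then have "real k = real_of_int i * real N" using assms by (simp add: field_simps)
  then have "real_of_int (int k) = real_of_int (i * int N)" by simp
  then have "int k = i * int N" by (simp only: of_int_eq_iff)
  then have "int N dvd int k" by simp
  then show "N dvd k" by (simp only: int_dvd_int_iff)
next
  assume "N dvd k"
  then obtain i where "k = N * i" by blast
  then have "real k * (2 * pi / real N) = 2 * pi * real i" using assms by (simp add: field_simps)
  then have "cis (2 * pi / real N) ^ k = cis (2 * pi * real i)" by (simp only: Complex.DeMoivre)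
  also have "\<dots> = 1" by (rule cis_multiple_2pi) simp
  finally show "cis (2 * pi / real N) ^ k = 1" .
qed

text \<open>With m the odd part of \<open>M\<close> and f its totient, m divides 2^f - 1 and hence
  4^f - 1. The base 4 makes \<open>M'\<close> divisible by 3, and the exponent \<open>Suc a\<close>
  makes N even also for odd \<open>M\<close>.\<close>

lemma cyclotomic_modulus:
  fixes M :: nat
  assumes "M > 0"
  obtains N a M' f where "M dvd N" "N = 2 ^ Suc a * M'" "f > 0" "M' + 1 = 4 ^ f"
    "cyclotomic_3 N (cis (2 * pi / real N))"
proof -
  obtain m where m: "M = 2 ^ multiplicity 2 M * m" "\<not> 2 dvd m"
    using multiplicity_decompose'[of M 2] assms by auto
  define a where "a = multiplicity 2 M"
  define f where "f = totient m"
  have m0: "m > 0" using m(1) assms by (cases m) auto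
  have f0: "f > 0" using m0 by (simp add: f_def)
  define M' where "M' = 4 ^ f - (1 :: nat)"
  have M': "M' + 1 = 4 ^ f" by (simp add: M'_def)
  have "coprime 2 m" using m(2) by simp
  then have "[2 ^ f = 1] (mod m)" unfolding f_def by (rule euler_theorem)
  then have "[(2 ^ f) ^ 2 = 1 ^ 2] (mod m)" by (rule cong_pow)
  moreover have "(2 ^ f) ^ 2 = (4 :: nat) ^ f" by (simp add: power_mult[symmetric] mult.commute[of f]) (simp add: power_mult)
  ultimately have "[M' + 1 = 0 + 1] (mod m)" unfolding M' by simp
  then have "m dvd M'" by (simp only: cong_add_rcancel_nat cong_0_iff)
  then have "M dvd 2 ^ Suc a * M'" using m(1) unfolding a_def
    by (metis dvd_mult_left mult_dvd_mono power_Suc dvd_triv_right)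
  moreover have "cyclotomic_3 (2 ^ Suc a * M') (cis (2 * pi / real (2 ^ Suc a * M')))"
  proof
    have "(4::nat) ^ 1 \<le> 4 ^ f" using f0 by (intro power_increasing) auto
    then have "M' \<ge> 3" unfolding M'[symmetric] by simp
    moreover have "(2 :: nat) ^ Suc a \<ge> 1" by simp
    ultimately have "1 * 3 \<le> 2 ^ Suc a * M'" by (intro mult_le_mono)
    then show ge2: "2 \<le> 2 ^ Suc a * M'" by linarith
    from ge2 show "(cis (2 * pi / real (2 ^ Suc a * M')) ^ k = 1) = (2 ^ Suc a * M' dvd k)" for k
      by (intro cis_power_eq_1_iff) linarith
    have "M' = 3 * (\<Sum>l<f. 4 ^ l)" using sum_powers_4[of f] M' by simp
    then show "3 dvd 2 ^ Suc a * M'" by simp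
  qed
  ultimately show thesis using that[OF _ refl f0 M'] by blast
qed

lemma not_dvd_fact_imp_gt: "\<not> int p dvd fact n \<Longrightarrow> p > 0 \<Longrightarrow> p > n"
proof (rule ccontr)
  assume "\<not> int p dvd fact n" "p > 0" "\<not> p > n"
  then have "p dvd fact n" by (simp add: dvd_fact)
  then have "int p dvd int (fact n)" by (simp only: int_dvd_int_iff)
  then have "int p dvd fact n" by (simp only: of_nat_fact)
  then show False using \<open>\<not> int p dvd fact n\<close> by simp
qed

theorem infinitely_many_primes_with_cube_roots_2:
  assumes "M > 0"
  shows "\<exists>p>n. prime p \<and> [p = 1] (mod M) \<and> card {r \<in> {0..<int p}. [r^3 = 2] (mod int p)} = 3"
proof -
  obtain N a M' f where N: "M dvd N" "N = 2 ^ Suc a * M'" "f > 0" "M' + 1 = 4 ^ f"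
    "cyclotomic_3 N (cis (2 * pi / real N))" by (rule cyclotomic_modulus[OF assms])
  interpret cyclotomic_3 N "cis (2 * pi / real N)" by (rule N(5))
  \<comment> \<open>Avoiding the divisors of n! forces p > n, and the factor 2 keeps
    \<open>chi 2\<close> nonzero.\<close>
  obtain p where p: "prime p" "[p = 1] (mod N)" "\<not> int p dvd 2 * fact n" "[2 ^ ((p - 1) div 3) = 1] (mod int p)"
    using prime_with_cubic_residue_2[OF three_dvd_N, of "2 * fact n"] by auto
  have p2: "\<not> int p dvd 2" "\<not> int p dvd fact n" using p(3) by auto
  have p13: "[p = 1] (mod 3)" using p(2) three_dvd_N cong_dvd_modulus_nat by blast
  obtain m w \<omega> where "cubic_character p m w \<omega>" using cubic_character_exists[OF p(1) p13] .
  then interpret cubic_character p m w \<omega> .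
  have "(p - 1) div 3 = m" using p_eq by simp
  then have "chi 2 = 1" using chi_eqI[OF p2(1), of 0] p(4) by simp
  then have "card {r \<in> {0..<int p}. [r^3 = 2] (mod int p)} = 3" using card_cube_roots_2 by simp
  moreover have "[p = 1] (mod M)" using p(2) N(1) cong_dvd_modulus_nat by blast
  moreover have "p > n" using not_dvd_fact_imp_gt[OF p2(2)] p(1) prime_gt_0_nat by blast
  ultimately show ?thesis using p(1) by blast
qed

theorem infinitely_many_primes_without_cube_roots_2:
  assumes "M > 0"
  shows "\<exists>p>n. prime p \<and> [p = 1] (mod M) \<and> card {r \<in> {0..<int p}. [r^3 = 2] (mod int p)} = 0"
proof -
  obtain N a M' f where N: "M dvd N" "N = 2 ^ Suc a * M'" "f > 0" "M' + 1 = 4 ^ f"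
    "cyclotomic_3 N (cis (2 * pi / real N))" by (rule cyclotomic_modulus[OF assms])
  interpret cyclotomic_3 N "cis (2 * pi / real N)" by (rule N(5))
  obtain p where p: "prime p" "[p = 1] (mod N)" "\<not> int p dvd fact n"
    "\<not> (\<exists>u v :: int. int p = u^2 + 27 * v ^ 2)"
    using prime_without_cubic_residue_2[OF N(2-4), of "fact n"] by (metis fact_nonzero)
  have p13: "[p = 1] (mod 3)" using p(2) three_dvd_N cong_dvd_modulus_nat by blast
  have "card {r \<in> {0..<int p}. [r^3 = 2] (mod int p)} = 0"
    using card_cube_roots_2_one_mod_3[OF p(1) p13] p(4) by auto
  moreover have "[p = 1] (mod M)" using p(2) N(1) cong_dvd_modulus_nat by blast
  moreover have "p > n" using not_dvd_fact_imp_gt[OF p(3)] p(1) prime_gt_0_nat by blast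
  ultimately show ?thesis using p(1) by blast
qed

section \<open>Lattices between pL and L\<close>

lemma card_image_eq_if_same_kernel:
  assumes "\<And>u v. u \<in> H \<Longrightarrow> v \<in> H \<Longrightarrow> f u = f v \<longleftrightarrow> g u = g v"
  shows "card (f ` H) = card (g ` H)"
proof -
  define h where "h y = g (inv_into H f y)" for y
  have h: "h (f u) = g u" if "u \<in> H" for u
  proof -
    have "inv_into H f (f u) \<in> H" "f (inv_into H f (f u)) = f u"
      using that by (auto intro: inv_into_into f_inv_into_f)
    then show ?thesis using assms[of "inv_into H f (f u)" u] that by (simp add: h_def)
  qed
  have "inj_on h (f ` H)"
  proof
    fix x y assume "x \<in> f ` H" "y \<in> f ` H" "h x = h y"
    then show "x = y" using h assms by auto
  qed
  then have "card (h ` f ` H) = card (f ` H)" by (rule card_image)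
  moreover have "h ` f ` H = g ` H" using h by (auto simp: image_iff)
  ultimately show ?thesis by simp
qed

locale mod_p_lattices = Modules.module zmul
  for zmul :: "int \<Rightarrow> 'a::ab_group_add \<Rightarrow> 'a" +
  fixes p :: nat
  assumes prime_p: "prime p"
begin

text \<open>A subgroup containing \<open>pL\<close> stands for a subspace of \<open>L/pL\<close>.\<close>

definition lat :: "'a set \<Rightarrow> bool" where
  "lat H \<longleftrightarrow> (\<forall>u\<in>H. \<forall>v\<in>H. u + v \<in> H) \<and> (\<forall>u\<in>H. - u \<in> H) \<and> (\<forall>u. zmul (int p) u \<in> H)"

definition PL :: "'a set" where "PL = range (zmul (int p))"

lemma lat_add: "lat H \<Longrightarrow> u \<in> H \<Longrightarrow> v \<in> H \<Longrightarrow> u + v \<in> H"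
  and lat_uminus: "lat H \<Longrightarrow> u \<in> H \<Longrightarrow> - u \<in> H"
  and lat_p: "lat H \<Longrightarrow> zmul (int p) u \<in> H"
  by (auto simp: lat_def)

lemma lat_diff: "lat H \<Longrightarrow> u \<in> H \<Longrightarrow> v \<in> H \<Longrightarrow> u - v \<in> H"
  using lat_add[of H u "- v"] lat_uminus[of H v] by simp

lemma lat_0: "lat H \<Longrightarrow> 0 \<in> H"
  using lat_p[of H 0] by simp

lemma lat_scale: assumes "lat H" "u \<in> H" shows "zmul n u \<in> H"
proof -
  have nat: "zmul (int k) u \<in> H" for k
    by (induction k) (use assms in \<open>auto simp: lat_0 scale_left_distrib intro: lat_add\<close>)
  show ?thesis
  proof (cases "n \<ge> 0")
    case True
    then show ?thesis using nat[of "nat n"] by simp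
  next
    case False
    then have "zmul n u = - zmul (int (nat (- n))) u" by simp
    then show ?thesis using nat assms lat_uminus by metis
  qed
qed

lemma lat_scale_dvd: assumes "lat H" "int p dvd n" shows "zmul n u \<in> H"
proof -
  obtain k where "n = int p * k" using assms(2) by blast
  then have "zmul n u = zmul (int p) (zmul k u)" by simp
  then show ?thesis using lat_p[OF assms(1)] by metis
qed

lemma lat_cong_iff: assumes "lat H" "u - v \<in> H" shows "u \<in> H \<longleftrightarrow> v \<in> H"
  using lat_add[OF assms(1), of "u - v" v] lat_diff[OF assms(1), of u "u - v"] assms(2) by auto

lemma lat_add_cancel: assumes "lat H" "u \<in> H" shows "u + v \<in> H \<longleftrightarrow> v \<in> H"
  using lat_cong_iff[OF assms(1), of "u + v" v] assms(2) by simp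

lemma lat_PL: "lat PL"
  unfolding lat_def PL_def
  by (auto simp: image_iff) (metis scale_right_distrib, metis scale_minus_right)

lemma PL_least: "lat H \<Longrightarrow> PL \<subseteq> H" by (auto simp: PL_def lat_p)

lemma lat_UNIV [simp]: "lat UNIV" by (simp add: lat_def)

lemma lat_Int: "lat H \<Longrightarrow> lat K \<Longrightarrow> lat (H \<inter> K)" by (auto simp: lat_def)

definition coset :: "'a set \<Rightarrow> 'a \<Rightarrow> 'a set" where "coset K u = (+) u ` K"

text \<open>Counting the cosets that \<open>H\<close> meets does not presuppose that
  \<open>K\<close> lies in \<open>H\<close>. An infinite count would give 0;
  \<open>finite_cosets\<close> excludes this.\<close>

definition idx :: "'a set \<Rightarrow> 'a set \<Rightarrow> nat" where "idx K H = card (coset K ` H)"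

lemma mem_coset: "v \<in> coset K u \<longleftrightarrow> v - u \<in> K"
  by (auto simp: coset_def image_iff algebra_simps) (metis add.commute diff_add_cancel)

lemma coset_eq_iff: assumes "lat K" shows "coset K u = coset K v \<longleftrightarrow> u - v \<in> K"
proof
  assume "coset K u = coset K v"
  moreover have "u \<in> coset K u" using lat_0[OF assms] by (simp add: mem_coset)
  ultimately show "u - v \<in> K" by (simp add: mem_coset)
next
  assume uv: "u - v \<in> K"
  have "x - u \<in> K \<longleftrightarrow> x - v \<in> K" for x
    using lat_add_cancel[OF assms uv, of "x - u"] by (simp add: algebra_simps)
  then show "coset K u = coset K v" by (auto simp: mem_coset)
qed

lemma idx_eq_card:
  assumes "lat K" "\<And>u v. u \<in> H \<Longrightarrow> v \<in> H \<Longrightarrow> f u = f v \<longleftrightarrow> u - v \<in> K"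
  shows "idx K H = card (f ` H)"
  unfolding idx_def by (rule card_image_eq_if_same_kernel) (simp add: assms coset_eq_iff)

lemma idx_self: "lat K \<Longrightarrow> idx K K = 1"
proof -
  assume K: "lat K"
  then have "idx K K = card ((\<lambda>_. ()) ` K)" by (intro idx_eq_card) (auto intro: lat_diff)
  also have "(\<lambda>_. ()) ` K = {()}" using lat_0[OF K] by auto
  finally show ?thesis by simp
qed

definition ssum :: "'a set \<Rightarrow> 'a set \<Rightarrow> 'a set" where
  "ssum A B = {a + b | a b. a \<in> A \<and> b \<in> B}"

lemma ssumI: "a \<in> A \<Longrightarrow> b \<in> B \<Longrightarrow> a + b \<in> ssum A B" by (auto simp: ssum_def)

lemma ssumE: assumes "x \<in> ssum A B" obtains a b where "a \<in> A" "b \<in> B" "x = a + b"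
  using assms by (auto simp: ssum_def)

lemma lat_ssum: assumes "lat A" "lat B" shows "lat (ssum A B)"
  unfolding lat_def
proof (intro conjI ballI allI)
  fix u v assume "u \<in> ssum A B" "v \<in> ssum A B"
  then obtain a b a' b' where *: "a \<in> A" "b \<in> B" "u = a + b" "a' \<in> A" "b' \<in> B" "v = a' + b'"
    by (auto simp: ssum_def)
  have "(a + a') + (b + b') \<in> ssum A B" using * assms by (intro ssumI lat_add)
  then show "u + v \<in> ssum A B" using * by (simp add: algebra_simps)
next
  fix u assume "u \<in> ssum A B"
  then obtain a b where *: "a \<in> A" "b \<in> B" "u = a + b" by (auto simp: ssum_def)
  have "(- a) + (- b) \<in> ssum A B" using * assms by (intro ssumI lat_uminus)
  then show "- u \<in> ssum A B" using * by (simp add: algebra_simps)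
next
  fix u show "zmul (int p) u \<in> ssum A B"
    using ssumI[of "zmul (int p) u" A 0 B] assms by (simp add: lat_p lat_0)
qed

lemma ssum_upper: "lat B \<Longrightarrow> A \<subseteq> ssum A B" "lat A \<Longrightarrow> B \<subseteq> ssum A B"
  using ssumI[of _ A 0 B] ssumI[of 0 A _ B] lat_0 by auto

lemma ssum_least: "lat H \<Longrightarrow> A \<subseteq> H \<Longrightarrow> B \<subseteq> H \<Longrightarrow> ssum A B \<subseteq> H"
  by (auto simp: ssum_def intro: lat_add)

text \<open>Second isomorphism theorem: \<open>I\<close> meets every coset of \<open>Z\<close> in
  the sum, and it is cut by them into cosets of the intersection.\<close>

lemma idx_ssum: assumes "lat I" "lat Z" shows "idx Z (ssum I Z) = idx (I \<inter> Z) I"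
proof -
  have "coset Z ` ssum I Z = coset Z ` I"
  proof (intro equalityI subsetI)
    fix C assume "C \<in> coset Z ` ssum I Z"
    then obtain a b where ab: "a \<in> I" "b \<in> Z" "C = coset Z (a + b)" by (auto simp: ssum_def)
    then have "C = coset Z a" using coset_eq_iff[OF assms(2), of "a + b" a] by simp
    then show "C \<in> coset Z ` I" using ab by blast
  qed (use ssum_upper(1)[OF assms(2)] in blast)
  moreover have "idx (I \<inter> Z) I = card (coset Z ` I)"
    by (rule idx_eq_card) (use assms in \<open>auto simp: lat_Int coset_eq_iff intro: lat_diff\<close>)
  ultimately show ?thesis by (simp add: idx_def)
qed

definition adjoin :: "'a set \<Rightarrow> 'a \<Rightarrow> 'a set" where
  "adjoin K c = {k + zmul n c | k n. k \<in> K}"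

lemma adjoinI: "k \<in> K \<Longrightarrow> k + zmul n c \<in> adjoin K c" by (auto simp: adjoin_def)

lemma lat_adjoin: assumes "lat K" shows "lat (adjoin K c)"
  unfolding lat_def
proof (intro conjI ballI allI)
  fix u v assume "u \<in> adjoin K c" "v \<in> adjoin K c"
  then obtain k n k' n' where *: "k \<in> K" "u = k + zmul n c" "k' \<in> K" "v = k' + zmul n' c"
    by (auto simp: adjoin_def)
  have "(k + k') + zmul (n + n') c \<in> adjoin K c" using * assms by (intro adjoinI lat_add)
  then show "u + v \<in> adjoin K c" using * by (simp add: scale_left_distrib algebra_simps)
next
  fix u assume "u \<in> adjoin K c"
  then obtain k n where *: "k \<in> K" "u = k + zmul n c" by (auto simp: adjoin_def)
  have "- k + zmul (- n) c \<in> adjoin K c" using * assms by (intro adjoinI lat_uminus)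
  then show "- u \<in> adjoin K c" using * by simp
next
  fix u show "zmul (int p) u \<in> adjoin K c"
    using adjoinI[of "zmul (int p) u" K 0 c] assms by (simp add: lat_p)
qed

lemma adjoin_upper: "K \<subseteq> adjoin K c" using adjoinI[of _ K 0 c] by auto

lemma adjoin_mem: "lat K \<Longrightarrow> c \<in> adjoin K c" using adjoinI[of 0 K 1 c] lat_0 by simp

lemma adjoin_least: "lat H \<Longrightarrow> K \<subseteq> H \<Longrightarrow> c \<in> H \<Longrightarrow> adjoin K c \<subseteq> H"
  by (auto simp: adjoin_def intro!: lat_add lat_scale)

text \<open>\<open>K\<close> contains p c, so by Bezout a multiple n c in \<open>K\<close> with n
  prime to p would bring c itself into \<open>K\<close>.\<close>

lemma scale_mem_iff: assumes "lat K" "c \<notin> K" shows "zmul n c \<in> K \<longleftrightarrow> int p dvd n"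
proof
  assume n: "zmul n c \<in> K"
  show "int p dvd n"
  proof (rule ccontr)
    assume "\<not> int p dvd n"
    then have "coprime (int p) n" using prime_p by (simp add: prime_imp_coprime)
    then obtain x y where "x * int p + y * n = 1" using bezout_int[of "int p" n] by (auto simp: coprime_iff_gcd_eq_1)
    then have "zmul (x * int p + y * n) c = c" by simp
    moreover have "zmul (x * int p) c \<in> K" using assms(1) by (rule lat_scale_dvd) simp
    moreover have "zmul (y * n) c \<in> K" using lat_scale[OF assms(1) n, of y] by simp
    ultimately have "c \<in> K" using lat_add[OF assms(1)] by (metis scale_left_distrib)
    then show False using assms(2) by simp
  qed
qed (rule lat_scale_dvd[OF assms(1)])

lemma p_gt_1: "p > 1" using prime_p by (rule prime_gt_1_nat)

lemma idx_adjoin: assumes "lat K" "c \<notin> K" shows "idx K (adjoin K c) = p"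
proof -
  have "coset K ` adjoin K c = (\<lambda>n. coset K (zmul (int n) c)) ` {..<p}"
  proof (intro equalityI subsetI)
    fix C assume "C \<in> coset K ` adjoin K c"
    then obtain k n where *: "k \<in> K" "C = coset K (k + zmul n c)" by (auto simp: adjoin_def)
    define m where "m = nat (n mod int p)"
    have m: "int m = n mod int p" using p_gt_1 by (simp add: m_def)
    have "zmul (n - int m) c \<in> K" unfolding m by (rule lat_scale_dvd[OF assms(1)]) (simp add: minus_mod_eq_mult_div)
    then have "k + zmul (n - int m) c \<in> K" using *(1) by (rule lat_add[OF assms(1), rotated])
    then have "C = coset K (zmul (int m) c)"
      unfolding *(2) coset_eq_iff[OF assms(1)] by (simp add: scale_left_diff_distrib algebra_simps)
    moreover have "int m < int p" unfolding m using p_gt_1 by simp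
    ultimately show "C \<in> (\<lambda>n. coset K (zmul (int n) c)) ` {..<p}" by auto
  next
    fix C assume "C \<in> (\<lambda>n. coset K (zmul (int n) c)) ` {..<p}"
    then show "C \<in> coset K ` adjoin K c" using adjoinI[OF lat_0[OF assms(1)]] by auto
  qed
  moreover have "inj_on (\<lambda>n. coset K (zmul (int n) c)) {..<p}"
  proof
    fix m n assume mn: "m \<in> {..<p}" "n \<in> {..<p}" "coset K (zmul (int m) c) = coset K (zmul (int n) c)"
    then have "zmul (int m - int n) c \<in> K"
      by (simp add: coset_eq_iff[OF assms(1)] scale_left_diff_distrib)
    then have "int p dvd int m - int n" using scale_mem_iff[OF assms] by blast
    then have "[int m = int n] (mod int p)" by (simp add: cong_iff_dvd_diff)
    then show "m = n" using mn by (simp add: cong_int_iff unique_euclidean_semiring_class.cong_def)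
  qed
  ultimately show ?thesis by (simp add: idx_def card_image)
qed

end

locale finite_mod_p_lattices = mod_p_lattices +
  assumes finite_quotient: "finite (coset PL ` UNIV)"
begin

lemma finite_cosets: assumes "lat K" shows "finite (coset K ` H)"
proof -
  have "coset K u = ssum (coset PL u) K" for u
  proof (intro equalityI subsetI)
    fix x assume "x \<in> coset K u"
    then have "x - u \<in> K" by (simp add: mem_coset)
    moreover have "u \<in> coset PL u" using lat_0[OF lat_PL] by (simp add: mem_coset)
    ultimately have "u + (x - u) \<in> ssum (coset PL u) K" by (intro ssumI)
    then show "x \<in> ssum (coset PL u) K" by simp
  next
    fix x assume "x \<in> ssum (coset PL u) K"
    then obtain a b where ab: "a - u \<in> PL" "b \<in> K" "x = a + b" by (auto simp: mem_coset elim: ssumE)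
    then have "(a - u) + b \<in> K" using PL_least[OF assms] assms by (auto intro: lat_add)
    then show "x \<in> coset K u" using ab(3) by (simp add: mem_coset algebra_simps)
  qed
  then have "coset K ` H \<subseteq> (\<lambda>C. ssum C K) ` coset PL ` UNIV" by auto
  then show ?thesis using finite_quotient finite_subset by blast
qed

lemma idx_pos: assumes "lat K" "lat H" shows "idx K H > 0"
  unfolding idx_def card_gt_0_iff using finite_cosets[OF assms(1)] lat_0[OF assms(2)] by blast

lemma idx_1_imp_subset: assumes "lat K" "lat H" "idx K H = 1" shows "H \<subseteq> K"
proof
  fix u assume u: "u \<in> H"
  obtain C where "coset K ` H = {C}" using assms(3) card_1_singletonE unfolding idx_def by blast
  then have "coset K u = coset K 0" using u lat_0[OF assms(2)] by blast
  then show "u \<in> K" by (simp add: coset_eq_iff[OF assms(1)])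
qed

text \<open>A lattice is a union of cosets of \<open>PL\<close>, and there are finitely many of
  these.\<close>

lemma finite_lats: "finite {T. lat T \<and> P T}"
proof (rule finite_subset)
  show "{T. lat T \<and> P T} \<subseteq> Union ` Pow (coset PL ` UNIV)"
  proof
    fix T assume "T \<in> {T. lat T \<and> P T}"
    then have T: "lat T" by simp
    have "T = \<Union> (coset PL ` T)"
      using PL_least[OF T] lat_0[OF lat_PL] lat_cong_iff[OF T] by (auto simp: mem_coset)
    then show "T \<in> Union ` Pow (coset PL ` UNIV)" by blast
  qed
qed (use finite_quotient in simp)

text \<open>With a representative r chosen in every J-coset of \<open>H\<close>, an element u is
  described modulo \<open>K\<close> by its J-coset and the K-coset of u - r.\<close>

lemma idx_mult:
  assumes "lat K" "lat J" "lat H" "K \<subseteq> J" "J \<subseteq> H"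
  shows "idx K H = idx K J * idx J H"
proof -
  define r where "r C = (SOME u. u \<in> H \<and> C = coset J u)" for C
  have r: "r (coset J u) \<in> H \<and> coset J u = coset J (r (coset J u))" if "u \<in> H" for u
    unfolding r_def by (rule someI[of _ u]) (use that in simp)
  have r1: "u - r (coset J u) \<in> J" if "u \<in> H" for u
    using r[OF that] coset_eq_iff[OF assms(2)] by blast
  let ?f = "\<lambda>u. (coset K (u - r (coset J u)), coset J u)"
  have "idx K H = card (?f ` H)"
  proof (rule idx_eq_card[OF assms(1)])
    fix u v assume uv: "u \<in> H" "v \<in> H"
    show "?f u = ?f v \<longleftrightarrow> u - v \<in> K"
    proof
      assume eq: "?f u = ?f v"
      then have cJ: "coset J u = coset J v" by simp
      have "coset K (u - r (coset J u)) = coset K (v - r (coset J v))"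
        using eq unfolding prod.inject by blast
      then have "(u - r (coset J u)) - (v - r (coset J v)) \<in> K"
        by (simp only: coset_eq_iff[OF assms(1)])
      then show "u - v \<in> K" unfolding cJ by simp
    next
      assume "u - v \<in> K"
      moreover from this have "coset J u = coset J v" using assms(4) by (auto simp: coset_eq_iff[OF assms(2)])
      ultimately show "?f u = ?f v" by (simp add: coset_eq_iff[OF assms(1)])
    qed
  qed
  also have "?f ` H = coset K ` J \<times> coset J ` H"
  proof (intro equalityI subsetI)
    fix x assume "x \<in> coset K ` J \<times> coset J ` H"
    then obtain j u where x: "j \<in> J" "u \<in> H" "x = (coset K j, coset J u)" by auto
    let ?v = "j + r (coset J u)"
    have vH: "?v \<in> H" using x(1,2) r[OF x(2)] assms(3,5) by (auto intro: lat_add)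
    have "coset J ?v = coset J (r (coset J u))" using x(1) by (simp add: coset_eq_iff[OF assms(2)])
    then have "coset J ?v = coset J u" using r[OF x(2)] by simp
    then have "?f ?v = x" using x(3) by simp
    then show "x \<in> ?f ` H" using vH by blast
  qed (use r1 in auto)
  finally show ?thesis by (simp add: idx_def card_cartesian_product)
qed

lemma idx_dvd_power:
  assumes "lat K" "lat J" "lat H" "K \<subseteq> J" "J \<subseteq> H" "idx K H = p ^ n"
  obtains k where "k \<le> n" "idx K J = p ^ k" "idx J H = p ^ (n - k)"
proof -
  have eq: "idx K J * idx J H = p ^ n" using idx_mult[OF assms(1-5)] assms(6) by simp
  then have "idx K J dvd p ^ n" by (metis dvd_triv_left)
  then obtain k where k: "k \<le> n" "idx K J = p ^ k" using divides_primepow_nat[OF prime_p] by blast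
  then have "p ^ k * idx J H = p ^ k * p ^ (n - k)" using eq by (simp add: power_add[symmetric])
  then have "idx J H = p ^ (n - k)" using p_gt_1 by simp
  then show thesis using that k by blast
qed

end

section \<open>Counting the lattices between two given ones\<close>

lemma flag_count:
  assumes "finite A" "finite B" "\<And>x. x \<in> A \<Longrightarrow> card {y \<in> B. R x y} = a" "\<And>y. y \<in> B \<Longrightarrow> card {x \<in> A. R x y} = b"
  shows "card A * a = card B * b"
proof -
  have "(\<Sum>x\<in>A. card {y \<in> B. R x y}) = (\<Sum>y\<in>B. card {x \<in> A. R x y})"
    using assms(1,2) by (rule sum_multicount_gen) simp
  then show ?thesis using assms(3,4) by simp
qed

context finite_mod_p_lattices begin

lemma eq_if_idx_eq:
  assumes "lat K" "lat A" "lat B" "K \<subseteq> A" "A \<subseteq> B" "idx K A = idx K B"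
  shows "A = B"
proof -
  have "idx K A * 1 = idx K A * idx A B" using idx_mult[OF assms(1-5)] unfolding assms(6) by simp
  then have "1 = idx A B" unfolding mult_cancel1 using idx_pos[OF assms(1,2)] by simp
  then have "idx A B = 1" by simp
  then show ?thesis using idx_1_imp_subset[OF assms(2,3)] assms(5) by blast
qed

text \<open>Stands for the n-dimensional subspaces of H/K, with the dimension encoded by the index
  p^n.\<close>

definition between :: "'a set \<Rightarrow> 'a set \<Rightarrow> nat \<Rightarrow> 'a set set" where
  "between K H n = {T. lat T \<and> K \<subseteq> T \<and> T \<subseteq> H \<and> idx K T = p ^ n}"

lemma finite_between [simp]: "finite (between K H n)"
  unfolding between_def by (rule finite_lats)

lemma between_0: assumes "lat K" "lat H" "K \<subseteq> H" shows "between K H 0 = {K}"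
proof (intro equalityI subsetI)
  fix T assume "T \<in> between K H 0"
  then have "lat T" "K \<subseteq> T" "idx K T = 1" by (auto simp: between_def)
  then show "T \<in> {K}" using idx_1_imp_subset[OF assms(1)] by blast
qed (use assms idx_self[OF assms(1)] in \<open>simp add: between_def\<close>)

lemma between_top: assumes "lat K" "lat H" "K \<subseteq> H" "idx K H = p ^ n" shows "between K H n = {H}"
proof (intro equalityI subsetI)
  fix T assume "T \<in> between K H n"
  then have "lat T" "K \<subseteq> T" "T \<subseteq> H" "idx K T = idx K H" using assms(4) by (auto simp: between_def)
  then show "T \<in> {H}" using eq_if_idx_eq[OF assms(1) _ assms(2)] by blast
qed (use assms in \<open>simp add: between_def\<close>)

lemma between_empty: assumes "lat K" "lat H" "K \<subseteq> H" "idx K H = p ^ n" "n < k" shows "between K H k = {}"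
proof (rule ccontr)
  assume "between K H k \<noteq> {}"
  then obtain T where T: "lat T" "K \<subseteq> T" "T \<subseteq> H" "idx K T = p ^ k" by (auto simp: between_def)
  obtain l where "l \<le> n" "idx K T = p ^ l" using idx_dvd_power[OF assms(1) T(1) assms(2) T(2,3) assms(4)] by blast
  then show False using T(4) assms(5) p_gt_1 by simp
qed

text \<open>The q-integer (p^m - 1)/(p - 1), written as a sum to stay within the natural
  numbers.\<close>

definition qnum :: "nat \<Rightarrow> nat" where "qnum m = (\<Sum>i<m. p ^ i)"

lemma qnum_Suc: "qnum (Suc m) = qnum m + p ^ m" by (simp add: qnum_def)

lemma qnum_mult: "qnum m * (p - 1) + 1 = p ^ m"
proof (induction m)
  case (Suc m)
  have "qnum (Suc m) * (p - 1) + 1 = p ^ m + p ^ m * (p - 1)"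
    using Suc by (simp add: qnum_Suc algebra_simps)
  also have "\<dots> = p ^ m * (1 + (p - 1))" by (simp only: distrib_left mult_1_right)
  also have "1 + (p - 1) = p" using p_gt_1 by simp
  finally show ?case by simp
qed (simp add: qnum_def)

lemma qnum_pos: "qnum (Suc m) > 0"
  using p_gt_1 by (simp add: qnum_Suc)

text \<open>The nonzero cosets of \<open>K\<close> in \<open>H\<close> are partitioned by the lines,
  and every line contains p - 1 of them.\<close>

lemma card_lines:
  assumes "lat K" "lat H" "K \<subseteq> H" "idx K H = p ^ n"
  shows "card (between K H 1) = qnum n"
proof -
  have outer: "card (coset K ` (T - K)) + 1 = idx K T" if T: "lat T" "K \<subseteq> T" for T
  proof -
    have "coset K ` T = insert (coset K 0) (coset K ` (T - K))"
    proof (intro equalityI subsetI)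
      fix C assume "C \<in> coset K ` T"
      then obtain x where "x \<in> T" "C = coset K x" by blast
      then show "C \<in> insert (coset K 0) (coset K ` (T - K))"
        by (cases "x \<in> K") (auto simp: coset_eq_iff[OF assms(1)])
    qed (use T lat_0 in auto)
    moreover have "coset K 0 \<notin> coset K ` (T - K)"
      using lat_uminus[OF assms(1)] by (auto simp: coset_eq_iff[OF assms(1)]) (metis minus_minus)
    ultimately show ?thesis unfolding idx_def using finite_cosets[OF assms(1)] by simp
  qed
  have un: "coset K ` (H - K) = (\<Union>T\<in>between K H 1. coset K ` (T - K))"
  proof (intro equalityI subsetI)
    fix C assume "C \<in> coset K ` (H - K)"
    then obtain h where h: "h \<in> H" "h \<notin> K" "C = coset K h" by blast
    have "adjoin K h \<in> between K H 1"
      unfolding between_def using assms h idx_adjoin[OF assms(1) h(2)]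
      by (simp add: lat_adjoin adjoin_upper adjoin_least)
    moreover have "h \<in> adjoin K h - K" using h(2) adjoin_mem[OF assms(1)] by simp
    ultimately show "C \<in> (\<Union>T\<in>between K H 1. coset K ` (T - K))" using h(3) by blast
  qed (auto simp: between_def)
  have disj: "coset K ` (T - K) \<inter> coset K ` (Y - K) = {}"
    if XY: "T \<in> between K H 1" "Y \<in> between K H 1" "T \<noteq> Y" for T Y
  proof (rule ccontr)
    assume "coset K ` (T - K) \<inter> coset K ` (Y - K) \<noteq> {}"
    then obtain x y where xy: "x \<in> T" "y \<in> Y" "y \<notin> K" "coset K x = coset K y" by blast
    have lXY: "lat T" "lat Y" "K \<subseteq> T" "K \<subseteq> Y" "idx K T = p" "idx K Y = p"
      using XY by (auto simp: between_def)
    have "x - y \<in> T" using xy(4) lXY(3) by (auto simp: coset_eq_iff[OF assms(1)])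
    then have "y \<in> T" using lat_cong_iff[OF lXY(1)] xy(1) by blast
    have "adjoin K y = Z" if "lat Z" "K \<subseteq> Z" "idx K Z = p" "y \<in> Z" for Z
      by (rule eq_if_idx_eq[OF assms(1) lat_adjoin[OF assms(1)] that(1) adjoin_upper])
        (use that idx_adjoin[OF assms(1) xy(3)] in \<open>simp_all add: adjoin_least\<close>)
    then have "T = Y" using lXY \<open>y \<in> T\<close> xy(2) by metis
    then show False using XY(3) by simp
  qed
  have "card (coset K ` (H - K)) = (\<Sum>T\<in>between K H 1. card (coset K ` (T - K)))"
    unfolding un using disj finite_cosets[OF assms(1)] by (intro card_UN_disjoint) auto
  also have "\<dots> = (\<Sum>T\<in>between K H 1. p - 1)"
  proof (rule sum.cong[OF refl])
    fix T assume "T \<in> between K H 1"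
    then have "card (coset K ` (T - K)) + 1 = p" using outer[of T] by (simp add: between_def)
    then show "card (coset K ` (T - K)) = p - 1" by simp
  qed
  finally have "card (between K H 1) * (p - 1) + 1 = p ^ n"
    using outer[OF assms(2,3)] assms(4) by simp
  then have "card (between K H 1) * (p - 1) = qnum n * (p - 1)" using qnum_mult[of n] by linarith
  then show ?thesis using p_gt_1 by simp
qed

lemma between_above:
  assumes "lat K" "lat H" "T \<in> between K H i"
  shows "{Y \<in> between K H (i + j). T \<subseteq> Y} = between T H j"
proof -
  have T: "lat T" "K \<subseteq> T" "T \<subseteq> H" "idx K T = p ^ i" using assms(3) by (auto simp: between_def)
  have "idx K Y = p ^ (i + j) \<longleftrightarrow> idx T Y = p ^ j" if "lat Y" "T \<subseteq> Y" for Y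
    using idx_mult[OF assms(1) T(1) that(1) T(2) that(2)] T(4) p_gt_1 by (simp add: power_add)
  then show ?thesis using T by (auto simp: between_def)
qed

lemma between_below:
  assumes "Y \<in> between K H j"
  shows "{T \<in> between K H i. T \<subseteq> Y} = between K Y i"
proof (intro equalityI subsetI)
  have YH: "Y \<subseteq> H" using assms by (simp add: between_def)
  fix T assume T: "T \<in> between K Y i"
  then have "T \<subseteq> Y" by (simp add: between_def)
  then have "T \<subseteq> H" using YH by (rule subset_trans)
  then show "T \<in> {T \<in> between K H i. T \<subseteq> Y}" using T by (simp add: between_def)
qed (simp add: between_def)

lemma idx_between:
  assumes "lat K" "lat H" "K \<subseteq> H" "idx K H = p ^ n" "T \<in> between K H i"
  shows "idx T H = p ^ (n - i)"
proof -
  have T: "lat T" "K \<subseteq> T" "T \<subseteq> H" "idx K T = p ^ i" using assms(5) by (auto simp: between_def)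
  obtain k where k: "k \<le> n" "idx K T = p ^ k" "idx T H = p ^ (n - k)"
    using idx_dvd_power[OF assms(1) T(1) assms(2) T(2,3) assms(4)] by blast
  then have "k = i" using T(4) p_gt_1 by simp
  then show ?thesis using k by simp
qed

text \<open>Double counting of a line inside a hyperplane: by induction a line lies in as many
  hyperplanes as a hyperplane contains lines, so lines and hyperplanes are equinumerous.\<close>

lemma card_hyperplanes:
  assumes "lat K" "lat H" "K \<subseteq> H" "idx K H = p ^ Suc m"
  shows "card (between K H m) = qnum (Suc m)"
  using assms
proof (induction m arbitrary: K)
  case 0
  then show ?case by (simp add: between_0 qnum_def)
next
  case (Suc m)
  have "card (between K H 1) * qnum (Suc m) = card (between K H (Suc m)) * qnum (Suc m)"
  proof (rule flag_count[where R = "(\<subseteq>)"])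
    fix T assume T: "T \<in> between K H 1"
    have "{Y \<in> between K H (Suc m). T \<subseteq> Y} = between T H m"
      using between_above[OF Suc.prems(1,2) T, of m] by simp
    moreover have "idx T H = p ^ Suc m" using idx_between[OF Suc.prems T] by simp
    moreover have "lat T" "T \<subseteq> H" using T by (auto simp: between_def)
    ultimately show "card {Y \<in> between K H (Suc m). T \<subseteq> Y} = qnum (Suc m)"
      using Suc.IH[OF _ Suc.prems(2)] by simp
  next
    fix Y assume Y: "Y \<in> between K H (Suc m)"
    then have "lat Y" "K \<subseteq> Y" "idx K Y = p ^ Suc m" by (auto simp: between_def)
    then show "card {T \<in> between K H 1. T \<subseteq> Y} = qnum (Suc m)"
      unfolding between_below[OF Y] using card_lines[OF Suc.prems(1)] by blast
  qed simp_all
  moreover have "card (between K H 1) = qnum (Suc (Suc m))" using card_lines[OF Suc.prems] .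
  ultimately show ?case using qnum_pos[of m] by simp
qed

definition qfact :: "nat \<Rightarrow> nat" where "qfact m = (\<Prod>i<m. qnum (Suc i))"

lemma qfact_pos: "qfact m > 0" by (simp add: qfact_def qnum_pos)

text \<open>Double counting of inclusions between dimensions k and k + 1 yields the recursion of the
  Gaussian binomials; the multiplied form avoids division.\<close>

lemma card_between_mult:
  assumes "lat K" "lat H" "K \<subseteq> H" "idx K H = p ^ n" "k \<le> n"
  shows "card (between K H k) * (qfact k * qfact (n - k)) = qfact n"
  using assms(5)
proof (induction k)
  case 0
  then show ?case using between_0[OF assms(1-3)] by (simp add: qfact_def)
next
  case (Suc k)
  have nk: "n - k = Suc (n - Suc k)" using Suc.prems by simp
  have "card (between K H k) * qnum (n - k) = card (between K H (Suc k)) * qnum (Suc k)"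
  proof (rule flag_count[where R = "(\<subseteq>)"])
    fix T assume T: "T \<in> between K H k"
    have "{Y \<in> between K H (Suc k). T \<subseteq> Y} = between T H 1"
      using between_above[OF assms(1,2) T, of 1] by simp
    moreover have "lat T" "T \<subseteq> H" using T by (auto simp: between_def)
    ultimately show "card {Y \<in> between K H (Suc k). T \<subseteq> Y} = qnum (n - k)"
      using card_lines[OF _ assms(2) _ idx_between[OF assms(1-4) T]] by simp
  next
    fix Y assume Y: "Y \<in> between K H (Suc k)"
    then have "lat Y" "K \<subseteq> Y" "idx K Y = p ^ Suc k" by (auto simp: between_def)
    then show "card {T \<in> between K H k. T \<subseteq> Y} = qnum (Suc k)"
      unfolding between_below[OF Y] using card_hyperplanes[OF assms(1)] by blast
  qed simp_all
  then have "card (between K H (Suc k)) * (qfact (Suc k) * qfact (n - Suc k))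
     = card (between K H k) * (qfact k * (qnum (n - k) * qfact (n - Suc k)))"
    by (simp add: qfact_def mult_ac)
  also have "qnum (n - k) * qfact (n - Suc k) = qfact (n - k)"
    unfolding nk by (simp add: qfact_def)
  finally show ?case using Suc by simp
qed

text \<open>For k <= n the division of natural numbers is exact whenever an index p^n occurs, by
  \<open>card_between_mult\<close>.\<close>

definition qbinomial :: "nat \<Rightarrow> nat \<Rightarrow> nat" where
  "qbinomial n k = qfact n div (qfact k * qfact (n - k))"

lemma card_between:
  assumes "lat K" "lat H" "K \<subseteq> H" "idx K H = p ^ n" "k \<le> n"
  shows "card (between K H k) = qbinomial n k"
  unfolding qbinomial_def card_between_mult[OF assms, symmetric] using qfact_pos by simp

lemma qbinomial_symmetric: "k \<le> n \<Longrightarrow> qbinomial n (n - k) = qbinomial n k"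
  by (simp add: qbinomial_def mult.commute)

lemma qbinomial_3: "qbinomial 3 1 = 1 + p + p^2" "qbinomial 3 2 = 1 + p + p^2"
proof -
  have q: "qfact 3 = (1 + p + p^2) * (1 + p)" "qfact 2 = 1 + p" "qfact 1 = 1"
    by (simp_all add: qfact_def qnum_def numeral_3_eq_3 numeral_2_eq_2)
  have "qbinomial 3 1 = qfact 3 div (qfact 1 * qfact 2)" "qbinomial 3 2 = qfact 3 div (qfact 2 * qfact 1)"
    by (simp_all add: qbinomial_def)
  moreover have "(1 + p + p^2) * (1 + p) div (1 + p) = 1 + p + p^2" by (rule nonzero_mult_div_cancel_right) simp
  ultimately show "qbinomial 3 1 = 1 + p + p^2" "qbinomial 3 2 = 1 + p + p^2"
    unfolding q by (simp_all only: mult_1 mult_1_right)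
qed

text \<open>Splitting off one generator \<open>c\<close> of \<open>U\<close> modulo \<open>Z\<close>: the subgroup \<open>I\<close> contains \<open>c + z\<close> for
  exactly one coset of elements \<open>z\<close> modulo \<open>J\<close>.\<close>

lemma card_extensions:
  assumes "lat J" "lat Z" "lat U" "J \<subseteq> Z" "Z \<subseteq> U" "idx Z U = p ^ u"
  shows "card {I. lat I \<and> I \<inter> Z = J \<and> ssum I Z = U} = idx J Z ^ u"
  using assms
proof (induction u arbitrary: J Z)
  case 0
  then have UZ: "U = Z" using idx_1_imp_subset[of Z U] by auto
  have "{I. lat I \<and> I \<inter> Z = J \<and> ssum I Z = U} = {J}"
  proof (intro equalityI subsetI)
    fix I assume "I \<in> {I. lat I \<and> I \<inter> Z = J \<and> ssum I Z = U}"
    then have "lat I" "I \<inter> Z = J" "ssum I Z = Z" by (auto simp: UZ)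
    then have "I \<subseteq> Z" using ssum_upper(1)[OF 0(2), of I] by simp
    then show "I \<in> {J}" using \<open>I \<inter> Z = J\<close> by auto
  next
    fix I assume "I \<in> {J}"
    moreover have "ssum J Z = Z" using ssum_least[OF 0(2) 0(4)] ssum_upper(2)[OF 0(1)] by blast
    ultimately show "I \<in> {I. lat I \<and> I \<inter> Z = J \<and> ssum I Z = U}" using 0 UZ by auto
  qed
  then show ?case by simp
next
  case (Suc u)
  note J = Suc.prems(1) and Z = Suc.prems(2) and U = Suc.prems(3)
  have "\<not> U \<subseteq> Z"
  proof
    assume "U \<subseteq> Z"
    then have "idx Z U = 1" using idx_self[OF Z] Suc.prems(5) by (metis subset_antisym)
    then show False using Suc.prems(6) p_gt_1 by simp
  qed
  then obtain c where c: "c \<in> U" "c \<notin> Z" by blast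
  let ?E = "{I. lat I \<and> I \<inter> Z = J \<and> ssum I Z = U}"
  let ?Ez = "\<lambda>z. {I \<in> ?E. c + z \<in> I}"
  let ?Z1 = "adjoin Z c" and ?J1 = "\<lambda>z. adjoin J (c + z)"
  have Z1: "lat ?Z1" "Z \<subseteq> ?Z1" "?Z1 \<subseteq> U"
    using lat_adjoin[OF Z] adjoin_upper adjoin_least[OF U Suc.prems(5) c(1)] by auto
  have idxZ1: "idx ?Z1 U = p ^ u"
    using idx_mult[OF Z Z1(1) U Z1(2,3)] idx_adjoin[OF Z c(2)] Suc.prems(6) p_gt_1 by simp
  have step: "card (?Ez z) = idx J Z ^ u" if z: "z \<in> Z" for z
  proof -
    have J1: "lat (?J1 z)" "J \<subseteq> ?J1 z" "c + z \<in> ?J1 z"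
      using lat_adjoin[OF J] adjoin_upper adjoin_mem[OF J] by auto
    have cz: "c + z \<notin> Z" using c(2) lat_cong_iff[OF Z, of "c + z" c] z by simp
    have cZ1: "c + z \<in> ?Z1" using lat_add[OF Z1(1) adjoin_mem[OF Z]] Z1(2) z by blast
    have J1Z1: "?J1 z \<subseteq> ?Z1" using adjoin_least[OF Z1(1) _ cZ1] Suc.prems(4) Z1(2) by blast
    have J1Z: "?J1 z \<inter> Z = J"
    proof (intro equalityI subsetI)
      fix x assume "x \<in> ?J1 z \<inter> Z"
      then obtain j n where x: "j \<in> J" "x = j + zmul n (c + z)" "x \<in> Z" by (auto simp: adjoin_def)
      then have "zmul n (c + z) \<in> Z" using lat_add_cancel[OF Z, of j] Suc.prems(4) by auto
      then have "int p dvd n" using scale_mem_iff[OF Z cz] by blast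
      then have "zmul n (c + z) \<in> J" by (rule lat_scale_dvd[OF J])
      then show "x \<in> J" using x(1,2) lat_add[OF J] by simp
    qed (use J1(2) Suc.prems(4) in blast)
    have sumZ1: "ssum (?J1 z) Z = ?Z1"
    proof
      show "ssum (?J1 z) Z \<subseteq> ?Z1" by (rule ssum_least[OF Z1(1) J1Z1 Z1(2)])
      have "(c + z) + (- z) \<in> ssum (?J1 z) Z" using J1(3) lat_uminus[OF Z z] by (rule ssumI)
      then have "c \<in> ssum (?J1 z) Z" by simp
      then show "?Z1 \<subseteq> ssum (?J1 z) Z"
        by (intro adjoin_least lat_ssum ssum_upper J1(1) Z)
    qed
    \<comment> \<open>Once c + z is known to lie in I, the problem is the same one with c adjoined
      to Z and c + z adjoined to J. The quotient U/Z has lost one dimension, and the index of J in Z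
      is unchanged.\<close>
    have "?Ez z = {I. lat I \<and> I \<inter> ?Z1 = ?J1 z \<and> ssum I ?Z1 = U}"
    proof (intro equalityI subsetI)
      fix I assume "I \<in> ?Ez z"
      then have I: "lat I" "I \<inter> Z = J" "ssum I Z = U" "c + z \<in> I" by auto
      have "I \<inter> ?Z1 = ?J1 z"
      proof (intro equalityI subsetI)
        fix x assume x: "x \<in> I \<inter> ?Z1"
        then obtain z' n where x': "z' \<in> Z" "x = z' + zmul n c" by (auto simp: adjoin_def)
        have "x - zmul n (c + z) \<in> I" using x I(1,4) by (intro lat_diff lat_scale) auto
        moreover have "x - zmul n (c + z) = z' - zmul n z" using x'(2) by (simp add: scale_right_distrib)
        moreover have "z' - zmul n z \<in> Z" using x'(1) z Z by (intro lat_diff lat_scale)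
        ultimately have "x - zmul n (c + z) \<in> J" using I(2) by auto
        then have "(x - zmul n (c + z)) + zmul n (c + z) \<in> ?J1 z" by (rule adjoinI)
        then show "x \<in> ?J1 z" by simp
      qed (use adjoin_least[OF I(1) _ I(4)] I(2) J1Z1 in blast)
      moreover have "ssum I ?Z1 = U"
      proof
        have "I \<subseteq> U" using I(3) ssum_upper(1)[OF Z, of I] by simp
        then show "ssum I ?Z1 \<subseteq> U" using ssum_least[OF U] Z1(3) by blast
        show "U \<subseteq> ssum I ?Z1" unfolding I(3)[symmetric] using Z1(2) by (auto simp: ssum_def)
      qed
      ultimately show "I \<in> {I. lat I \<and> I \<inter> ?Z1 = ?J1 z \<and> ssum I ?Z1 = U}" using I(1) by simp
    next
      fix I assume "I \<in> {I. lat I \<and> I \<inter> ?Z1 = ?J1 z \<and> ssum I ?Z1 = U}"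
      then have I: "lat I" "I \<inter> ?Z1 = ?J1 z" "ssum I ?Z1 = U" by auto
      have cI: "c + z \<in> I" using J1(3) I(2) by blast
      have "I \<inter> Z = J" using I(2) J1Z Z1(2) by blast
      moreover have "ssum I Z = U"
      proof
        have "I \<subseteq> U" using I(3) ssum_upper(1)[OF Z1(1), of I] by simp
        then show "ssum I Z \<subseteq> U" using ssum_least[OF U] Suc.prems(5) by blast
        have "?Z1 \<subseteq> ssum I Z" unfolding sumZ1[symmetric] using I(2) by (auto simp: ssum_def)
        then show "U \<subseteq> ssum I Z"
          unfolding I(3)[symmetric] by (intro ssum_least lat_ssum I(1) Z ssum_upper)
      qed
      ultimately show "I \<in> ?Ez z" using I(1) cI by simp
    qed
    also have "card \<dots> = idx (?J1 z) ?Z1 ^ u"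
      by (rule Suc.IH[OF J1(1) Z1(1) U J1Z1 Z1(3) idxZ1])
    also have "idx (?J1 z) ?Z1 = idx J Z"
    proof -
      have "idx (?J1 z) (ssum Z (?J1 z)) = idx (Z \<inter> ?J1 z) Z" by (rule idx_ssum[OF Z J1(1)])
      moreover have "ssum Z (?J1 z) = ?Z1" unfolding sumZ1[symmetric] by (auto simp: ssum_def) (metis add.commute)+
      moreover have "Z \<inter> ?J1 z = J" using J1Z by blast
      ultimately show ?thesis by (simp only:)
    qed
    finally show ?thesis .
  qed
  define r where "r C = (SOME z. z \<in> Z \<and> C = coset J z)" for C
  have r: "r C \<in> Z \<and> C = coset J (r C)" if "C \<in> coset J ` Z" for C
    unfolding r_def by (rule someI_ex) (use that in blast)
  have "?E = (\<Union>C\<in>coset J ` Z. ?Ez (r C))" (is "_ = ?UN")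
  proof (intro equalityI subsetI)
    fix I assume I: "I \<in> ?E"
    then obtain i z where iz: "i \<in> I" "z \<in> Z" "c = i + z" using c(1) by (auto elim: ssumE)
    let ?C = "coset J (- z)"
    have C: "?C \<in> coset J ` Z" using lat_uminus[OF Z iz(2)] by blast
    have "- z - r ?C \<in> J" using r[OF C] coset_eq_iff[OF J] by blast
    then have "i - (- z - r ?C) \<in> I" using I iz(1) by (auto intro!: lat_diff)
    then have "c + r ?C \<in> I" using iz(3) by (simp add: algebra_simps)
    then show "I \<in> (\<Union>C\<in>coset J ` Z. ?Ez (r C))" using I C by blast
  qed auto
  then have "card ?E = card ?UN" by (rule arg_cong)
  also have "card ?UN = (\<Sum>C\<in>coset J ` Z. card (?Ez (r C)))"
  proof (rule card_UN_disjoint)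
    show "finite (coset J ` Z)" by (rule finite_cosets[OF J])
    have "finite ?E" by (rule finite_lats)
    then have "finite (?Ez z)" for z by (rule finite_subset[rotated]) blast
    then show "\<forall>C\<in>coset J ` Z. finite (?Ez (r C))" by blast
    show "\<forall>C\<in>coset J ` Z. \<forall>D\<in>coset J ` Z. C \<noteq> D \<longrightarrow> ?Ez (r C) \<inter> ?Ez (r D) = {}"
    proof (intro ballI impI)
      fix C D assume CD: "C \<in> coset J ` Z" "D \<in> coset J ` Z" "C \<noteq> D"
      show "?Ez (r C) \<inter> ?Ez (r D) = {}"
      proof (rule ccontr)
        assume "?Ez (r C) \<inter> ?Ez (r D) \<noteq> {}"
        then obtain I where I: "lat I" "I \<inter> Z = J" "c + r C \<in> I" "c + r D \<in> I" by auto
        have "(c + r C) - (c + r D) \<in> I" using I by (intro lat_diff)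
        moreover have "r C - r D \<in> Z" using r[OF CD(1)] r[OF CD(2)] Z by (intro lat_diff) auto
        ultimately have "r C - r D \<in> J" using I(2) by auto
        then have "coset J (r C) = coset J (r D)" by (simp add: coset_eq_iff[OF J])
        then show False using r[OF CD(1)] r[OF CD(2)] CD(3) by simp
      qed
    qed
  qed
  also have "\<dots> = (\<Sum>C\<in>coset J ` Z. idx J Z ^ u)"
  proof (rule sum.cong[OF refl])
    fix C assume "C \<in> coset J ` Z"
    from step[OF conjunct1[OF r[OF this]]] show "card (?Ez (r C)) = idx J Z ^ u" .
  qed
  also have "\<dots> = idx J Z ^ Suc u" by (simp only: sum_constant power_Suc idx_def of_nat_id)
  finally show ?case .
qed

end

section \<open>Ideals of the Lie ring modulo p\<close>

text \<open>Everything the count uses about the Lie ring: coordinates, elements \<open>mk\<close>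
  with prescribed coordinates, and the bracket in coordinates. \<open>PL_iff\<close> makes the
  coordinates modulo p determine a coset of \<open>PL\<close>.\<close>

locale np8_mod = finite_mod_p_lattices zmul p
  for zmul :: "int \<Rightarrow> 'a::ab_group_add \<Rightarrow> 'a" and p :: nat +
  fixes cx cy :: "nat \<Rightarrow> 'a \<Rightarrow> int" and br :: "'a \<Rightarrow> 'a \<Rightarrow> 'a"
    and mk :: "int \<Rightarrow> int \<Rightarrow> int \<Rightarrow> int \<Rightarrow> int \<Rightarrow> int \<Rightarrow> int \<Rightarrow> int \<Rightarrow> 'a"
  assumes cx_add [simp]: "cx i (u + v) = cx i u + cx i v" and cy_add [simp]: "cy i (u + v) = cy i u + cy i v"
    and cx_scale [simp]: "cx i (zmul n u) = n * cx i u" and cy_scale [simp]: "cy i (zmul n u) = n * cy i u"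
    and cx_mk [simp]: "cx 1 (mk a1 a2 a3 a4 a5 b1 b2 b3) = a1" "cx 2 (mk a1 a2 a3 a4 a5 b1 b2 b3) = a2"
      "cx 3 (mk a1 a2 a3 a4 a5 b1 b2 b3) = a3" "cx 4 (mk a1 a2 a3 a4 a5 b1 b2 b3) = a4"
      "cx 5 (mk a1 a2 a3 a4 a5 b1 b2 b3) = a5"
    and cy_mk [simp]: "cy 1 (mk a1 a2 a3 a4 a5 b1 b2 b3) = b1" "cy 2 (mk a1 a2 a3 a4 a5 b1 b2 b3) = b2"
      "cy 3 (mk a1 a2 a3 a4 a5 b1 b2 b3) = b3"
    and PL_iff: "u \<in> PL \<longleftrightarrow> int p dvd cx 1 u \<and> int p dvd cx 2 u \<and> int p dvd cx 3 u \<and> int p dvd cx 4 u \<and> int p dvd cx 5 u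
      \<and> int p dvd cy 1 u \<and> int p dvd cy 2 u \<and> int p dvd cy 3 u"
    and cx_br [simp]: "cx i (br u v) = 0"
    and cy1_br: "cy 1 (br u v) = cx 1 u * cx 4 v - cx 4 u * cx 1 v + cx 2 u * cx 5 v - cx 5 u * cx 2 v"
    and cy2_br: "cy 2 (br u v) = cx 1 u * cx 5 v - cx 5 u * cx 1 v + 2 * (cx 3 u * cx 4 v - cx 4 u * cx 3 v)"
    and cy3_br: "cy 3 (br u v) = cx 2 u * cx 4 v - cx 4 u * cx 2 v + cx 3 u * cx 5 v - cx 5 u * cx 3 v"
begin

lemmas cy_br = cy1_br cy2_br cy3_br

declare One_nat_def [simp del]

lemma cx_uminus [simp]: "cx i (- u) = - cx i u" using cx_scale[of i "-1" u] by simp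
lemma cy_uminus [simp]: "cy i (- u) = - cy i u" using cy_scale[of i "-1" u] by simp
lemma cx_diff [simp]: "cx i (u - v) = cx i u - cx i v" using cx_add[of i u "- v"] by simp
lemma cy_diff [simp]: "cy i (u - v) = cy i u - cy i v" using cy_add[of i u "- v"] by simp

text \<open>The preimage in L of the span of the y_i in L/pL.\<close>

definition Zt :: "'a set" where
  "Zt = {u. int p dvd cx 1 u \<and> int p dvd cx 2 u \<and> int p dvd cx 3 u \<and> int p dvd cx 4 u \<and> int p dvd cx 5 u}"

lemma lat_Zt: "lat Zt" by (auto simp: lat_def Zt_def)

lemma PL_Zt: "PL \<subseteq> Zt" by (auto simp: PL_iff Zt_def)

lemma br_Zt: "br u v \<in> Zt" by (simp add: Zt_def)

lemma PL_iff_Zt: "u \<in> Zt \<Longrightarrow> u \<in> PL \<longleftrightarrow> int p dvd cy 1 u \<and> int p dvd cy 2 u \<and> int p dvd cy 3 u"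
  by (auto simp: PL_iff Zt_def)

lemma mod_eq_iff: "a mod int p = b mod int p \<longleftrightarrow> int p dvd a - b"
  by (metis mod_eq_dvd_iff)

lemma p_pos: "int p > 0" using p_gt_1 by simp

lemma idx_PL_Zt: "idx PL Zt = p ^ 3"
proof -
  let ?f = "\<lambda>u. (cy 1 u mod int p, cy 2 u mod int p, cy 3 u mod int p)"
  have "idx PL Zt = card (?f ` Zt)"
  proof (rule idx_eq_card[OF lat_PL])
    fix u v assume "u \<in> Zt" "v \<in> Zt"
    then have "u - v \<in> Zt" by (rule lat_diff[OF lat_Zt])
    then show "?f u = ?f v \<longleftrightarrow> u - v \<in> PL" by (simp add: PL_iff_Zt mod_eq_iff)
  qed
  also have "?f ` Zt = {0..<int p} \<times> {0..<int p} \<times> {0..<int p}"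
  proof (intro equalityI subsetI)
    fix x assume "x \<in> {0..<int p} \<times> {0..<int p} \<times> {0..<int p}"
    then obtain a b c where x: "x = (a, b, c)" "a \<in> {0..<int p}" "b \<in> {0..<int p}" "c \<in> {0..<int p}" by auto
    have "mk 0 0 0 0 0 a b c \<in> Zt" by (simp add: Zt_def)
    moreover have "x = ?f (mk 0 0 0 0 0 a b c)" using x by simp
    ultimately show "x \<in> ?f ` Zt" by (rule image_eqI[rotated])
  qed (use p_pos in auto)
  finally show ?thesis by (simp add: card_cartesian_product power3_eq_cube)
qed

lemma idx_Zt_UNIV: "idx Zt UNIV = p ^ 5"
proof -
  let ?f = "\<lambda>u. (cx 1 u mod int p, cx 2 u mod int p, cx 3 u mod int p, cx 4 u mod int p, cx 5 u mod int p)"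
  let ?R = "{0..<int p}"
  have "idx Zt UNIV = card (?f ` UNIV)"
    by (rule idx_eq_card[OF lat_Zt]) (simp add: Zt_def mod_eq_iff)
  also have "?f ` UNIV = ?R \<times> ?R \<times> ?R \<times> ?R \<times> ?R"
  proof (intro equalityI subsetI)
    fix x assume "x \<in> ?R \<times> ?R \<times> ?R \<times> ?R \<times> ?R"
    then obtain a b c d e where x: "x = (a, b, c, d, e)" "a \<in> ?R" "b \<in> ?R" "c \<in> ?R" "d \<in> ?R" "e \<in> ?R" by auto
    then have "x = ?f (mk a b c d e 0 0 0)" by simp
    then show "x \<in> ?f ` UNIV" by (rule range_eqI)
  qed (use p_pos in auto)
  finally show ?thesis by (simp add: card_cartesian_product numeral_eq_Suc)
qed

definition comm_in :: "'a set \<Rightarrow> 'a set \<Rightarrow> bool" where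
  "comm_in U J \<longleftrightarrow> (\<forall>u\<in>U. \<forall>v. br u v \<in> J)"

text \<open>The largest \<open>U\<close> with [U, L] inside \<open>J\<close>; for a plane
  \<open>J\<close> it is the radical of the alternating form induced by the bracket.\<close>

definition Rad :: "'a set \<Rightarrow> 'a set" where "Rad J = {u. \<forall>v. br u v \<in> J}"

lemma comm_in_iff: "comm_in U J \<longleftrightarrow> U \<subseteq> Rad J" by (auto simp: comm_in_def Rad_def)

text \<open>The bracket is known only through its coordinates, so additivity is obtained up to
  \<open>PL\<close>; this suffices for subgroups that contain \<open>PL\<close>.\<close>

lemma br_additive_PL: "br (u + u') v - (br u v + br u' v) \<in> PL" "br (- u) v + br u v \<in> PL"
  by (auto simp: PL_iff cy_br algebra_simps)

lemma br_Zt_PL: "u \<in> Zt \<Longrightarrow> br u v \<in> PL"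
  by (simp add: PL_iff Zt_def cy_br dvd_add dvd_diff)

lemma lat_Rad: assumes J: "lat J" shows "lat (Rad J)"
  unfolding lat_def Rad_def mem_Collect_eq
proof (intro conjI ballI allI)
  fix u v w assume u: "u \<in> {u. \<forall>v. br u v \<in> J}" and v: "v \<in> {u. \<forall>v. br u v \<in> J}"
  have "br u w + br v w \<in> J" using lat_add[OF J] u v by simp
  moreover have "br (u + v) w - (br u w + br v w) \<in> J" using br_additive_PL(1) PL_least[OF J] by blast
  ultimately show "br (u + v) w \<in> J" using lat_cong_iff[OF J] by blast
next
  fix u w assume u: "u \<in> {u. \<forall>v. br u v \<in> J}"
  then have "- br u w \<in> J" using lat_uminus[OF J] by simp
  moreover have "br (- u) w - (- br u w) \<in> J" using br_additive_PL(2)[of u w] PL_least[OF J] by auto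
  ultimately show "br (- u) w \<in> J" using lat_cong_iff[OF J] by blast
next
  fix u w
  have "zmul (int p) u \<in> Zt" using lat_p[OF lat_Zt] .
  then show "br (zmul (int p) u) w \<in> J" using br_Zt_PL PL_least[OF J] by blast
qed

lemma Zt_Rad: "lat J \<Longrightarrow> Zt \<subseteq> Rad J"
  using br_Zt_PL PL_least by (auto simp: Rad_def)

definition ideals :: "nat \<Rightarrow> 'a set set" where
  "ideals d = {I. lat I \<and> comm_in I I \<and> idx PL I = p ^ d}"

definition pairs :: "nat \<Rightarrow> nat \<Rightarrow> ('a set \<times> 'a set) set" where
  "pairs u j = {(J, U). J \<in> between PL Zt j \<and> U \<in> between Zt UNIV u \<and> comm_in U J}"

lemma pairs_Sigma: "pairs u j = (SIGMA J:between PL Zt j. between Zt (Rad J) u)"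
  by (auto simp: pairs_def comm_in_iff between_def)

lemma card_pairs: "card (pairs u j) = (\<Sum>J\<in>between PL Zt j. card (between Zt (Rad J) u))"
  unfolding pairs_Sigma by (rule card_SigmaI) simp_all

lemma finite_pairs [simp]: "finite (pairs u j)"
  unfolding pairs_Sigma by (intro finite_SigmaI) simp_all

definition extensions :: "'a set \<times> 'a set \<Rightarrow> 'a set set" where
  "extensions = (\<lambda>(J, U). {I. lat I \<and> I \<inter> Zt = J \<and> ssum I Zt = U})"

text \<open>All brackets lie in \<open>Zt\<close>, so [I, L] inside I is the same as [I, L] inside
  J. Passing from I to I + \<open>Zt\<close> preserves this, because brackets with elements of
  \<open>Zt\<close> fall into \<open>PL\<close>.\<close>

lemma ideals_decomposition:
  "ideals d = (\<Union>j\<in>{..min 3 d}. \<Union>P\<in>pairs (d - j) j. extensions P)"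
proof (intro equalityI subsetI)
  fix I assume "I \<in> ideals d"
  then have I: "lat I" "comm_in I I" "idx PL I = p ^ d" by (auto simp: ideals_def)
  let ?J = "I \<inter> Zt" and ?U = "ssum I Zt"
  have J: "lat ?J" "PL \<subseteq> ?J" using lat_Int[OF I(1) lat_Zt] PL_least by auto
  have U: "lat ?U" "Zt \<subseteq> ?U" using lat_ssum[OF I(1) lat_Zt] ssum_upper(2)[OF I(1)] by auto
  obtain j where j: "j \<le> 3" "idx PL ?J = p ^ j"
    using idx_dvd_power[OF lat_PL J(1) lat_Zt J(2) _ idx_PL_Zt] by blast
  obtain k where k: "k \<le> d" "idx PL ?J = p ^ k" "idx ?J I = p ^ (d - k)"
    using idx_dvd_power[OF lat_PL J(1) I(1) J(2) _ I(3)] by blast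
  have "k = j" using k(2) j(2) p_gt_1 by simp
  have "idx Zt ?U = p ^ (d - j)" using idx_ssum[OF I(1) lat_Zt] k(3) \<open>k = j\<close> by simp
  moreover have "comm_in ?U ?J"
  proof -
    have "I \<subseteq> Rad ?J" using I(2) br_Zt by (auto simp: comm_in_def Rad_def)
    then show ?thesis unfolding comm_in_iff
      by (intro ssum_least lat_Rad J(1) Zt_Rad)
  qed
  ultimately have "(?J, ?U) \<in> pairs (d - j) j" using J U j by (auto simp: pairs_def between_def)
  moreover have "I \<in> extensions (?J, ?U)" using I(1) by (simp add: extensions_def)
  moreover have "j \<in> {..min 3 d}" using j(1) k(1) \<open>k = j\<close> by simp
  ultimately show "I \<in> (\<Union>j\<in>{..min 3 d}. \<Union>P\<in>pairs (d - j) j. extensions P)" by blast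
next
  fix I assume "I \<in> (\<Union>j\<in>{..min 3 d}. \<Union>P\<in>pairs (d - j) j. extensions P)"
  then obtain j J U where j: "j \<le> 3" "j \<le> d" and P: "(J, U) \<in> pairs (d - j) j" and "I \<in> extensions (J, U)" by auto
  then have I: "lat I" "I \<inter> Zt = J" "ssum I Zt = U" by (auto simp: extensions_def)
  have JU: "lat J" "PL \<subseteq> J" "idx PL J = p ^ j" "idx Zt U = p ^ (d - j)" "U \<subseteq> Rad J"
    using P by (auto simp: pairs_def between_def comm_in_iff)
  have "idx J I = p ^ (d - j)" using idx_ssum[OF I(1) lat_Zt] I JU(4) by simp
  moreover have "J \<subseteq> I" using I(2) by blast
  ultimately have "idx PL I = p ^ j * p ^ (d - j)" using idx_mult[OF lat_PL JU(1) I(1) JU(2)] JU(3) by simp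
  then have "idx PL I = p ^ d" using j by (simp add: power_add[symmetric])
  moreover have "I \<subseteq> Rad J" using JU(5) I(3) ssum_upper(1)[OF lat_Zt] by blast
  then have "comm_in I I" using \<open>J \<subseteq> I\<close> by (auto simp: comm_in_def Rad_def)
  ultimately show "I \<in> ideals d" using I(1) by (simp add: ideals_def)
qed

lemma card_ideals: "card (ideals d) = (\<Sum>j\<le>min 3 d. card (pairs (d - j) j) * p ^ ((3 - j) * (d - j)))"
proof -
  have fin: "finite (extensions P)" for P
    by (cases P) (auto simp: extensions_def intro: finite_lats)
  have key: "P = (I \<inter> Zt, ssum I Zt)" if "I \<in> extensions P" for P I
    using that by (cases P) (auto simp: extensions_def)
  have ext: "card (extensions P) = p ^ ((3 - j) * u)" if P: "P \<in> pairs u j" for P u j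
  proof -
    obtain J U where JU: "P = (J, U)" by (cases P)
    have *: "lat J" "PL \<subseteq> J" "J \<subseteq> Zt" "idx PL J = p ^ j" "lat U" "Zt \<subseteq> U" "idx Zt U = p ^ u"
      using P unfolding JU by (auto simp: pairs_def between_def)
    have "J \<in> between PL Zt j" using * by (simp add: between_def)
    then have "idx J Zt = p ^ (3 - j)" using idx_between[OF lat_PL lat_Zt PL_Zt idx_PL_Zt] by simp
    then show ?thesis using card_extensions[OF *(1) lat_Zt *(5,3,6,7)]
      by (simp add: JU extensions_def power_mult)
  qed
  have "card (ideals d) = (\<Sum>j\<le>min 3 d. card (\<Union>P\<in>pairs (d - j) j. extensions P))"
    unfolding ideals_decomposition
  proof (rule card_UN_disjoint)
    show "\<forall>i\<in>{..min 3 d}. \<forall>j\<in>{..min 3 d}. i \<noteq> j \<longrightarrow>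
      (\<Union>P\<in>pairs (d - i) i. extensions P) \<inter> (\<Union>P\<in>pairs (d - j) j. extensions P) = {}"
    proof (intro ballI impI)
      fix i j :: nat assume "i \<noteq> j"
      show "(\<Union>P\<in>pairs (d - i) i. extensions P) \<inter> (\<Union>P\<in>pairs (d - j) j. extensions P) = {}"
      proof (rule ccontr)
        assume "\<not> ?thesis"
        then obtain I P Q where "P \<in> pairs (d - i) i" "Q \<in> pairs (d - j) j" "I \<in> extensions P" "I \<in> extensions Q" by blast
        moreover from this have "P = Q" using key by metis
        ultimately have "p ^ i = p ^ j" by (auto simp: pairs_def between_def)
        then show False using \<open>i \<noteq> j\<close> p_gt_1 by simp
      qed
    qed
  qed (auto intro: fin)
  also have "\<dots> = (\<Sum>j\<le>min 3 d. card (pairs (d - j) j) * p ^ ((3 - j) * (d - j)))"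
  proof (rule sum.cong[OF refl])
    fix j
    have "card (\<Union>P\<in>pairs (d - j) j. extensions P) = (\<Sum>P\<in>pairs (d - j) j. card (extensions P))"
    proof (rule card_UN_disjoint)
      show "\<forall>P\<in>pairs (d - j) j. \<forall>Q\<in>pairs (d - j) j. P \<noteq> Q \<longrightarrow> extensions P \<inter> extensions Q = {}"
        using key by (metis disjoint_iff)
    qed (auto intro: fin)
    also have "\<dots> = (\<Sum>P\<in>pairs (d - j) j. p ^ ((3 - j) * (d - j)))" by (intro sum.cong refl ext)
    finally show "card (\<Union>P\<in>pairs (d - j) j. extensions P) = card (pairs (d - j) j) * p ^ ((3 - j) * (d - j))" by simp
  qed
  finally show ?thesis .
qed

end

section \<open>Radicals modulo planes\<close>

lemma dvd_combination2: fixes m :: int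
  assumes "m dvd x" "m dvd y" "e = k * x + l * y" shows "m dvd e"
  using assms by simp

lemma dvd_combination3: fixes m :: int
  assumes "m dvd x" "m dvd y" "m dvd z" "e = k * x + l * y + n * z" shows "m dvd e"
  using assms by simp

lemma dvd_diff_imp_iff: fixes m :: int
  assumes "m dvd a - b" shows "m dvd a \<longleftrightarrow> m dvd b"
proof
  assume "m dvd a" then show "m dvd b" by (rule dvd_combination2[OF assms, where k = "- 1" and l = 1]) simp
next
  assume "m dvd b" then show "m dvd a" by (rule dvd_combination2[OF assms, where k = 1 and l = 1]) simp
qed

context np8_mod begin

abbreviation roots :: "int set" where "roots \<equiv> {r \<in> {0..<int p}. [r ^ 3 = 2] (mod int p)}"

lemma prime_int_p: "prime (int p)" using prime_p by simp

lemma unit_inverse: assumes "\<not> int p dvd a" obtains m where "int p dvd m * a - 1"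
proof -
  have "coprime a (int p)" using prime_imp_coprime[OF prime_int_p assms] by (simp add: coprime_commute)
  then obtain m where "[a * m = 1] (mod int p)" using cong_solve_coprime_int by blast
  then show thesis using that[of m] by (simp add: cong_iff_dvd_diff mult.commute)
qed

lemma unit_cancel: "\<not> int p dvd a \<Longrightarrow> int p dvd a * b \<Longrightarrow> int p dvd b"
  using prime_int_p by (simp add: prime_dvd_mult_iff)

lemma dvd_square_cancel: "int p dvd a * a \<Longrightarrow> int p dvd a"
  using prime_int_p by (simp add: prime_dvd_mult_iff)

lemma roots_eqI: assumes "r \<in> roots" "s \<in> roots" "int p dvd r - s" shows "r = s"
proof -
  have "r mod int p = s mod int p" using assms(3) by (simp add: mod_eq_iff)
  then show ?thesis using assms(1,2) by simp
qed

lemma root_dvd: "r \<in> roots \<Longrightarrow> int p dvd r ^ 3 - 2" by (simp add: cong_iff_dvd_diff)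

definition plane :: "int \<Rightarrow> int \<Rightarrow> int \<Rightarrow> 'a set" where
  "plane a b c = {u \<in> Zt. int p dvd a * cy 1 u + b * cy 2 u + c * cy 3 u}"

lemma lat_plane: "lat (plane a b c)"
  unfolding lat_def
proof (intro conjI ballI allI)
  fix u v assume "u \<in> plane a b c" "v \<in> plane a b c"
  then have *: "u \<in> Zt" "v \<in> Zt" "int p dvd a * cy 1 u + b * cy 2 u + c * cy 3 u" "int p dvd a * cy 1 v + b * cy 2 v + c * cy 3 v"
    by (auto simp: plane_def)
  have "int p dvd a * cy 1 (u + v) + b * cy 2 (u + v) + c * cy 3 (u + v)"
    by (rule dvd_combination2[OF *(3,4), where k = 1 and l = 1]) (simp add: algebra_simps)
  then show "u + v \<in> plane a b c" using lat_add[OF lat_Zt *(1,2)] by (simp add: plane_def)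
next
  fix u assume "u \<in> plane a b c"
  then have *: "u \<in> Zt" "int p dvd a * cy 1 u + b * cy 2 u + c * cy 3 u" by (auto simp: plane_def)
  have "int p dvd a * cy 1 (- u) + b * cy 2 (- u) + c * cy 3 (- u)"
    by (rule dvd_combination2[OF *(2,2), where k = "- 1" and l = 0]) (simp add: algebra_simps)
  then show "- u \<in> plane a b c" using lat_uminus[OF lat_Zt *(1)] by (simp add: plane_def)
next
  fix u show "zmul (int p) u \<in> plane a b c"
    using lat_p[OF lat_Zt, of u] by (simp add: plane_def mult.left_commute[of _ "int p"])
qed

lemma PL_plane: "PL \<subseteq> plane a b c" by (rule PL_least[OF lat_plane])

lemma plane_Zt: "plane a b c \<subseteq> Zt" by (auto simp: plane_def)

text \<open>The form applied to [u, v] pairs x_1, x_2, x_3 with x_4, x_5 only. Its matrix has the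
  rows (a, c, 2b) and (b, a, c): the first two conditions are its rows, applied to the first three
  coordinates of u, and the last three are its columns, applied to the other two. They are the
  coefficients of the coordinates of v.\<close>

lemma Rad_plane:
  "u \<in> Rad (plane a b c) \<longleftrightarrow> int p dvd a * cx 1 u + c * cx 2 u + 2 * b * cx 3 u
     \<and> int p dvd b * cx 1 u + a * cx 2 u + c * cx 3 u \<and> int p dvd a * cx 4 u + b * cx 5 u
     \<and> int p dvd c * cx 4 u + a * cx 5 u \<and> int p dvd 2 * b * cx 4 u + c * cx 5 u" (is "_ \<longleftrightarrow> ?R")
proof
  assume "u \<in> Rad (plane a b c)"
  then have *: "int p dvd a * cy 1 (br u v) + b * cy 2 (br u v) + c * cy 3 (br u v)" for v
    by (simp add: Rad_def plane_def)
  show ?R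
    using *[of "mk 0 0 0 1 0 0 0 0"] *[of "mk 0 0 0 0 1 0 0 0"] *[of "mk (- 1) 0 0 0 0 0 0 0"]
      *[of "mk 0 (- 1) 0 0 0 0 0 0"] *[of "mk 0 0 (- 1) 0 0 0 0 0"]
    by (simp add: cy_br algebra_simps)
next
  assume R: ?R
  have "int p dvd a * cy 1 (br u v) + b * cy 2 (br u v) + c * cy 3 (br u v)" for v
  proof -
    have "a * cy 1 (br u v) + b * cy 2 (br u v) + c * cy 3 (br u v)
      = cx 4 v * (a * cx 1 u + c * cx 2 u + 2 * b * cx 3 u) + cx 5 v * (b * cx 1 u + a * cx 2 u + c * cx 3 u)
      - cx 1 v * (a * cx 4 u + b * cx 5 u) - cx 2 v * (c * cx 4 u + a * cx 5 u) - cx 3 v * (2 * b * cx 4 u + c * cx 5 u)"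
      by (simp add: cy_br algebra_simps)
    then show ?thesis using R by (simp add: dvd_add dvd_diff)
  qed
  then show "u \<in> Rad (plane a b c)" by (simp add: Rad_def plane_def br_Zt)
qed

lemma idx_prime_maximal:
  assumes "lat J" "lat H" "J \<subseteq> H" "idx J H = p" "c \<in> H" "c \<notin> J"
  shows "adjoin J c = H"
  by (rule eq_if_idx_eq[OF assms(1) lat_adjoin[OF assms(1)] assms(2) adjoin_upper])
    (use assms idx_adjoin[OF assms(1,6)] in \<open>simp_all add: adjoin_least\<close>)

text \<open>Some basis vector \<open>e k\<close> is not in \<open>J\<close>, and modulo
  \<open>J\<close> every \<open>e i\<close> is a multiple n i of it; these multiples are the
  coefficients of the form.\<close>

lemma plane_form:
  assumes "J \<in> between PL Zt 2"
  obtains a b c where "\<not> (int p dvd a \<and> int p dvd b \<and> int p dvd c)" "J = plane a b c"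
proof -
  have J: "lat J" "J \<subseteq> Zt" using assms by (auto simp: between_def)
  have iJ: "idx J Zt = p" using idx_between[OF lat_PL lat_Zt PL_Zt idx_PL_Zt assms] by simp
  define e where "e = (\<lambda>k::nat. mk 0 0 0 0 0 (if k = 1 then 1 else 0) (if k = 2 then 1 else 0) (if k = 3 then 1 else 0))"
  have eZ: "e k \<in> Zt" for k by (simp add: e_def Zt_def)
  have expand: "u - (zmul (cy 1 u) (e 1) + zmul (cy 2 u) (e 2) + zmul (cy 3 u) (e 3)) \<in> J" if "u \<in> Zt" for u
  proof -
    have "u - (zmul (cy 1 u) (e 1) + zmul (cy 2 u) (e 2) + zmul (cy 3 u) (e 3)) \<in> PL"
      using that by (simp add: PL_iff Zt_def e_def)
    then show ?thesis using PL_least[OF J(1)] by blast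
  qed
  have "\<exists>k\<in>{1, 2, 3}. e k \<notin> J"
  proof (rule ccontr)
    assume "\<not> ?thesis"
    then have "e 1 \<in> J" "e 2 \<in> J" "e 3 \<in> J" by auto
    then have "zmul (cy 1 u) (e 1) + zmul (cy 2 u) (e 2) + zmul (cy 3 u) (e 3) \<in> J" for u
      by (intro lat_add lat_scale J(1))
    then have "Zt \<subseteq> J" using expand lat_cong_iff[OF J(1)] by blast
    then have "idx J Zt = 1" using J idx_self by (metis subset_antisym)
    then show False using iJ p_gt_1 by simp
  qed
  then obtain k where k: "k \<in> {1, 2, 3}" "e k \<notin> J" by blast
  have "\<exists>n. e i - zmul n (e k) \<in> J" for i
  proof -
    have "e i \<in> adjoin J (e k)" using idx_prime_maximal[OF J(1) lat_Zt J(2) iJ eZ k(2)] eZ by simp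
    then obtain j n where "j \<in> J" "e i = j + zmul n (e k)" by (auto simp: adjoin_def)
    then show ?thesis by (metis add_diff_cancel_right')
  qed
  then obtain n where n: "\<And>i. e i - zmul (n i) (e k) \<in> J" by metis
  have "zmul (1 - n k) (e k) \<in> J" using n[of k] by (simp add: scale_left_diff_distrib)
  then have nk: "int p dvd 1 - n k" using scale_mem_iff[OF J(1) k(2)] by blast
  have "\<not> int p dvd n k"
  proof
    assume "int p dvd n k"
    then have "int p dvd 1" using nk dvd_add[of "int p" "1 - n k" "n k"] by simp
    then show False using p_gt_1 by simp
  qed
  then have nz: "\<not> (int p dvd n 1 \<and> int p dvd n 2 \<and> int p dvd n 3)" using k(1) by auto
  have mem: "u \<in> J \<longleftrightarrow> int p dvd n 1 * cy 1 u + n 2 * cy 2 u + n 3 * cy 3 u" if u: "u \<in> Zt" for u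
  proof -
    let ?m = "n 1 * cy 1 u + n 2 * cy 2 u + n 3 * cy 3 u"
    have "zmul (cy 1 u) (e 1 - zmul (n 1) (e k)) + zmul (cy 2 u) (e 2 - zmul (n 2) (e k))
      + zmul (cy 3 u) (e 3 - zmul (n 3) (e k)) \<in> J"
      by (intro lat_add lat_scale J(1) n)
    then have "(u - (zmul (cy 1 u) (e 1) + zmul (cy 2 u) (e 2) + zmul (cy 3 u) (e 3)))
      + (zmul (cy 1 u) (e 1 - zmul (n 1) (e k)) + zmul (cy 2 u) (e 2 - zmul (n 2) (e k))
      + zmul (cy 3 u) (e 3 - zmul (n 3) (e k))) \<in> J"
      by (rule lat_add[OF J(1) expand[OF u]])
    then have "u - zmul ?m (e k) \<in> J"
      by (simp add: scale_right_diff_distrib scale_left_distrib algebra_simps)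
    then have "u \<in> J \<longleftrightarrow> zmul ?m (e k) \<in> J" by (rule lat_cong_iff[OF J(1)])
    then show ?thesis using scale_mem_iff[OF J(1) k(2)] by simp
  qed
  have "J = plane (n 1) (n 2) (n 3)" using mem J(2) by (auto simp: plane_def)
  then show thesis using that nz by blast
qed

text \<open>The hypothesis says that the 2 x 3 matrix of \<open>Rad_plane\<close> has rank 2. Then
  the last two coordinates of a radical element vanish, and the first three are orthogonal to both
  rows, which leaves one dimension.\<close>

lemma idx_Rad_plane_nondegenerate:
  assumes nd: "\<not> (int p dvd a ^ 2 - b * c \<and> int p dvd a * c - 2 * b ^ 2 \<and> int p dvd c ^ 2 - 2 * a * b)"
  shows "idx Zt (Rad (plane a b c)) = p"
proof -
  \<comment> \<open>The cross product of the rows (a, c, 2b) and (b, a, c).\<close>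
  define w where "w = (\<lambda>k::nat. if k = 1 then c ^ 2 - 2 * a * b else if k = 2 then 2 * b ^ 2 - a * c else a ^ 2 - b * c)"
  let ?W = "mk (w 1) (w 2) (w 3) 0 0 0 0 0"
  have XW: "cx i ?W = w i" if "i \<in> {1, 2, 3}" for i using that by auto
  obtain k where k: "k \<in> {1, 2, 3}" "\<not> int p dvd w k"
  proof -
    have "\<not> (int p dvd w 1 \<and> int p dvd w 2 \<and> int p dvd w 3)"
      using nd dvd_minus_iff[of "int p" "a * c - 2 * b ^ 2"] by (auto simp: w_def)
    then show thesis using that by auto
  qed
  have W: "?W \<in> Rad (plane a b c)"
    by (simp add: Rad_plane w_def power2_eq_square algebra_simps)
  have "?W \<notin> Zt" using k by (auto simp: Zt_def)
  have "Rad (plane a b c) = adjoin Zt ?W"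
  proof
    show "adjoin Zt ?W \<subseteq> Rad (plane a b c)"
      by (intro adjoin_least lat_Rad lat_plane Zt_Rad W)
    show "Rad (plane a b c) \<subseteq> adjoin Zt ?W"
    proof
      fix u assume "u \<in> Rad (plane a b c)"
      then have R1: "int p dvd a * cx 1 u + c * cx 2 u + 2 * b * cx 3 u"
        and R2: "int p dvd b * cx 1 u + a * cx 2 u + c * cx 3 u"
        and R3: "int p dvd a * cx 4 u + b * cx 5 u" and R4: "int p dvd c * cx 4 u + a * cx 5 u"
        and R5: "int p dvd 2 * b * cx 4 u + c * cx 5 u" by (simp_all add: Rad_plane)
      \<comment> \<open>Cramer's rule: eliminating \<open>cx 5 u\<close> from two of the three
        equations leaves \<open>cx 4 u\<close> multiplied by a minor, which up to sign is an entry
        of w, and one of these is a unit.\<close>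
      have c4: "int p dvd w 3 * cx 4 u" "int p dvd w 2 * cx 4 u" "int p dvd w 1 * cx 4 u"
        by (rule dvd_combination2[OF R3 R4, where k = a and l = "- b"], simp add: w_def power2_eq_square algebra_simps,
          rule dvd_combination2[OF R3 R5, where k = "- c" and l = b], simp add: w_def power2_eq_square algebra_simps,
          rule dvd_combination2[OF R4 R5, where k = c and l = "- a"], simp add: w_def power2_eq_square algebra_simps)
      have c5: "int p dvd w 3 * cx 5 u" "int p dvd w 2 * cx 5 u" "int p dvd w 1 * cx 5 u"
        by (rule dvd_combination2[OF R3 R4, where k = "- c" and l = a], simp add: w_def power2_eq_square algebra_simps,
          rule dvd_combination2[OF R3 R5, where k = "2 * b" and l = "- a"], simp add: w_def power2_eq_square algebra_simps,
          rule dvd_combination2[OF R4 R5, where k = "- 2 * b" and l = c], simp add: w_def power2_eq_square algebra_simps)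
      have X45: "int p dvd cx 4 u" "int p dvd cx 5 u"
        using k c4 c5 by (auto intro: unit_cancel)
      \<comment> \<open>Orthogonality to both rows makes the first three coordinates of u
        proportional to w; the minors of the two vectors express this.\<close>
      have m12: "int p dvd cx 1 u * w 2 - cx 2 u * w 1"
        by (rule dvd_combination2[OF R1 R2, where k = "- c" and l = "2 * b"])
          (simp add: w_def power2_eq_square algebra_simps)
      have m13: "int p dvd cx 1 u * w 3 - cx 3 u * w 1"
        by (rule dvd_combination2[OF R1 R2, where k = a and l = "- c"])
          (simp add: w_def power2_eq_square algebra_simps)
      have m23: "int p dvd cx 2 u * w 3 - cx 3 u * w 2"
        by (rule dvd_combination2[OF R1 R2, where k = "- b" and l = a])
          (simp add: w_def power2_eq_square algebra_simps)
      have minor: "int p dvd cx i u * w j - cx j u * w i" if "i \<in> {1, 2, 3}" "j \<in> {1, 2, 3}" for i j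
        using that m12 m13 m23 dvd_minus_iff[of "int p" "cx 1 u * w 2 - cx 2 u * w 1"]
          dvd_minus_iff[of "int p" "cx 1 u * w 3 - cx 3 u * w 1"] dvd_minus_iff[of "int p" "cx 2 u * w 3 - cx 3 u * w 2"]
        by auto
      obtain m where m: "int p dvd m * w k - 1" using unit_inverse[OF k(2)] .
      have Xi: "int p dvd cx i u - m * cx k u * w i" if i: "i \<in> {1, 2, 3}" for i
      proof (rule unit_cancel[OF k(2)])
        show "int p dvd w k * (cx i u - m * cx k u * w i)"
          by (rule dvd_combination2[OF minor[OF i k(1)] m, where k = 1 and l = "- cx k u * w i"])
            (simp add: algebra_simps)
      qed
      have "u - zmul (m * cx k u) ?W \<in> Zt"
        using Xi[of 1] Xi[of 2] Xi[of 3] X45 by (simp add: Zt_def)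
      then have "(u - zmul (m * cx k u) ?W) + zmul (m * cx k u) ?W \<in> adjoin Zt ?W" by (rule adjoinI)
      then show "u \<in> adjoin Zt ?W" by simp
    qed
  qed
  then show ?thesis using idx_adjoin[OF lat_Zt \<open>?W \<notin> Zt\<close>] by simp
qed

definition root_plane :: "int \<Rightarrow> 'a set" where "root_plane r = plane r 1 (r ^ 2)"

text \<open>For a matrix of rank 1, b is a unit, since otherwise a^2 and c^2 would vanish as well.
  With r = a/b the first minor gives c = r^2 b, and the second then gives r^3 = 2.\<close>

lemma degenerate_plane:
  assumes nz: "\<not> (int p dvd a \<and> int p dvd b \<and> int p dvd c)"
    and A: "int p dvd a ^ 2 - b * c" and B: "int p dvd a * c - 2 * b ^ 2" and C: "int p dvd c ^ 2 - 2 * a * b"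
  shows "plane a b c \<in> root_plane ` roots"
proof -
  have b: "\<not> int p dvd b"
  proof
    assume b: "int p dvd b"
    have "int p dvd a ^ 2" by (rule dvd_combination2[OF A b, where k = 1 and l = c]) simp
    moreover have "int p dvd c ^ 2" by (rule dvd_combination2[OF C b, where k = 1 and l = "2 * a"]) simp
    ultimately show False using nz b prime_dvd_power[OF prime_int_p] by blast
  qed
  obtain m where m: "int p dvd m * b - 1" using unit_inverse[OF b] .
  define r where "r = m * a mod int p"
  have rm: "int p dvd r - m * a" unfolding r_def by (simp add: mod_eq_iff[symmetric])
  have ra: "int p dvd r * b - a"
    by (rule dvd_combination2[OF rm m, where k = b and l = a]) (simp add: algebra_simps)
  have rc: "int p dvd r ^ 2 * b - c"
  proof (rule unit_cancel[OF b])
    show "int p dvd b * (r ^ 2 * b - c)"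
      by (rule dvd_combination2[OF ra A, where k = "r * b + a" and l = 1])
        (simp add: power2_eq_square algebra_simps)
  qed
  have r3: "int p dvd r ^ 3 - 2"
  proof (rule unit_cancel[OF b], rule unit_cancel[OF b])
    show "int p dvd b * (b * (r ^ 3 - 2))"
      by (rule dvd_combination3[OF ra rc B, where k = "r ^ 2 * b" and l = a and n = 1])
        (simp add: power2_eq_square power3_eq_cube algebra_simps)
  qed
  have "r \<in> roots" using r3 p_pos by (simp add: r_def cong_iff_dvd_diff)
  moreover have "plane a b c = root_plane r"
  proof -
    have "int p dvd a * y1 + b * y2 + c * y3 \<longleftrightarrow> int p dvd r * y1 + 1 * y2 + r ^ 2 * y3" (is "?l \<longleftrightarrow> ?r") for y1 y2 y3
    proof -
      have "int p dvd b * (r * y1 + 1 * y2 + r ^ 2 * y3) - (a * y1 + b * y2 + c * y3)"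
        by (rule dvd_combination2[OF ra rc, where k = y1 and l = y3]) (simp add: algebra_simps)
      then have "?l \<longleftrightarrow> int p dvd b * (r * y1 + 1 * y2 + r ^ 2 * y3)"
        using dvd_diff_imp_iff by blast
      also have "\<dots> \<longleftrightarrow> ?r" using b prime_dvd_mult_iff[OF prime_int_p] by blast
      finally show ?thesis .
    qed
    then show ?thesis by (simp add: plane_def root_plane_def)
  qed
  ultimately show ?thesis by blast
qed

lemma root_plane_between: "root_plane r \<in> between PL Zt 2"
proof -
  let ?f = "\<lambda>u. (r * cy 1 u + 1 * cy 2 u + r ^ 2 * cy 3 u) mod int p"
  have "idx (root_plane r) Zt = card (?f ` Zt)"
    unfolding root_plane_def
  proof (rule idx_eq_card[OF lat_plane])
    fix u v assume "u \<in> Zt" "v \<in> Zt"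
    then have "u - v \<in> Zt" by (rule lat_diff[OF lat_Zt])
    then show "?f u = ?f v \<longleftrightarrow> u - v \<in> plane r 1 (r ^ 2)"
      unfolding mod_eq_iff by (simp add: plane_def algebra_simps)
  qed
  also have "?f ` Zt = {0..<int p}"
  proof (intro equalityI subsetI)
    fix k assume k: "k \<in> {0..<int p}"
    have "mk 0 0 0 0 0 0 k 0 \<in> Zt" by (simp add: Zt_def)
    moreover have "k = ?f (mk 0 0 0 0 0 0 k 0)" using k by simp
    ultimately show "k \<in> ?f ` Zt" by (rule image_eqI[rotated])
  qed (use p_pos in auto)
  finally have "idx (root_plane r) Zt = p" by simp
  moreover have "idx PL Zt = idx PL (root_plane r) * idx (root_plane r) Zt"
    unfolding root_plane_def by (intro idx_mult lat_PL lat_plane lat_Zt PL_plane plane_Zt)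
  ultimately have "idx PL (root_plane r) * p = p ^ 3" using idx_PL_Zt by simp
  also have "p ^ 3 = p ^ 2 * p" by (simp add: power2_eq_square power3_eq_cube)
  finally have "idx PL (root_plane r) * p = p ^ 2 * p" .
  then have "idx PL (root_plane r) = p ^ 2" using p_gt_1 by simp
  then show ?thesis using lat_plane PL_plane plane_Zt by (simp add: between_def root_plane_def)
qed

text \<open>As r^3 = 2, the first row (r, r^2, 2) is r times the second row (1, r, r^2). The five
  equations of \<open>Rad_plane\<close> reduce to two, and the radical has dimension 5 - 2 over
  \<open>Zt\<close>.\<close>

lemma idx_Rad_root_plane:
  assumes "r \<in> roots" shows "idx Zt (Rad (root_plane r)) = p ^ 3"
proof -
  have r3: "int p dvd r ^ 3 - 2" using root_dvd[OF assms] .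
  let ?f = "\<lambda>u. ((cx 1 u + r * cx 2 u + r ^ 2 * cx 3 u) mod int p, (r * cx 4 u + cx 5 u) mod int p)"
  have Rad: "u \<in> Rad (root_plane r) \<longleftrightarrow> int p dvd cx 1 u + r * cx 2 u + r ^ 2 * cx 3 u \<and> int p dvd r * cx 4 u + cx 5 u" for u
  proof -
    have "int p dvd r * cx 1 u + r ^ 2 * cx 2 u + 2 * 1 * cx 3 u" if "int p dvd cx 1 u + r * cx 2 u + r ^ 2 * cx 3 u"
      by (rule dvd_combination2[OF that r3, where k = r and l = "- cx 3 u"])
        (simp add: power2_eq_square power3_eq_cube algebra_simps)
    moreover have "int p dvd r ^ 2 * cx 4 u + r * cx 5 u" if "int p dvd r * cx 4 u + cx 5 u"
      by (rule dvd_combination2[OF that r3, where k = r and l = 0])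
        (simp add: power2_eq_square algebra_simps)
    moreover have "int p dvd 2 * 1 * cx 4 u + r ^ 2 * cx 5 u" if "int p dvd r * cx 4 u + cx 5 u"
      by (rule dvd_combination2[OF that r3, where k = "r ^ 2" and l = "- cx 4 u"])
        (simp add: power2_eq_square power3_eq_cube algebra_simps)
    ultimately show ?thesis unfolding root_plane_def Rad_plane mult_1_left by blast
  qed
  have "idx (Rad (root_plane r)) UNIV = card (?f ` UNIV)"
    by (rule idx_eq_card[OF lat_Rad]) (auto simp: root_plane_def lat_plane Rad[unfolded root_plane_def] mod_eq_iff algebra_simps)
  also have "?f ` UNIV = {0..<int p} \<times> {0..<int p}"
  proof (intro equalityI subsetI)
    fix x assume "x \<in> {0..<int p} \<times> {0..<int p}"
    then obtain a b where "x = (a, b)" "a \<in> {0..<int p}" "b \<in> {0..<int p}" by auto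
    then have "x = ?f (mk a 0 0 0 b 0 0 0)" by simp
    then show "x \<in> ?f ` UNIV" by (rule range_eqI)
  qed (use p_pos in auto)
  finally have "idx (Rad (root_plane r)) UNIV = p * p" by (simp add: card_cartesian_product)
  moreover have "lat (root_plane r)" by (simp add: root_plane_def lat_plane)
  then have "idx Zt UNIV = idx Zt (Rad (root_plane r)) * idx (Rad (root_plane r)) UNIV"
    by (intro idx_mult lat_Zt lat_Rad Zt_Rad lat_UNIV subset_UNIV)
  ultimately have "idx Zt (Rad (root_plane r)) * (p * p) = p ^ 5" using idx_Zt_UNIV by simp
  also have "p ^ 5 = p ^ 3 * (p * p)" by (simp add: numeral_eq_Suc)
  finally have "idx Zt (Rad (root_plane r)) * (p * p) = p ^ 3 * (p * p)" .
  then show ?thesis using p_gt_1 by simp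
qed

lemma inj_root_plane: "inj_on root_plane roots"
proof
  fix r s assume rs: "r \<in> roots" "s \<in> roots" "root_plane r = root_plane s"
  \<comment> \<open>y_1 - r y_2 lies in the plane of r, and the form of s takes the value s - r on
    it.\<close>
  let ?u = "mk 0 0 0 0 0 1 (- r) 0"
  have "?u \<in> root_plane r" by (simp add: root_plane_def plane_def Zt_def)
  then have "int p dvd s - r" unfolding rs(3) by (simp add: root_plane_def plane_def)
  then have "s = r" using roots_eqI rs(1,2) by blast
  then show "r = s" by simp
qed

lemma idx_Rad_other_plane:
  assumes "J \<in> between PL Zt 2 - root_plane ` roots" shows "idx Zt (Rad J) = p"
proof -
  obtain a b c where nz: "\<not> (int p dvd a \<and> int p dvd b \<and> int p dvd c)" and J: "J = plane a b c"
    using plane_form assms by blast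
  then have "\<not> (int p dvd a ^ 2 - b * c \<and> int p dvd a * c - 2 * b ^ 2 \<and> int p dvd c ^ 2 - 2 * a * b)"
    using degenerate_plane[OF nz] assms by blast
  then show ?thesis unfolding J by (rule idx_Rad_plane_nondegenerate)
qed

end

lemma sum_split_card:
  assumes "finite B" "A \<subseteq> B" "\<And>x. x \<in> A \<Longrightarrow> f x = a" "\<And>x. x \<in> B - A \<Longrightarrow> f x = (b :: nat)"
  shows "sum f B = card A * a + (card B - card A) * b"
proof -
  have "finite A" using assms(1,2) by (rule rev_finite_subset)
  have "sum f B = sum f A + sum f (B - A)" using assms(1,2) by (simp add: sum.subset_diff add.commute)
  also have "sum f A = card A * a" using assms(3) by simp
  also have "sum f (B - A) = (card B - card A) * b" using assms(4) \<open>finite A\<close> assms(2) by (simp add: card_Diff_subset)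
  finally show ?thesis .
qed

section \<open>Radicals modulo lines\<close>

context np8_mod begin

definition root_line :: "int \<Rightarrow> 'a set" where
  "root_line r = {u \<in> Zt. int p dvd cy 1 u - r * cy 3 u \<and> int p dvd cy 2 u - r ^ 2 * cy 3 u}"

lemma lat_root_line: "lat (root_line r)"
proof -
  have "root_line r = plane 1 0 (- r) \<inter> plane 0 1 (- (r ^ 2))"
    by (auto simp: root_line_def plane_def)
  then show ?thesis using lat_Int lat_plane by simp
qed

lemma root_line_between: "root_line r \<in> between PL Zt 1"
proof -
  have sub: "root_line r \<subseteq> Zt" by (auto simp: root_line_def)
  let ?f = "\<lambda>u. cy 3 u mod int p"
  have "idx PL (root_line r) = card (?f ` root_line r)"
  proof (rule idx_eq_card[OF lat_PL])
    fix u v assume "u \<in> root_line r" "v \<in> root_line r"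
    then have "u - v \<in> root_line r" by (rule lat_diff[OF lat_root_line])
    then have *: "u - v \<in> Zt" "int p dvd cy 1 (u - v) - r * cy 3 (u - v)" "int p dvd cy 2 (u - v) - r ^ 2 * cy 3 (u - v)"
      by (auto simp: root_line_def)
    have "int p dvd cy 1 (u - v)" "int p dvd cy 2 (u - v)" if "int p dvd cy 3 (u - v)"
      using dvd_diff_imp_iff[OF *(2)] dvd_diff_imp_iff[OF *(3)] that by (auto intro: dvd_mult)
    then show "?f u = ?f v \<longleftrightarrow> u - v \<in> PL"
      unfolding mod_eq_iff PL_iff_Zt[OF *(1)] by auto
  qed
  also have "?f ` root_line r = {0..<int p}"
  proof (intro equalityI subsetI)
    fix k assume k: "k \<in> {0..<int p}"
    have "mk 0 0 0 0 0 (r * k) (r ^ 2 * k) k \<in> root_line r" by (simp add: root_line_def Zt_def)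
    moreover have "k = ?f (mk 0 0 0 0 0 (r * k) (r ^ 2 * k) k)" using k by simp
    ultimately show "k \<in> ?f ` root_line r" by (rule image_eqI[rotated])
  qed (use p_pos in auto)
  finally show ?thesis using lat_root_line sub PL_least by (simp add: between_def)
qed

lemma inj_root_line: "inj_on root_line roots"
proof
  fix r s assume rs: "r \<in> roots" "s \<in> roots" "root_line r = root_line s"
  let ?u = "mk 0 0 0 0 0 r (r ^ 2) 1"
  have "?u \<in> root_line r" by (simp add: root_line_def Zt_def)
  then have "int p dvd r - s" unfolding rs(3) by (simp add: root_line_def)
  then show "r = s" using roots_eqI rs(1,2) by blast
qed

text \<open>\<open>L\<close> has dimension 1 over \<open>PL\<close>, so the coordinate vectors of
  two of its elements are proportional modulo p.\<close>

lemma line_minor: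
  assumes L: "L \<in> between PL Zt 1" and s: "s \<in> L" and t: "t \<in> L" and that: "i \<in> {1, 2, 3}" "j \<in> {1, 2, 3}"
  shows "int p dvd cy i s * cy j t - cy j s * cy i t"
proof -
  have L': "lat L" "PL \<subseteq> L" "L \<subseteq> Zt" "idx PL L = p" using L by (auto simp: between_def)
  have dY: "int p dvd cy k v" if "v \<in> PL" "k \<in> {1, 2, 3}" for v k using that by (auto simp: PL_iff)
  show ?thesis
  proof (cases "s \<in> PL")
    case True
    then show ?thesis using dY that by (simp add: dvd_diff)
  next
    case False
    then have "t \<in> adjoin PL s" using idx_prime_maximal[OF lat_PL L'(1,2,4) s] t by simp
    then obtain v n where "v \<in> PL" "t = v + zmul n s" by (auto simp: adjoin_def)
    then have "cy i s * cy j t - cy j s * cy i t = cy i s * cy j v - cy j s * cy i v" by (simp add: algebra_simps)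
    then show ?thesis using dY[OF \<open>v \<in> PL\<close>] that by (simp add: dvd_diff)
  qed
qed

text \<open>All brackets with u are proportional modulo p. Those with x_1 and x_2 force the last two
  coordinates of u to vanish; those with x_4 and x_5 are then (u_1, 2 u_3, u_2) and (u_2, u_1, u_3),
  and their minors give u_3 nonzero, u_2 = r u_3, u_1 = r^2 u_3 and r^3 = 2. The bracket with x_5
  spans the line.\<close>

lemma Rad_line:
  assumes L: "L \<in> between PL Zt 1" and u: "u \<in> Rad L" "u \<notin> Zt"
  obtains r where "r \<in> roots" "L = root_line r" "u \<in> adjoin Zt (mk (r ^ 2) r 1 0 0 0 0 0)"
proof -
  have L': "lat L" "PL \<subseteq> L" "L \<subseteq> Zt" "idx PL L = p" using L by (auto simp: between_def)
  have br: "br u v \<in> L" for v using u(1) by (simp add: Rad_def)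
  let ?e1 = "mk 1 0 0 0 0 0 0 0" and ?e2 = "mk 0 1 0 0 0 0 0 0" and ?e4 = "mk 0 0 0 1 0 0 0 0" and ?e5 = "mk 0 0 0 0 1 0 0 0"
  \<comment> \<open>The two brackets are (-u_4, -u_5, 0) and (-u_5, 0, -u_4), and two of their
    minors are squares up to sign.\<close>
  have "int p dvd cx 5 u * cx 5 u" "int p dvd cx 4 u * cx 4 u"
    using line_minor[OF L br[of ?e1] br[of ?e2], of 1 3] line_minor[OF L br[of ?e1] br[of ?e2], of 1 2]
    by (simp_all add: cy_br)
  then have X45: "int p dvd cx 4 u" "int p dvd cx 5 u" using dvd_square_cancel by blast+
  have m12: "int p dvd cx 1 u * cx 1 u - 2 * cx 2 u * cx 3 u"
    and m13: "int p dvd cx 1 u * cx 3 u - cx 2 u * cx 2 u"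
    and m23: "int p dvd 2 * cx 3 u * cx 3 u - cx 1 u * cx 2 u"
    using line_minor[OF L br[of ?e4] br[of ?e5], of 1 2] line_minor[OF L br[of ?e4] br[of ?e5], of 1 3]
      line_minor[OF L br[of ?e4] br[of ?e5], of 2 3]
    by (simp_all add: cy_br algebra_simps)
  have X3: "\<not> int p dvd cx 3 u"
  proof
    assume X3: "int p dvd cx 3 u"
    have "int p dvd cx 1 u * cx 1 u"
      by (rule dvd_combination2[OF m12 X3, where k = 1 and l = "2 * cx 2 u"]) simp
    moreover have "int p dvd cx 2 u * cx 2 u"
      by (rule dvd_combination2[OF m13 X3, where k = "- 1" and l = "cx 1 u"]) simp
    ultimately have "int p dvd cx 1 u" "int p dvd cx 2 u" using dvd_square_cancel by blast+
    then show False using u(2) X3 X45 by (simp add: Zt_def)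
  qed
  obtain m where m: "int p dvd m * cx 3 u - 1" using unit_inverse[OF X3] .
  define r where "r = m * cx 2 u mod int p"
  have rm: "int p dvd r - m * cx 2 u" unfolding r_def by (simp add: mod_eq_iff[symmetric])
  have r2: "int p dvd r * cx 3 u - cx 2 u"
    by (rule dvd_combination2[OF rm m, where k = "cx 3 u" and l = "cx 2 u"]) (simp add: algebra_simps)
  have r1: "int p dvd r ^ 2 * cx 3 u - cx 1 u"
  proof (rule unit_cancel[OF X3])
    show "int p dvd cx 3 u * (r ^ 2 * cx 3 u - cx 1 u)"
      by (rule dvd_combination2[OF r2 m13, where k = "r * cx 3 u + cx 2 u" and l = "- 1"])
        (simp add: power2_eq_square algebra_simps)
  qed
  have r3: "int p dvd r ^ 3 - 2"
  proof (rule unit_cancel[OF X3], rule unit_cancel[OF X3])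
    show "int p dvd cx 3 u * (cx 3 u * (r ^ 3 - 2))"
      by (rule dvd_combination3[OF r2 r1 m23, where k = "r ^ 2 * cx 3 u" and l = "cx 2 u" and n = "- 1"])
        (simp add: power2_eq_square power3_eq_cube algebra_simps)
  qed
  have r: "r \<in> roots" using r3 p_pos by (simp add: r_def cong_iff_dvd_diff)
  let ?w = "br u ?e5"
  have w: "?w \<notin> PL" using X3 by (simp add: PL_iff cy_br)
  have "?w \<in> root_line r"
    using br_Zt r1 r2 by (simp add: root_line_def cy_br dvd_diff_commute)
  then have "adjoin PL ?w = root_line r"
    using root_line_between[of r] w by (intro idx_prime_maximal) (auto simp: between_def lat_PL)
  moreover have "adjoin PL ?w = L" using idx_prime_maximal[OF lat_PL L'(1,2,4) br w] .
  ultimately have "L = root_line r" by simp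
  moreover have "u - zmul (cx 3 u) (mk (r ^ 2) r 1 0 0 0 0 0) \<in> Zt"
    using r1 r2 X45 by (simp add: Zt_def dvd_diff_commute mult.commute)
  from adjoinI[OF this, of "cx 3 u" "mk (r ^ 2) r 1 0 0 0 0 0"]
  have "u \<in> adjoin Zt (mk (r ^ 2) r 1 0 0 0 0 0)" by simp
  ultimately show thesis using that r by blast
qed

text \<open>By \<open>Rad_line\<close> a radical element outside \<open>Zt\<close> comes from a root
  s with the same line, and injectivity identifies s with r.\<close>

lemma idx_Rad_root_line:
  assumes r: "r \<in> roots" shows "idx Zt (Rad (root_line r)) = p"
proof -
  let ?W = "mk (r ^ 2) r 1 0 0 0 0 0"
  have W: "?W \<notin> Zt" using p_gt_1 by (simp add: Zt_def)
  have "int p dvd cy 2 (br ?W v) - r ^ 2 * cy 3 (br ?W v)" for v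
    by (rule dvd_combination2[OF root_dvd[OF r] root_dvd[OF r], where k = "- cx 4 v" and l = 0])
      (simp add: cy_br power2_eq_square power3_eq_cube algebra_simps)
  then have "?W \<in> Rad (root_line r)"
    by (simp add: Rad_def root_line_def br_Zt) (simp add: cy_br power2_eq_square algebra_simps)
  then have "adjoin Zt ?W \<subseteq> Rad (root_line r)"
    by (intro adjoin_least lat_Rad lat_root_line Zt_Rad)
  moreover have "Rad (root_line r) \<subseteq> adjoin Zt ?W"
  proof
    fix u assume u: "u \<in> Rad (root_line r)"
    show "u \<in> adjoin Zt ?W"
    proof (cases "u \<in> Zt")
      case True
      then show ?thesis using adjoin_upper by blast
    next
      case False
      then obtain s where s: "s \<in> roots" "root_line r = root_line s" "u \<in> adjoin Zt (mk (s ^ 2) s 1 0 0 0 0 0)"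
        using Rad_line[OF root_line_between u] by blast
      then have "r = s" using inj_root_line r by (simp add: inj_on_def)
      then show ?thesis using s(3) by simp
    qed
  qed
  ultimately have "Rad (root_line r) = adjoin Zt ?W" by simp
  then show ?thesis using idx_adjoin[OF lat_Zt W] by simp
qed

lemma Rad_other_line:
  assumes "L \<in> between PL Zt 1 - root_line ` roots" shows "Rad L = Zt"
proof -
  have "Zt \<subseteq> Rad L" using assms by (auto simp: between_def intro!: Zt_Rad)
  moreover have "u \<in> Zt" if "u \<in> Rad L" for u
    using Rad_line[OF _ that] assms by blast
  ultimately show ?thesis by blast
qed

lemma Rad_PL: "Rad PL = Zt"
proof
  show "Rad PL \<subseteq> Zt"
  proof
    fix u assume "u \<in> Rad PL"
    then have *: "br u v \<in> PL" for v by (simp add: Rad_def)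
    show "u \<in> Zt"
      using *[of "mk 1 0 0 0 0 0 0 0"] *[of "mk 0 0 0 1 0 0 0 0"] *[of "mk 0 0 0 0 1 0 0 0"]
      by (simp add: Zt_def PL_iff cy_br)
  qed
qed (rule Zt_Rad[OF lat_PL])

lemma Rad_Zt: "Rad Zt = UNIV" by (auto simp: Rad_def br_Zt)

section \<open>Counting pairs and ideals by dimension\<close>

lemma card_between_Zt:
  assumes "lat H" "Zt \<subseteq> H" "idx Zt H = p ^ n"
  shows "card (between Zt H u) = (if u \<le> n then qbinomial n u else 0)"
  using card_between[OF lat_Zt assms] between_empty[OF lat_Zt assms, of u] by auto

text \<open>The numbers of remaining planes and lines are differences of natural numbers; this bound
  lets them be evaluated without truncation.\<close>

lemma card_roots_le: "card roots \<le> qbinomial 3 2"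
proof -
  have "card roots = card (root_plane ` roots)" using card_image[OF inj_root_plane] by simp
  also have "\<dots> \<le> card (between PL Zt 2)" using root_plane_between by (intro card_mono) auto
  also have "\<dots> = qbinomial 3 2" by (rule card_between[OF lat_PL lat_Zt PL_Zt idx_PL_Zt]) simp
  finally show ?thesis .
qed

lemma card_pairs_0: "card (pairs u 0) = (if u = 0 then 1 else 0)"
  using card_between_Zt[OF lat_Zt subset_refl, of 0 u] idx_self[OF lat_Zt]
  by (simp add: card_pairs between_0[OF lat_PL lat_Zt PL_Zt] Rad_PL qbinomial_def qfact_def)

lemma card_pairs_3: "card (pairs u 3) = (if u \<le> 5 then qbinomial 5 u else 0)"
  using card_between_Zt[OF lat_UNIV subset_UNIV idx_Zt_UNIV, of u]
  by (simp add: card_pairs between_top[OF lat_PL lat_Zt PL_Zt idx_PL_Zt] Rad_Zt)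

lemma card_pairs_2:
  "card (pairs u 2) = card roots * (if u \<le> 3 then qbinomial 3 u else 0)
     + (qbinomial 3 2 - card roots) * (if u \<le> 1 then qbinomial 1 u else 0)"
proof -
  have "card (pairs u 2) = card (root_plane ` roots) * (if u \<le> 3 then qbinomial 3 u else 0)
     + (card (between PL Zt 2) - card (root_plane ` roots)) * (if u \<le> 1 then qbinomial 1 u else 0)"
    unfolding card_pairs
  proof (rule sum_split_card)
    show "root_plane ` roots \<subseteq> between PL Zt 2" using root_plane_between by blast
  next
    fix J assume "J \<in> root_plane ` roots"
    then have "lat J" "idx Zt (Rad J) = p ^ 3" using idx_Rad_root_plane by (auto simp: root_plane_def lat_plane)
    then show "card (between Zt (Rad J) u) = (if u \<le> 3 then qbinomial 3 u else 0)"
      by (intro card_between_Zt lat_Rad Zt_Rad)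
  next
    fix J assume J: "J \<in> between PL Zt 2 - root_plane ` roots"
    then have "lat J" "idx Zt (Rad J) = p ^ 1" using idx_Rad_other_plane by (auto simp: between_def)
    then show "card (between Zt (Rad J) u) = (if u \<le> 1 then qbinomial 1 u else 0)"
      by (intro card_between_Zt lat_Rad Zt_Rad)
  qed simp
  moreover have "card (between PL Zt 2) = qbinomial 3 2"
    by (rule card_between[OF lat_PL lat_Zt PL_Zt idx_PL_Zt]) simp
  ultimately show ?thesis by (simp only: card_image[OF inj_root_plane])
qed

lemma card_pairs_1:
  "card (pairs u 1) = card roots * (if u \<le> 1 then qbinomial 1 u else 0)
     + (qbinomial 3 1 - card roots) * (if u = 0 then 1 else 0)"
proof -
  have "card (pairs u 1) = card (root_line ` roots) * (if u \<le> 1 then qbinomial 1 u else 0)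
     + (card (between PL Zt 1) - card (root_line ` roots)) * (if u = 0 then 1 else 0)"
    unfolding card_pairs
  proof (rule sum_split_card)
    show "root_line ` roots \<subseteq> between PL Zt 1" using root_line_between by blast
  next
    fix J assume "J \<in> root_line ` roots"
    then have "lat J" "idx Zt (Rad J) = p ^ 1" using idx_Rad_root_line lat_root_line by auto
    then show "card (between Zt (Rad J) u) = (if u \<le> 1 then qbinomial 1 u else 0)"
      by (intro card_between_Zt lat_Rad Zt_Rad)
  next
    fix J assume J: "J \<in> between PL Zt 1 - root_line ` roots"
    show "card (between Zt (Rad J) u) = (if u = 0 then 1 else 0)"
      unfolding Rad_other_line[OF J] using card_between_Zt[OF lat_Zt subset_refl, of 0 u] idx_self[OF lat_Zt]
      by (simp add: qbinomial_def qfact_def)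
  qed simp
  moreover have "card (between PL Zt 1) = qbinomial 3 1"
    by (rule card_between[OF lat_PL lat_Zt PL_Zt idx_PL_Zt]) simp
  ultimately show ?thesis by (simp only: card_image[OF inj_root_line])
qed

lemma qbinomial_0: "qbinomial n 0 = 1" using qfact_pos[of n] by (simp add: qbinomial_def qfact_def)

lemma qbinomial_self: "qbinomial n n = 1" using qbinomial_symmetric[of 0 n] by (simp add: qbinomial_0)

text \<open>\<open>ideals d\<close> counts by dimension over \<open>PL\<close>, so d = 8 - i for
  codimension i. The equations are listed by increasing codimension.\<close>

lemma card_ideals_codim:
  defines "N \<equiv> card roots" and "b \<equiv> 1 + p + p ^ 2"
  shows "card (ideals 8) = 1" "card (ideals 7) = qbinomial 5 1" "card (ideals 6) = qbinomial 5 2"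
    "card (ideals 5) = qbinomial 5 3 + p ^ 3 * N" "card (ideals 4) = qbinomial 5 4 + p ^ 2 * b * N"
    "card (ideals 3) = 1 + (p + p ^ 2 * (1 + N) + p ^ 3 * (1 + N))"
    "card (ideals 2) = 1 + p + p ^ 2 * (1 + N)" "card (ideals 1) = b" "card (ideals 0) = 1"
proof -
  \<comment> \<open>The guards replace the upper limit \<open>min 3 d\<close>, which keeps the
    differences d - j from being truncated.\<close>
  have sum: "card (ideals d) = card (pairs d 0) * p ^ (3 * d) + (if 1 \<le> d then card (pairs (d - 1) 1) * p ^ (2 * (d - 1)) else 0)
     + (if 2 \<le> d then card (pairs (d - 2) 2) * p ^ (d - 2) else 0) + (if 3 \<le> d then card (pairs (d - 3) 3) else 0)" for d
  proof -
    have "d = 0 \<or> d = 1 \<or> d = 2 \<or> 3 \<le> d" by linarith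
    then show ?thesis
      unfolding card_ideals by (elim disjE) (simp_all add: numeral_eq_Suc One_nat_def)
  qed
  have b: "qbinomial 3 1 = b" "qbinomial 3 2 = b" using qbinomial_3 by (simp_all add: b_def)
  have q5: "qbinomial 5 4 = qbinomial 5 1" "qbinomial 5 3 = qbinomial 5 2"
    using qbinomial_symmetric[of 1 5] qbinomial_symmetric[of 2 5] by simp_all
  note pairs = card_pairs_0 card_pairs_1 card_pairs_2 card_pairs_3 b q5 qbinomial_0 qbinomial_self N_def
  show "card (ideals 8) = 1" "card (ideals 7) = qbinomial 5 1" "card (ideals 6) = qbinomial 5 2"
    "card (ideals 5) = qbinomial 5 3 + p ^ 3 * N" "card (ideals 4) = qbinomial 5 4 + p ^ 2 * b * N"
    "card (ideals 0) = 1"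
    unfolding sum by (simp_all add: pairs pairs[unfolded One_nat_def] One_nat_def)
  have Nb: "N \<le> b" using card_roots_le b by (simp add: N_def)
  obtain k where k: "b = N + k" using le_Suc_ex[OF Nb] by blast
  show "card (ideals 1) = b"
    unfolding sum using k by (simp add: pairs pairs[unfolded One_nat_def] One_nat_def)
  have "card (ideals 2) = N * p ^ 2 + b" unfolding sum using k by (simp add: pairs pairs[unfolded One_nat_def] One_nat_def)
  then show "card (ideals 2) = 1 + p + p ^ 2 * (1 + N)" by (simp add: b_def algebra_simps)
  have "card (ideals 3) = (N * b + k) * p + 1" unfolding sum using k by (simp add: pairs pairs[unfolded One_nat_def] One_nat_def)
  \<comment> \<open>Adding p N to both sides completes N + k to b and avoids a subtraction.\<close>
  also have "\<dots> + p * N = N * b * p + b * p + 1" using k by (simp add: algebra_simps)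
  finally show "card (ideals 3) = 1 + (p + p ^ 2 * (1 + N) + p ^ 3 * (1 + N))"
    by (simp add: b_def algebra_simps power2_eq_square power3_eq_cube)
qed

end

section \<open>Subspaces over the prime field as lattices\<close>

text \<open>A finite carrier generates itself, so there is a finite basis, and coordinates in it
  give a bijection with functions from the basis to the field.\<close>

lemma (in vectorspace) card_eq_card_field_power_dim:
  assumes fin: "finite (carrier V)"
  shows "card (carrier V) = card (carrier K) ^ dim"
proof -
  have "gen_set (carrier V)"
  proof
    show "span (carrier V) \<subseteq> carrier V" by (rule span_is_subset2) simp
    show "carrier V \<subseteq> span (carrier V)" by (rule in_own_span) simp
  qed
  then have "fin_dim" using fin by (auto simp: fin_dim_def)
  then obtain B where B: "finite B" "basis B" using finite_basis_exists by blast
  have BV: "B \<subseteq> carrier V" using B(2) by (simp add: basis_def)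
  have uniq: "\<exists>!a. a \<in> B \<rightarrow>\<^sub>E carrier K \<and> lincomb a B = v" if "v \<in> carrier V" for v
    using basis_criterion[OF B(1) BV] B(2) that by blast
  have lc: "lincomb a B \<in> carrier V" if "a \<in> B \<rightarrow>\<^sub>E carrier K" for a
    by (rule lincomb_closed[OF BV]) (use that in auto)
  have "bij_betw (\<lambda>a. lincomb a B) (B \<rightarrow>\<^sub>E carrier K) (carrier V)"
    unfolding bij_betw_def
  proof
    show "inj_on (\<lambda>a. lincomb a B) (B \<rightarrow>\<^sub>E carrier K)"
    proof
      fix a b assume ab: "a \<in> B \<rightarrow>\<^sub>E carrier K" "b \<in> B \<rightarrow>\<^sub>E carrier K" "lincomb a B = lincomb b B"
      show "a = b" using uniq[OF lc[OF ab(1)]] ab by metis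
    qed
    show "(\<lambda>a. lincomb a B) ` (B \<rightarrow>\<^sub>E carrier K) = carrier V"
    proof (intro equalityI subsetI)
      fix v assume "v \<in> carrier V"
      then obtain a where "a \<in> B \<rightarrow>\<^sub>E carrier K" "lincomb a B = v" using uniq by blast
      then show "v \<in> (\<lambda>a. lincomb a B) ` (B \<rightarrow>\<^sub>E carrier K)" by blast
    qed (use lc in blast)
  qed
  then have "card (carrier V) = card (B \<rightarrow>\<^sub>E carrier K)" by (simp add: bij_betw_same_card)
  also have "\<dots> = card (carrier K) ^ card B" using B(1) by (simp add: card_PiE)
  finally show ?thesis using dim_basis[OF B] by simp
qed

text \<open>A model \<open>V\<close> of L/K with projection \<open>f\<close>. The kernel is a
  parameter because the locale serves both L/pL, with \<open>PL\<close> as kernel, and F_p^m, with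
  the common kernel of m coordinates modulo p. Of the record only addition, zero and scalar action
  are constrained.\<close>

locale lattice_quotient = finite_mod_p_lattices zmul p
  for zmul :: "int \<Rightarrow> 'a::ab_group_add \<Rightarrow> 'a" and p :: nat +
  fixes V :: "(int, 'v) module" and f :: "'a \<Rightarrow> 'v" and K :: "'a set"
  assumes lat_K: "lat K"
    and carrier_V: "carrier V = range f"
    and f_eq_iff: "f u = f v \<longleftrightarrow> u - v \<in> K"
    and f_add: "f u \<oplus>\<^bsub>V\<^esub> f v = f (u + v)"
    and f_zero: "\<zero>\<^bsub>V\<^esub> = f 0"
    and f_smult: "k \<in> {0..<int p} \<Longrightarrow> k \<odot>\<^bsub>V\<^esub> f u = f (zmul k u)"
begin

lemma Fp_simps: "carrier (Fp p) = {0..<int p}" "\<one>\<^bsub>Fp p\<^esub> = 1" "\<zero>\<^bsub>Fp p\<^esub> = 0"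
  "a \<oplus>\<^bsub>Fp p\<^esub> b = (a + b) mod int p" "a \<otimes>\<^bsub>Fp p\<^esub> b = (a * b) mod int p"
  by (auto simp: residue_ring_def)

lemma field_Fp: "Ring.field (Fp p)"
  by (rule residues_prime.is_field) (simp add: residues_prime_def prime_p)

lemma f_mod: "f (zmul (a mod int p) u) = f (zmul a u)"
proof -
  have "zmul (a mod int p - a) u \<in> K"
    by (rule lat_scale_dvd[OF lat_K]) (simp add: mod_eq_dvd_iff[symmetric])
  then show ?thesis by (simp add: f_eq_iff scale_left_diff_distrib)
qed

lemma vectorspace_V: "vectorspace (Fp p) V"
proof (rule vs_criteria)
  have pos: "int p > 0" using p_gt_1 by simp
  show "Ring.field (Fp p)" by (rule field_Fp)
  show "\<forall>v\<in>carrier V. \<exists>w\<in>carrier V. v \<oplus>\<^bsub>V\<^esub> w = \<zero>\<^bsub>V\<^esub>"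
  proof
    fix v assume "v \<in> carrier V"
    then obtain u where "v = f u" by (auto simp: carrier_V)
    then show "\<exists>w\<in>carrier V. v \<oplus>\<^bsub>V\<^esub> w = \<zero>\<^bsub>V\<^esub>"
      by (intro bexI[of _ "f (- u)"]) (simp_all add: carrier_V f_add f_zero)
  qed
  show "\<forall>a b v. a \<in> carrier (Fp p) \<and> b \<in> carrier (Fp p) \<and> v \<in> carrier V \<longrightarrow>
      (a \<otimes>\<^bsub>Fp p\<^esub> b) \<odot>\<^bsub>V\<^esub> v = a \<odot>\<^bsub>V\<^esub> (b \<odot>\<^bsub>V\<^esub> v)"
    using pos by (auto simp: Fp_simps carrier_V f_smult f_mod)
  show "\<forall>a b v. a \<in> carrier (Fp p) \<and> b \<in> carrier (Fp p) \<and> v \<in> carrier V \<longrightarrow>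
      (a \<oplus>\<^bsub>Fp p\<^esub> b) \<odot>\<^bsub>V\<^esub> v = a \<odot>\<^bsub>V\<^esub> v \<oplus>\<^bsub>V\<^esub> b \<odot>\<^bsub>V\<^esub> v"
    using pos by (auto simp: Fp_simps carrier_V f_smult f_mod f_add scale_left_distrib)
  show "\<forall>v\<in>carrier V. \<one>\<^bsub>Fp p\<^esub> \<odot>\<^bsub>V\<^esub> v = v"
    using p_gt_1 by (auto simp: Fp_simps carrier_V f_smult)
qed (auto simp: carrier_V f_add f_zero f_smult Fp_simps add_ac scale_right_distrib)

lemma f_mem_image_iff: assumes "lat H" "K \<subseteq> H" shows "f u \<in> f ` H \<longleftrightarrow> u \<in> H"
proof
  assume "f u \<in> f ` H"
  then obtain v where "v \<in> H" "u - v \<in> K" by (auto simp: f_eq_iff)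
  then show "u \<in> H" using assms lat_cong_iff[of H u v] by blast
qed simp

lemma subspace_image: assumes "lat H" "K \<subseteq> H" shows "VectorSpace.subspace (Fp p) (f ` H) V"
proof (rule VectorSpace.subspace.intro[OF vectorspace_V], rule submodule.intro)
  show "Module.module (Fp p) V" using vectorspace_V by (simp add: vectorspace_def)
  show "f ` H \<subseteq> carrier V" by (auto simp: carrier_V)
  show "\<zero>\<^bsub>V\<^esub> \<in> f ` H" using lat_0[OF assms(1)] by (simp add: f_zero)
  show "v \<oplus>\<^bsub>V\<^esub> w \<in> f ` H" if "v \<in> f ` H" "w \<in> f ` H" for v w
    using that lat_add[OF assms(1)] by (auto simp: f_add)
  show "c \<odot>\<^bsub>V\<^esub> v \<in> f ` H" if "c \<in> carrier (Fp p)" "v \<in> f ` H" for c v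
    using that lat_scale[OF assms(1)] by (auto simp: Fp_simps f_smult)
qed

lemma subspace_preimage:
  assumes "VectorSpace.subspace (Fp p) W V"
  shows "lat (f -` W)" "K \<subseteq> f -` W" "f ` (f -` W) = W"
proof -
  interpret W: submodule "Fp p" W V using assms by (simp add: VectorSpace.subspace_def)
  have zero: "f 0 \<in> W" using W.zero_closed by (simp add: f_zero)
  have K: "f u = f 0" if "u \<in> K" for u using that by (simp add: f_eq_iff)
  show "K \<subseteq> f -` W" using zero K by auto
  show "f ` (f -` W) = W" using W.subset by (auto simp: carrier_V)
  show "lat (f -` W)"
    unfolding lat_def vimage_eq
  proof (intro conjI ballI allI)
    fix u v assume "u \<in> f -` W" "v \<in> f -` W"
    then show "f (u + v) \<in> W" using W.m_closed[of "f u" "f v"] by (simp add: f_add)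
  next
    fix u assume "u \<in> f -` W"
    \<comment> \<open>Scalars are the representatives 0, ..., p - 1, so -1 appears as p - 1.\<close>
    then have "(int p - 1) \<odot>\<^bsub>V\<^esub> f u \<in> W" using p_gt_1 by (intro W.smult_closed) (auto simp: Fp_simps)
    then have "f (zmul (int p - 1) u) \<in> W" using p_gt_1 by (simp add: f_smult)
    moreover have "zmul (int p - 1) u - (- u) \<in> K" using lat_p[OF lat_K] by (simp add: scale_left_diff_distrib)
    ultimately show "f (- u) \<in> W" by (simp only: f_eq_iff[symmetric])
  next
    fix u show "f (zmul (int p) u) \<in> W" using zero K lat_p[OF lat_K] by metis
  qed
qed

text \<open>Both sides count the image of \<open>H\<close>: by cosets of \<open>K\<close>, and as a
  vector space over a field with p elements.\<close>

lemma idx_eq_p_power_dim: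
  assumes "lat H" "K \<subseteq> H" shows "idx K H = p ^ vectorspace.dim (Fp p) (V\<lparr>carrier := f ` H\<rparr>)"
proof -
  interpret vectorspace "Fp p" V by (rule vectorspace_V)
  interpret W: vectorspace "Fp p" "V\<lparr>carrier := f ` H\<rparr>"
    by (rule subspace_is_vs[OF subspace_image[OF assms]])
  have idx: "idx K H = card (f ` H)" by (rule idx_eq_card[OF lat_K f_eq_iff])
  then have "finite (f ` H)" using idx_pos[OF lat_K assms(1)] card_ge_0_finite by metis
  then show ?thesis using W.card_eq_card_field_power_dim idx by (simp add: Fp_simps)
qed

lemma dim_eq_iff:
  assumes "lat H" "K \<subseteq> H"
  shows "vectorspace.dim (Fp p) (V\<lparr>carrier := f ` H\<rparr>) = i \<longleftrightarrow> idx K H = p ^ i"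
  unfolding idx_eq_p_power_dim[OF assms] using p_gt_1 by simp

lemma inj_on_image_lattices: "inj_on ((`) f) {H. lat H \<and> K \<subseteq> H}"
proof
  fix A B assume A: "A \<in> {H. lat H \<and> K \<subseteq> H}" and B: "B \<in> {H. lat H \<and> K \<subseteq> H}" and eq: "f ` A = f ` B"
  have "x \<in> A \<longleftrightarrow> x \<in> B" for x using f_mem_image_iff[of A x] f_mem_image_iff[of B x] A B eq by simp
  then show "A = B" by blast
qed

lemma Fp_subspaces_eq: "Fp_subspaces p V i = (`) f ` between K UNIV i"
proof (intro equalityI subsetI)
  fix W assume "W \<in> Fp_subspaces p V i"
  then have W: "VectorSpace.subspace (Fp p) W V" "vectorspace.dim (Fp p) (V\<lparr>carrier := W\<rparr>) = i"
    by (auto simp: Fp_subspaces_def)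
  note P = subspace_preimage[OF W(1)]
  have "f -` W \<in> between K UNIV i"
    using P dim_eq_iff[OF P(1,2), of i] W(2) by (simp add: between_def)
  then show "W \<in> (`) f ` between K UNIV i" using P(3) by (metis imageI)
next
  fix W assume "W \<in> (`) f ` between K UNIV i"
  then obtain H where H: "lat H" "K \<subseteq> H" "idx K H = p ^ i" "W = f ` H" by (auto simp: between_def)
  then show "W \<in> Fp_subspaces p V i"
    using subspace_image dim_eq_iff by (simp add: Fp_subspaces_def)
qed

lemma card_Fp_subspaces: "card (Fp_subspaces p V i) = card (between K UNIV i)"
  unfolding Fp_subspaces_eq
  by (rule card_image, rule inj_on_subset[OF inj_on_image_lattices]) (auto simp: between_def)

lemma card_ideals_of_codim:
  assumes mult: "\<And>u v. f u \<otimes>\<^bsub>V\<^esub> f v = f (br u v)" and n: "idx K UNIV = p ^ n" and i: "i \<le> n"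
  shows "card (ideals_of_codim p V i)
    = card {I. lat I \<and> K \<subseteq> I \<and> (\<forall>u\<in>I. \<forall>v. br u v \<in> I \<and> br v u \<in> I) \<and> idx K I = p ^ (n - i)}"
    (is "_ = card ?S")
proof -
  have dimV: "vectorspace.dim (Fp p) V = n"
  proof -
    have "V\<lparr>carrier := f ` UNIV\<rparr> = V" using carrier_V by simp
    then show ?thesis using dim_eq_iff[OF lat_UNIV subset_UNIV, of n] n by simp
  qed
  have ideal: "lie_ideal p V (f ` I) \<longleftrightarrow> (\<forall>u\<in>I. \<forall>v. br u v \<in> I \<and> br v u \<in> I)" if "lat I" "K \<subseteq> I" for I
    using subspace_image[OF that] by (auto simp: lie_ideal_def carrier_V mult f_mem_image_iff[OF that])
  have "ideals_of_codim p V i = (`) f ` ?S"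
  proof (intro equalityI subsetI)
    fix W assume W: "W \<in> ideals_of_codim p V i"
    then have "VectorSpace.subspace (Fp p) W V" by (simp add: ideals_of_codim_def lie_ideal_def)
    note P = subspace_preimage[OF this]
    have "vectorspace.dim (Fp p) (V\<lparr>carrier := W\<rparr>) = n - i" "lie_ideal p V W"
      using W by (auto simp: ideals_of_codim_def dimV)
    moreover have "idx K (f -` W) = p ^ (n - i)"
      using dim_eq_iff[OF P(1,2), of "n - i"] calculation(1) unfolding P(3) by blast
    moreover have "\<forall>u\<in>f -` W. \<forall>v. br u v \<in> f -` W \<and> br v u \<in> f -` W"
      using ideal[OF P(1,2)] calculation(2) unfolding P(3) by blast
    ultimately have "f -` W \<in> ?S" using P(1,2) by blast
    then show "W \<in> (`) f ` ?S" by (rule image_eqI[where f = "(`) f", OF P(3)[symmetric]])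
  next
    fix W assume "W \<in> (`) f ` ?S"
    then obtain I where I: "W = f ` I" "I \<in> ?S" by (rule imageE)
    have L: "lat I" "K \<subseteq> I" and J: "\<forall>u\<in>I. \<forall>v. br u v \<in> I \<and> br v u \<in> I" "idx K I = p ^ (n - i)"
      using I(2) by simp_all
    have "vectorspace.dim (Fp p) (V\<lparr>carrier := f ` I\<rparr>) = n - i" using dim_eq_iff[OF L] J(2) by blast
    moreover have "lie_ideal p V (f ` I)" using ideal[OF L] J(1) by blast
    ultimately show "W \<in> ideals_of_codim p V i" unfolding ideals_of_codim_def I(1) mem_Collect_eq dimV using i by simp
  qed
  moreover have "inj_on ((`) f) ?S" by (rule inj_on_subset[OF inj_on_image_lattices]) auto
  ultimately show ?thesis by (simp add: card_image)
qed

end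

context finite_mod_p_lattices begin

text \<open>F_p^m is a quotient of the lattice itself by way of m integer coordinates that take
  arbitrary values, so its subspaces are covered by the count of intermediate lattices.\<close>

lemma gauss_binomial_eq_qbinomial:
  fixes C :: "nat \<Rightarrow> 'a \<Rightarrow> int"
  assumes add: "\<And>i u v. C i (u + v) = C i u + C i v" and scale: "\<And>i n u. C i (zmul n u) = n * C i u"
    and surj: "\<And>g. \<exists>u. \<forall>i<m. C i u = g i" and k: "k \<le> m"
  shows "gauss_binomial p m k = qbinomial m k"
proof -
  let ?K = "{u. \<forall>i<m. int p dvd C i u}"
  let ?f = "\<lambda>u. \<lambda>i\<in>{..<m}. C i u mod int p"
  have pos: "int p > 0" using p_gt_1 by simp
  have minus: "C i (- u) = - C i u" for i u using scale[of i "- 1" u] by simp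
  have diff: "C i (u - v) = C i u - C i v" for i u v using add[of i u "- v"] minus by simp
  have zero: "C i 0 = 0" for i using scale[of i 0 0] by simp
  have lat_K: "lat ?K" by (auto simp: lat_def add minus scale)
  have range: "range ?f = ({..<m} \<rightarrow>\<^sub>E {0..<int p})"
  proof (intro equalityI subsetI)
    fix g assume g: "g \<in> {..<m} \<rightarrow>\<^sub>E {0..<int p}"
    obtain u where u: "\<forall>i<m. C i u = g i" using surj by blast
    have "g = ?f u"
    proof
      fix i show "g i = ?f u i" using g u by (cases "i < m") (auto simp: PiE_def extensional_def Pi_def)
    qed
    then show "g \<in> range ?f" by blast
  next
    fix g assume "g \<in> range ?f"
    then obtain u where "g = ?f u" by blast
    then show "g \<in> {..<m} \<rightarrow>\<^sub>E {0..<int p}" using pos by (simp add: restrict_PiE_iff)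
  qed
  have eq: "?f u = ?f v \<longleftrightarrow> u - v \<in> ?K" for u v
  proof -
    have "?f u = ?f v \<longleftrightarrow> (\<forall>i<m. C i u mod int p = C i v mod int p)"
      by (auto simp: fun_eq_iff restrict_def)
    then show ?thesis by (simp add: mod_eq_dvd_iff diff)
  qed
  have Fp_carrier: "carrier (Fp p) = {0..<int p}" by (auto simp: residue_ring_def)
  interpret lattice_quotient zmul p "Fp_power p m" ?f ?K
  proof
    show "lat ?K" by (rule lat_K)
    show "carrier (Fp_power p m) = range ?f" unfolding range by (simp add: Fp_power_def Fp_carrier)
    show "?f u = ?f v \<longleftrightarrow> u - v \<in> ?K" for u v by (rule eq)
    show "?f u \<oplus>\<^bsub>Fp_power p m\<^esub> ?f v = ?f (u + v)" for u v
      by (auto simp: Fp_power_def residue_ring_def add mod_add_eq intro!: restrict_ext)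
    show "\<zero>\<^bsub>Fp_power p m\<^esub> = ?f 0"
      by (auto simp: Fp_power_def residue_ring_def zero intro!: restrict_ext)
    show "k \<odot>\<^bsub>Fp_power p m\<^esub> ?f u = ?f (zmul k u)" for k u
      by (auto simp: Fp_power_def residue_ring_def scale mod_mult_right_eq intro!: restrict_ext)
  qed
  have "idx ?K UNIV = p ^ m"
    using idx_eq_card[OF lat_K eq, of UNIV] unfolding range by (simp add: card_PiE)
  then show ?thesis
    unfolding gauss_binomial_def card_Fp_subspaces by (rule card_between[OF lat_K lat_UNIV subset_UNIV _ k])
qed

end

section \<open>Coordinates and brackets in the Lie ring\<close>

context L_np8 begin

declare One_nat_def [simp del]

abbreviation B :: "'a set" where "B \<equiv> {x 1, x 2, x 3, x 4, x 5, y 1, y 2, y 3}"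

text \<open>Cut off outside 1..5 so that the coordinates of a bracket vanish for every index, as the
  locale \<open>np8_mod\<close> demands.\<close>

definition cx :: "nat \<Rightarrow> 'a \<Rightarrow> int" where "cx i u = (if i \<in> {1..5} then representation B u (x i) else 0)"
definition cy :: "nat \<Rightarrow> 'a \<Rightarrow> int" where "cy i u = representation B u (y i)"

definition mk :: "int \<Rightarrow> int \<Rightarrow> int \<Rightarrow> int \<Rightarrow> int \<Rightarrow> int \<Rightarrow> int \<Rightarrow> int \<Rightarrow> 'a" where
  "mk a1 a2 a3 a4 a5 b1 b2 b3 = zmul a1 (x 1) + zmul a2 (x 2) + zmul a3 (x 3) + zmul a4 (x 4) + zmul a5 (x 5)
     + zmul b1 (y 1) + zmul b2 (y 2) + zmul b3 (y 3)"

lemma in_span: "u \<in> span B" using basis_span by simp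

lemma rep_add: "representation B (u + v) b = representation B u b + representation B v b"
  using representation_add[OF basis_independent in_span in_span, of u v] by simp

lemma rep_scale: "representation B (zmul n u) b = n * representation B u b"
  using representation_scale[OF basis_independent in_span, of n u] by simp

lemma coord_add: "cx i (u + v) = cx i u + cx i v" "cy i (u + v) = cy i u + cy i v"
  by (simp_all add: cx_def cy_def rep_add)

lemma coord_scale: "cx i (zmul n u) = n * cx i u" "cy i (zmul n u) = n * cy i u"
  by (simp_all add: cx_def cy_def rep_scale)

lemma rep_basis: "b \<in> B \<Longrightarrow> representation B b c = (if c = b then 1 else 0)"
  using representation_basis[OF basis_independent] by simp

lemma basis_coordinates:
  "i \<in> {1..5} \<Longrightarrow> j \<in> {1..5} \<Longrightarrow> cx i (x j) = (if i = j then 1 else 0)"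
  "i \<in> {1..5} \<Longrightarrow> j \<in> {1..3} \<Longrightarrow> cx i (y j) = 0"
  "i \<in> {1..3} \<Longrightarrow> j \<in> {1..5} \<Longrightarrow> cy i (x j) = 0"
  "i \<in> {1..3} \<Longrightarrow> j \<in> {1..3} \<Longrightarrow> cy i (y j) = (if i = j then 1 else 0)"
proof -
  have 5: "i \<in> {1, 2, 3, 4, 5}" if "i \<in> {1..5}" for i :: nat using that by auto
  have 3: "i \<in> {1, 2, 3}" if "i \<in> {1..3}" for i :: nat using that by auto
  have x: "x i \<in> B" if "i \<in> {1..5}" for i using 5[OF that] by auto
  have y: "y i \<in> B" if "i \<in> {1..3}" for i using 3[OF that] by auto
  have xx: "x i = x j \<longleftrightarrow> i = j" if "i \<in> {1..5}" "j \<in> {1..5}" for i j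
    using 5[OF that(1)] 5[OF that(2)] basis_distinct by auto
  have yy: "y i = y j \<longleftrightarrow> i = j" if "i \<in> {1..3}" "j \<in> {1..3}" for i j
    using 3[OF that(1)] 3[OF that(2)] basis_distinct by auto
  have xy: "x i \<noteq> y j" if "i \<in> {1..5}" "j \<in> {1..3}" for i j
    using 5[OF that(1)] 3[OF that(2)] basis_distinct by auto
  show "cx i (x j) = (if i = j then 1 else 0)" if "i \<in> {1..5}" "j \<in> {1..5}"
    using that by (simp add: cx_def rep_basis[OF x] xx)
  show "cx i (y j) = 0" if "i \<in> {1..5}" "j \<in> {1..3}"
    using that by (simp add: cx_def rep_basis[OF y] xy)
  show "cy i (x j) = 0" if "i \<in> {1..3}" "j \<in> {1..5}"
    using xy[OF that(2,1)] by (simp add: cy_def rep_basis[OF x[OF that(2)]])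
  show "cy i (y j) = (if i = j then 1 else 0)" if "i \<in> {1..3}" "j \<in> {1..3}"
    using that by (simp add: cy_def rep_basis[OF y] yy)
qed

lemma expand: "u = mk (cx 1 u) (cx 2 u) (cx 3 u) (cx 4 u) (cx 5 u) (cy 1 u) (cy 2 u) (cy 3 u)"
proof -
  have "u = (\<Sum>b\<in>B. zmul (representation B u b) b)"
    using sum_representation_eq[OF basis_independent in_span _ subset_refl, of u] by simp
  then show ?thesis
    unfolding mk_def cx_def cy_def using basis_distinct by (simp add: add_ac)
qed

lemma cx_mk: "cx 1 (mk a1 a2 a3 a4 a5 b1 b2 b3) = a1" "cx 2 (mk a1 a2 a3 a4 a5 b1 b2 b3) = a2"
    "cx 3 (mk a1 a2 a3 a4 a5 b1 b2 b3) = a3" "cx 4 (mk a1 a2 a3 a4 a5 b1 b2 b3) = a4"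
    "cx 5 (mk a1 a2 a3 a4 a5 b1 b2 b3) = a5"
  by (simp_all add: mk_def coord_add coord_scale basis_coordinates)

lemma cy_mk: "cy 1 (mk a1 a2 a3 a4 a5 b1 b2 b3) = b1" "cy 2 (mk a1 a2 a3 a4 a5 b1 b2 b3) = b2"
    "cy 3 (mk a1 a2 a3 a4 a5 b1 b2 b3) = b3"
  by (simp_all add: mk_def coord_add coord_scale basis_coordinates)

text \<open>The bracket is assumed biadditive only; its homogeneity over the integers is derived
  from this.\<close>

lemma additive_scale:
  assumes add: "\<And>u v. h (u + v) = h u + (h v :: 'a)" shows "h (zmul n u) = zmul n (h u)"
proof -
  have 0: "h 0 = 0" using add[of 0 0] by simp
  have minus: "h (- v) = - h v" for v using add[of v "- v"] 0 by (simp add: eq_neg_iff_add_eq_0 add.commute)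
  have nat: "h (zmul (int k) u) = zmul (int k) (h u)" for k
    by (induction k) (simp_all add: 0 add scale_left_distrib)
  show ?thesis
  proof (cases "n \<ge> 0")
    case True
    then show ?thesis using nat[of "nat n"] by simp
  next
    case False
    then have "n = - int (nat (- n))" by simp
    then show ?thesis using nat[of "nat (- n)"] minus by (metis scale_minus_left)
  qed
qed

lemma br_scale: "br (zmul n u) v = zmul n (br u v)" "br u (zmul n v) = zmul n (br u v)"
  using additive_scale[of "\<lambda>u. br u v"] additive_scale[of "br u"] by (simp_all add: br_add_left br_add_right)

lemma br_swap: "br v u = - br u v"
proof -
  have "br (u + v) (u + v) = br u v + br v u"
    unfolding br_add_left br_add_right by (simp add: br_self)
  then have "br v u + br u v = 0" by (simp add: br_self add.commute)
  then show ?thesis by (simp only: eq_neg_iff_add_eq_0)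
qed

text \<open>The presentation gives this relation only after doubling. L is torsion-free: an element
  whose double is 0 has zero coordinates.\<close>

lemma br_x1_x5: "br (x 1) (x 5) = y 2"
proof -
  have "zmul 2 (br (x 1) (x 5) - y 2) = 0" using rel2 by (simp add: scale_right_diff_distrib)
  moreover have "z = 0" if "zmul 2 z = 0" for z
  proof -
    have z: "2 * cx i z = 0" "2 * cy i z = 0" for i
      using that coord_scale(1)[of i 2 z] coord_scale(2)[of i 2 z] coord_scale(1)[of i 0 0] coord_scale(2)[of i 0 0]
      by simp_all
    have "z = mk 0 0 0 0 0 0 0 0" using expand[of z] z by simp
    then show ?thesis by (simp add: mk_def)
  qed
  ultimately show ?thesis by (metis eq_iff_diff_eq_0)
qed

lemma br_basis_xx:
  "br (x 1) (x 2) = 0" "br (x 1) (x 3) = 0" "br (x 2) (x 3) = 0" "br (x 4) (x 5) = 0"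
  "br (x 1) (x 4) = y 1" "br (x 2) (x 5) = y 1" "br (x 1) (x 5) = y 2" "br (x 3) (x 4) = zmul 2 (y 2)"
  "br (x 2) (x 4) = y 3" "br (x 3) (x 5) = y 3"
  using xx_zero[of 1 2] xx_zero[of 1 3] xx_zero[of 2 3] xx_zero[of 4 5] rel1 rel2 rel3 br_x1_x5 by simp_all

lemma br_mk:
  "br (mk a1 a2 a3 a4 a5 b1 b2 b3) (mk c1 c2 c3 c4 c5 d1 d2 d3)
    = mk 0 0 0 0 0 (a1 * c4 - a4 * c1 + a2 * c5 - a5 * c2) (a1 * c5 - a5 * c1 + 2 * (a3 * c4 - a4 * c3))
        (a2 * c4 - a4 * c2 + a3 * c5 - a5 * c3)"
proof -
  note xx = br_basis_xx br_basis_xx[THEN br_swap[THEN trans, OF arg_cong[where f = uminus]]]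
  have xy: "br (x i) (y j) = 0" "br (y j) (x i) = 0" if "i \<in> {1..5}" "j \<in> {1..3}" for i j
    using xy_zero[OF that] br_swap[of "y j" "x i"] by simp_all
  have yy: "br (y i) (y j) = 0" if "i \<in> {1..3}" "j \<in> {1..3}" for i j
    using yy_zero[OF that] .
  show ?thesis
    unfolding mk_def br_add_left br_add_right br_scale
    by (simp add: xx xy yy br_self)
      (simp add: scale_left_distrib scale_left_diff_distrib scale_right_distrib algebra_simps)
qed

lemma coord_br:
  "cx i (br u v) = 0"
  "cy 1 (br u v) = cx 1 u * cx 4 v - cx 4 u * cx 1 v + cx 2 u * cx 5 v - cx 5 u * cx 2 v"
  "cy 2 (br u v) = cx 1 u * cx 5 v - cx 5 u * cx 1 v + 2 * (cx 3 u * cx 4 v - cx 4 u * cx 3 v)"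
  "cy 3 (br u v) = cx 2 u * cx 4 v - cx 4 u * cx 2 v + cx 3 u * cx 5 v - cx 5 u * cx 3 v"
proof -
  have 5: "i \<in> {1, 2, 3, 4, 5}" if "i \<in> {1..5}" for i :: nat using that by auto
  let ?w = "mk 0 0 0 0 0 (cx 1 u * cx 4 v - cx 4 u * cx 1 v + cx 2 u * cx 5 v - cx 5 u * cx 2 v)
    (cx 1 u * cx 5 v - cx 5 u * cx 1 v + 2 * (cx 3 u * cx 4 v - cx 4 u * cx 3 v))
    (cx 2 u * cx 4 v - cx 4 u * cx 2 v + cx 3 u * cx 5 v - cx 5 u * cx 3 v)"
  have w: "br u v = ?w"
    using br_mk[of "cx 1 u" "cx 2 u" "cx 3 u" "cx 4 u" "cx 5 u" "cy 1 u" "cy 2 u" "cy 3 u"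
      "cx 1 v" "cx 2 v" "cx 3 v" "cx 4 v" "cx 5 v" "cy 1 v" "cy 2 v" "cy 3 v"]
    by (simp only: expand[symmetric])
  show "cx i (br u v) = 0"
  proof (cases "i \<in> {1..5}")
    case True
    then show ?thesis using 5[OF True] by (elim insertE emptyE) (simp_all only: w cx_mk)
  next
    case False
    then show ?thesis unfolding cx_def by (rule if_not_P)
  qed
  show "cy 1 (br u v) = cx 1 u * cx 4 v - cx 4 u * cx 1 v + cx 2 u * cx 5 v - cx 5 u * cx 2 v"
    "cy 2 (br u v) = cx 1 u * cx 5 v - cx 5 u * cx 1 v + 2 * (cx 3 u * cx 4 v - cx 4 u * cx 3 v)"
    "cy 3 (br u v) = cx 2 u * cx 4 v - cx 4 u * cx 2 v + cx 3 u * cx 5 v - cx 5 u * cx 3 v"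
    by (simp_all only: w cy_mk)
qed

lemma np8_mod: assumes "prime p" shows "np8_mod zmul p cx cy br mk"
proof -
  interpret mod_p_lattices zmul p by unfold_locales (rule assms)
  have PL_iff: "u \<in> PL \<longleftrightarrow> int p dvd cx 1 u \<and> int p dvd cx 2 u \<and> int p dvd cx 3 u \<and> int p dvd cx 4 u \<and> int p dvd cx 5 u
      \<and> int p dvd cy 1 u \<and> int p dvd cy 2 u \<and> int p dvd cy 3 u" (is "_ \<longleftrightarrow> ?R") for u
  proof
    assume "u \<in> PL"
    then show ?R by (auto simp: PL_def coord_scale)
  next
    assume ?R
    then obtain a1 a2 a3 a4 a5 b1 b2 b3 where "cx 1 u = int p * a1" "cx 2 u = int p * a2" "cx 3 u = int p * a3"
      "cx 4 u = int p * a4" "cx 5 u = int p * a5" "cy 1 u = int p * b1" "cy 2 u = int p * b2" "cy 3 u = int p * b3"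
      unfolding dvd_def by blast
    then have "u = zmul (int p) (mk a1 a2 a3 a4 a5 b1 b2 b3)"
      using expand[of u] by (simp add: mk_def scale_right_distrib)
    then show "u \<in> PL" unfolding PL_def by blast
  qed
  have minus: "cx i (u - v) = cx i u - cx i v" "cy i (u - v) = cy i u - cy i v" for i u v
    using coord_add[of i u "- v"] coord_scale[of i "- 1" v] by simp_all
  have "finite (coset PL ` UNIV)"
  proof (rule finite_surj)
    let ?R = "{0..<int p}"
    let ?g = "\<lambda>(a1, a2, a3, a4, a5, b1, b2, b3). coset PL (mk a1 a2 a3 a4 a5 b1 b2 b3)"
    show "finite (?R \<times> ?R \<times> ?R \<times> ?R \<times> ?R \<times> ?R \<times> ?R \<times> ?R)" by simp
    show "coset PL ` UNIV \<subseteq> ?g ` (?R \<times> ?R \<times> ?R \<times> ?R \<times> ?R \<times> ?R \<times> ?R \<times> ?R)"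
    proof
      fix C assume "C \<in> coset PL ` UNIV"
      then obtain u where u: "C = coset PL u" by blast
      let ?t = "(cx 1 u mod int p, cx 2 u mod int p, cx 3 u mod int p, cx 4 u mod int p, cx 5 u mod int p,
        cy 1 u mod int p, cy 2 u mod int p, cy 3 u mod int p)"
      have d: "int p dvd a - a mod int p" for a by simp
      have "C = ?g ?t"
        unfolding u prod.case coset_eq_iff[OF lat_PL] PL_iff minus cx_mk cy_mk using d by blast
      moreover have "?t \<in> ?R \<times> ?R \<times> ?R \<times> ?R \<times> ?R \<times> ?R \<times> ?R \<times> ?R" using p_gt_1 by simp
      ultimately show "C \<in> ?g ` (?R \<times> ?R \<times> ?R \<times> ?R \<times> ?R \<times> ?R \<times> ?R \<times> ?R)" by (rule image_eqI)
    qed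
  qed
  then show ?thesis
    by unfold_locales (simp_all only: coord_add coord_scale cx_mk cy_mk PL_iff coord_br)
qed

end

section \<open>The ideal zeta function\<close>

lemma num_roots_eq: "num_roots p = card {r \<in> {0..<int p}. [r ^ 3 = 2] (mod int p)}"
proof -
  have "{r \<in> carrier (Fp p). [r ^ 3 - 2 = 0] (mod int p)} = {r \<in> {0..<int p}. [r ^ 3 = 2] (mod int p)}"
    by (auto simp: residue_ring_def cong_iff_dvd_diff)
  then show ?thesis unfolding num_roots_def by (rule arg_cong)
qed

text \<open>The operations of \<open>lie_mod\<close> are unions over representatives; independence
  of the representatives makes such a union collapse to one coset.\<close>

lemma UN_eq_const: "\<lbrakk>a \<in> A; \<And>u. u \<in> A \<Longrightarrow> g u = C\<rbrakk> \<Longrightarrow> (\<Union>u\<in>A. g u) = C"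
  by auto

lemma poly_eq_if_eq_at_infinitely_many_nats:
  fixes f g :: "complex poly"
  assumes "infinite A" "\<And>n. n \<in> A \<Longrightarrow> poly f (of_nat n) = poly g (of_nat n)"
  shows "f = g"
proof (rule ccontr)
  assume "f \<noteq> g"
  then have "finite {z. poly (f - g) z = 0}" by (intro poly_roots_finite) simp
  moreover have "of_nat ` A \<subseteq> {z. poly (f - g) z = 0}" using assms(2) by auto
  ultimately have "finite (of_nat ` A :: complex set)" by (rule rev_finite_subset)
  then show False using assms(1) finite_imageD[of of_nat A] by (auto simp: inj_on_def)
qed

text \<open>As \<open>s\<close> varies, \<open>p powr (- s)\<close> takes infinitely many values, so that coefficients in
  \<open>t\<close> can be compared.\<close>

lemma coeff_of_zeta:
  fixes zmul :: "int \<Rightarrow> 'a::ab_group_add \<Rightarrow> 'a"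
  assumes p: "prime p" and W: "\<And>s. ideal_zeta zmul br n p s = eval2 W (of_nat p) (of_nat p powr (- s))" and i: "i \<le> n"
  shows "poly (map_poly of_rat (Polynomial.coeff W i)) (of_nat p) = (of_nat (card (ideals_of_codim p (lie_mod zmul br p) i)) :: complex)"
proof -
  let ?h = "\<lambda>c. poly (map_poly of_rat c) (of_nat p) :: complex"
  let ?c = "\<lambda>i. of_nat (card (ideals_of_codim p (lie_mod zmul br p) i)) :: complex"
  define Q where "Q = (\<Sum>i\<le>n. Polynomial.monom (?c i) i)"
  have "map_poly ?h W = Q"
  proof (rule poly_eq_if_eq_at_infinitely_many_nats)
    show "infinite (range (\<lambda>k. p ^ k))"
      using p prime_gt_1_nat by (intro range_inj_infinite) (simp add: inj_on_def)
    fix m assume "m \<in> range (\<lambda>k. p ^ k)"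
    then obtain k where k: "m = p ^ k" by blast
    \<comment> \<open>At s = -k the variable t takes the natural value p^k.\<close>
    have "(of_nat p :: complex) powr (- (- of_nat k)) = of_nat m"
      using p prime_gt_0_nat[OF p] by (simp add: k powr_nat)
    then show "poly (map_poly ?h W) (of_nat m) = poly Q (of_nat m)"
      using W[of "- of_nat k"] by (simp add: eval2_def ideal_zeta_def Q_def poly_sum poly_monom)
  qed
  then have "Polynomial.coeff (map_poly ?h W) i = Polynomial.coeff Q i" by (rule arg_cong)
  then show ?thesis using i by (simp add: coeff_map_poly Q_def coeff_sum)
qed

section \<open>Ideals of L/pL, the zeta function and failure of PORC\<close>

context L_np8 begin

lemma pcoset_eq_coset: assumes "prime p" shows "pcoset zmul p = mod_p_lattices.coset (mod_p_lattices.PL zmul p)"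
proof -
  interpret mod_p_lattices zmul p by unfold_locales (rule assms)
  show ?thesis by (rule ext) (auto simp: pcoset_def coset_def PL_def)
qed

lemma lattice_quotient_lie_mod:
  assumes "prime p"
  shows "lattice_quotient zmul p (lie_mod zmul br p) (pcoset zmul p) (mod_p_lattices.PL zmul p)"
    and "pcoset zmul p u \<otimes>\<^bsub>lie_mod zmul br p\<^esub> pcoset zmul p v = pcoset zmul p (br u v)"
proof -
  interpret np8_mod zmul p cx cy br mk by (rule np8_mod[OF assms])
  note pc = pcoset_eq_coset[OF assms]
  have mem: "v \<in> pcoset zmul p u \<longleftrightarrow> v - u \<in> PL" for u v by (simp add: pc mem_coset)
  have self: "u \<in> pcoset zmul p u" for u by (simp add: mem lat_0[OF lat_PL])
  have eq: "pcoset zmul p u = pcoset zmul p v \<longleftrightarrow> u - v \<in> PL" for u v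
    by (simp add: pc coset_eq_iff[OF lat_PL])
  show "lattice_quotient zmul p (lie_mod zmul br p) (pcoset zmul p) PL"
  proof
    show "lat PL" by (rule lat_PL)
    show "carrier (lie_mod zmul br p) = range (pcoset zmul p)" by (simp add: lie_mod_def)
    show "pcoset zmul p u = pcoset zmul p v \<longleftrightarrow> u - v \<in> PL" for u v by (rule eq)
    show "\<zero>\<^bsub>lie_mod zmul br p\<^esub> = pcoset zmul p 0" by (simp add: lie_mod_def)
    show "pcoset zmul p u \<oplus>\<^bsub>lie_mod zmul br p\<^esub> pcoset zmul p v = pcoset zmul p (u + v)" for u v
    proof -
      have *: "pcoset zmul p (u' + v') = pcoset zmul p (u + v)" if "u' \<in> pcoset zmul p u" "v' \<in> pcoset zmul p v" for u' v'
        using lat_add[OF lat_PL, of "u' - u" "v' - v"] that by (simp add: mem eq algebra_simps)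
      have "(\<Union>u'\<in>pcoset zmul p u. \<Union>v'\<in>pcoset zmul p v. pcoset zmul p (u' + v')) = pcoset zmul p (u + v)"
        by (intro UN_eq_const[OF self] *)
      then show ?thesis by (simp add: lie_mod_def)
    qed
    show "k \<odot>\<^bsub>lie_mod zmul br p\<^esub> pcoset zmul p u = pcoset zmul p (zmul k u)" for k u
    proof -
      have *: "pcoset zmul p (zmul k u') = pcoset zmul p (zmul k u)" if "u' \<in> pcoset zmul p u" for u'
        using lat_scale[OF lat_PL, of "u' - u" k] that by (simp add: mem eq scale_right_diff_distrib)
      have "(\<Union>u'\<in>pcoset zmul p u. pcoset zmul p (zmul k u')) = pcoset zmul p (zmul k u)"
        by (intro UN_eq_const[OF self] *)
      then show ?thesis by (simp add: lie_mod_def)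
    qed
  qed
  have *: "pcoset zmul p (br u' v') = pcoset zmul p (br u v)" if uv: "u' \<in> pcoset zmul p u" "v' \<in> pcoset zmul p v" for u' v'
  proof -
    obtain a b where ab: "u' = u + zmul (int p) a" "v' = v + zmul (int p) b"
      using uv by (auto simp: pcoset_def)
    have "br u' v' - br u v = zmul (int p) (br a v + br u b + zmul (int p) (br a b))"
      unfolding ab br_add_left br_add_right br_scale by (simp add: scale_right_distrib)
    then show ?thesis unfolding eq PL_def by blast
  qed
  have "(\<Union>u'\<in>pcoset zmul p u. \<Union>v'\<in>pcoset zmul p v. pcoset zmul p (br u' v')) = pcoset zmul p (br u v)"
    by (intro UN_eq_const[OF self] *)
  then show "pcoset zmul p u \<otimes>\<^bsub>lie_mod zmul br p\<^esub> pcoset zmul p v = pcoset zmul p (br u v)"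
    by (simp add: lie_mod_def)
qed

lemma card_ideals_of_codim_lie_mod:
  fixes p defines "N \<equiv> num_roots p" and "b \<equiv> 1 + p + p ^ 2"
  assumes p: "prime p"
  shows "card (ideals_of_codim p (lie_mod zmul br p) 0) = gauss_binomial p 5 0"
    "card (ideals_of_codim p (lie_mod zmul br p) 1) = gauss_binomial p 5 1"
    "card (ideals_of_codim p (lie_mod zmul br p) 2) = gauss_binomial p 5 2"
    "card (ideals_of_codim p (lie_mod zmul br p) 3) = gauss_binomial p 5 3 + p ^ 3 * N"
    "card (ideals_of_codim p (lie_mod zmul br p) 4) = gauss_binomial p 5 4 + p ^ 2 * b * N"
    "card (ideals_of_codim p (lie_mod zmul br p) 5) = gauss_binomial p 5 5 + (p + p ^ 2 * (1 + N) + p ^ 3 * (1 + N))"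
    "card (ideals_of_codim p (lie_mod zmul br p) 6) = 1 + p + p ^ 2 * (1 + N)"
    "card (ideals_of_codim p (lie_mod zmul br p) 7) = b"
    "card (ideals_of_codim p (lie_mod zmul br p) 8) = 1"
    "gauss_binomial p 3 1 = b"
proof -
  interpret np8_mod zmul p cx cy br mk by (rule np8_mod[OF p])
  interpret Q: lattice_quotient zmul p "lie_mod zmul br p" "pcoset zmul p" PL
    by (rule lattice_quotient_lie_mod[OF p])
  have "idx PL UNIV = idx PL Zt * idx Zt UNIV" by (intro idx_mult lat_PL lat_Zt PL_Zt lat_UNIV subset_UNIV)
  then have "idx PL UNIV = p ^ 8" unfolding idx_PL_Zt idx_Zt_UNIV by (simp add: power_add[symmetric])
  note card = Q.card_ideals_of_codim[OF lattice_quotient_lie_mod(2)[OF p] this]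
  have "{I. lat I \<and> PL \<subseteq> I \<and> (\<forall>u\<in>I. \<forall>v. br u v \<in> I \<and> br v u \<in> I) \<and> idx PL I = p ^ d} = ideals d" for d
  proof -
    have "br v u \<in> I \<longleftrightarrow> br u v \<in> I" if "lat I" for u v I
      unfolding br_swap[where v = v and u = u]
      using lat_uminus[OF that, of "br u v"] lat_uminus[OF that, of "- br u v"] by auto
    then show ?thesis unfolding ideals_def comm_in_def using PL_least by blast
  qed
  note codim = card[unfolded this]
  have cx: "gauss_binomial p 5 k = qbinomial 5 k" if "k \<le> 5" for k
  \<comment> \<open>Row vectors are indexed from 0, the basis elements from 1.\<close>
  proof (rule gauss_binomial_eq_qbinomial[where C = "\<lambda>i. cx (Suc i)", OF _ _ _ that])
    fix g :: "nat \<Rightarrow> int"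
    have "cx (Suc i) (mk (g 0) (g 1) (g 2) (g 3) (g 4) 0 0 0) = g i" if "i < 5" for i
    proof -
      have "i \<in> {0, 1, 2, 3, 4}" using that by auto
      moreover have "Suc 0 = 1" "Suc 1 = 2" "Suc 2 = 3" "Suc 3 = 4" "Suc 4 = 5" by simp_all
      ultimately show ?thesis by (elim insertE emptyE) (simp_all only: cx_mk)
    qed
    then show "\<exists>u. \<forall>i<5. cx (Suc i) u = g i" by blast
  qed simp_all
  have cy: "gauss_binomial p 3 k = qbinomial 3 k" if "k \<le> 3" for k
  proof (rule gauss_binomial_eq_qbinomial[where C = "\<lambda>i. cy (Suc i)", OF _ _ _ that])
    fix g :: "nat \<Rightarrow> int"
    have "cy (Suc i) (mk 0 0 0 0 0 (g 0) (g 1) (g 2)) = g i" if "i < 3" for i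
    proof -
      have "i \<in> {0, 1, 2}" using that by auto
      moreover have "Suc 0 = 1" "Suc 1 = 2" "Suc 2 = 3" by simp_all
      ultimately show ?thesis by (elim insertE emptyE) (simp_all only: cy_mk)
    qed
    then show "\<exists>u. \<forall>i<3. cy (Suc i) u = g i" by blast
  qed simp_all
  have N: "card {r \<in> {0..<int p}. [r ^ 3 = 2] (mod int p)} = N" by (simp only: N_def num_roots_eq)
  have ar: "(8::nat) - 0 = 8" "(8::nat) - 1 = 7" "(8::nat) - 2 = 6" "(8::nat) - 3 = 5" "(8::nat) - 4 = 4"
    "(8::nat) - 5 = 3" "(8::nat) - 6 = 2" "(8::nat) - 7 = 1" "(8::nat) - 8 = 0" by simp_all
  have cod: "card (ideals_of_codim p (lie_mod zmul br p) i) = card (ideals (8 - i))" if "i \<le> 8" for i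
    using codim[OF that] .
  have cx': "gauss_binomial p 5 0 = 1" "gauss_binomial p 5 1 = qbinomial 5 1" "gauss_binomial p 5 2 = qbinomial 5 2"
    "gauss_binomial p 5 3 = qbinomial 5 3" "gauss_binomial p 5 4 = qbinomial 5 4" "gauss_binomial p 5 5 = 1"
    using cx[of 0] cx[of 1] cx[of 2] cx[of 3] cx[of 4] cx[of 5] by (simp_all add: qbinomial_0 qbinomial_self)
  note c = cod[of 0, unfolded ar] cod[of 1, unfolded ar] cod[of 2, unfolded ar] cod[of 3, unfolded ar]
    cod[of 4, unfolded ar] cod[of 5, unfolded ar] cod[of 6, unfolded ar] cod[of 7, unfolded ar] cod[of 8, unfolded ar]
  note I = card_ideals_codim[unfolded N]
  show "card (ideals_of_codim p (lie_mod zmul br p) 0) = gauss_binomial p 5 0" using c(1) I(1) cx' by simp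
  show "card (ideals_of_codim p (lie_mod zmul br p) 1) = gauss_binomial p 5 1" using c(2) I(2) cx'(2) by linarith
  show "card (ideals_of_codim p (lie_mod zmul br p) 2) = gauss_binomial p 5 2" using c(3) I(3) cx'(3) by linarith
  show "card (ideals_of_codim p (lie_mod zmul br p) 3) = gauss_binomial p 5 3 + p ^ 3 * N" using c(4) I(4) cx'(4) by linarith
  show "card (ideals_of_codim p (lie_mod zmul br p) 4) = gauss_binomial p 5 4 + p ^ 2 * b * N"
    unfolding b_def using c(5) I(5) cx'(5) by linarith
  show "card (ideals_of_codim p (lie_mod zmul br p) 5) = gauss_binomial p 5 5 + (p + p ^ 2 * (1 + N) + p ^ 3 * (1 + N))"
    using c(6) I(6) cx'(6) by linarith
  show "card (ideals_of_codim p (lie_mod zmul br p) 6) = 1 + p + p ^ 2 * (1 + N)" using c(7) I(7) by linarith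
  show "card (ideals_of_codim p (lie_mod zmul br p) 7) = b" unfolding b_def using c(8) I(8) by linarith
  show "card (ideals_of_codim p (lie_mod zmul br p) 8) = 1" using c(9) I(9) by simp
  show "gauss_binomial p 3 1 = b" unfolding b_def using cy[of 1] qbinomial_3(1) by linarith
qed

lemma ideal_zeta_formula:
  assumes p: "prime p"
  shows "let q = (of_nat p :: complex);
             t = q powr (- s);
             N = (of_nat (num_roots p) :: complex);
             b = (of_nat (gauss_binomial p 3 1) :: complex)
         in ideal_zeta zmul br 8 p s =
              zeta_Fp_power p 5 s + q ^ 3 * N * t ^ 3 + q ^ 2 * b * N * t ^ 4
              + (q + q ^ 2 * (1 + N) + q ^ 3 * (1 + N)) * t ^ 5
              + (1 + q + q ^ 2 * (1 + N)) * t ^ 6 + b * t ^ 7 + t ^ 8"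
proof -
  have s5: "(\<Sum>i\<le>5. g i) = g 0 + g 1 + g 2 + g 3 + g 4 + g 5" for g :: "nat \<Rightarrow> complex"
    by (simp add: eval_nat_numeral One_nat_def)
  have s8: "(\<Sum>i\<le>8. g i) = g 0 + g 1 + g 2 + g 3 + g 4 + g 5 + g 6 + g 7 + g 8" for g :: "nat \<Rightarrow> complex"
    by (simp add: eval_nat_numeral One_nat_def)
  have regroup: "g0 * t0 + g1 * t1 + g2 * t2 + (g3 + c3) * t3 + (g4 + c4) * t4 + (g5 + c5) * t5 + c6 * t6 + c7 * t7 + 1 * t8
    = g0 * t0 + g1 * t1 + g2 * t2 + g3 * t3 + g4 * t4 + g5 * t5 + c3 * t3 + c4 * t4 + c5 * t5 + c6 * t6 + c7 * t7 + t8"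
    for g0 g1 g2 g3 g4 g5 c3 c4 c5 c6 c7 t0 t1 t2 t3 t4 t5 t6 t7 t8 :: complex
    by (simp add: algebra_simps)
  define q where "q = (of_nat p :: complex)"
  define t where "t = q powr (- s)"
  define N where "N = (of_nat (num_roots p) :: complex)"
  define b where "b = (of_nat (gauss_binomial p 3 1) :: complex)"
  define g where "g k = (of_nat (gauss_binomial p 5 k) :: complex)" for k
  have bp: "1 + p + p ^ 2 = gauss_binomial p 3 1" by (rule card_ideals_of_codim_lie_mod(10)[OF p, symmetric])
  have z: "zeta_Fp_power p 5 s = g 0 * t ^ 0 + g 1 * t ^ 1 + g 2 * t ^ 2 + g 3 * t ^ 3 + g 4 * t ^ 4 + g 5 * t ^ 5"
    unfolding zeta_Fp_power_def s5 t_def q_def g_def ..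
  have "ideal_zeta zmul br 8 p s = g 0 * t ^ 0 + g 1 * t ^ 1 + g 2 * t ^ 2 + (g 3 + q ^ 3 * N) * t ^ 3
    + (g 4 + q ^ 2 * b * N) * t ^ 4 + (g 5 + (q + q ^ 2 * (1 + N) + q ^ 3 * (1 + N))) * t ^ 5
    + (1 + q + q ^ 2 * (1 + N)) * t ^ 6 + b * t ^ 7 + 1 * t ^ 8"
    unfolding ideal_zeta_def s8 card_ideals_of_codim_lie_mod(1-9)[OF p] bp
    unfolding t_def q_def g_def N_def b_def
    by (simp only: of_nat_add of_nat_mult of_nat_power of_nat_1)
  also note regroup
  finally have "ideal_zeta zmul br 8 p s =
              zeta_Fp_power p 5 s + q ^ 3 * N * t ^ 3 + q ^ 2 * b * N * t ^ 4
              + (q + q ^ 2 * (1 + N) + q ^ 3 * (1 + N)) * t ^ 5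
              + (1 + q + q ^ 2 * (1 + N)) * t ^ 6 + b * t ^ 7 + t ^ 8"
    unfolding z .
  then show ?thesis unfolding Let_def q_def t_def N_def b_def .
qed

text \<open>The polynomial giving the coefficient of t^6 in the class 1 would agree at infinitely
  many primes with 1 + X + 4 X^2 and at infinitely many others with 1 + X + X^2.\<close>

lemma not_PORC: "\<not> PORC (ideal_zeta zmul br 8)"
proof
  assume "PORC (ideal_zeta zmul br 8)"
  then obtain M and W :: "nat \<Rightarrow> rat poly poly" where M: "M \<ge> 2" and
    fin: "finite {p. prime p \<and> \<not> (\<forall>i\<in>{1..M-1}. [p = i] (mod M) \<longrightarrow>
       (\<forall>s. ideal_zeta zmul br 8 p s = eval2 (W i) (of_nat p) (of_nat p powr (- s))))}" (is "finite ?E")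
    unfolding PORC_def by blast
  define w :: "complex poly" where "w = map_poly of_rat (Polynomial.coeff (W 1) 6)"
  have w: "w = [:1, 1, 1 + of_nat N:]"
    if many: "\<And>n. \<exists>p>n. prime p \<and> [p = 1] (mod M) \<and> num_roots p = N" for N
  proof (rule poly_eq_if_eq_at_infinitely_many_nats)
    let ?A = "{p. prime p \<and> [p = 1] (mod M) \<and> num_roots p = N}"
    have "infinite ?A" unfolding infinite_nat_iff_unbounded using many by blast
    then show "infinite (?A - ?E)" using fin by (rule Diff_infinite_finite[rotated])
    fix p assume p: "p \<in> ?A - ?E"
    \<comment> \<open>M >= 2 puts the class 1 into the range 1, ..., M - 1.\<close>
    then have "ideal_zeta zmul br 8 p s = eval2 (W 1) (of_nat p) (of_nat p powr (- s))" for s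
      using M by auto
    then have "poly w (of_nat p) = of_nat (card (ideals_of_codim p (lie_mod zmul br p) 6))"
      unfolding w_def using p by (intro coeff_of_zeta) auto
    also have "card (ideals_of_codim p (lie_mod zmul br p) 6) = 1 + p + p ^ 2 * (1 + N)"
      using card_ideals_of_codim_lie_mod(7)[of p] p by auto
    finally show "poly w (of_nat p) = poly [:1, 1, 1 + of_nat N:] (of_nat p)"
      by (simp add: power2_eq_square algebra_simps)
  qed
  have M0: "M > 0" using M by simp
  have "w = [:1, 1, 1 + of_nat 3:]"
    by (rule w) (use infinitely_many_primes_with_cube_roots_2[OF M0] in \<open>simp add: num_roots_eq\<close>)
  moreover have "w = [:1, 1, 1 + of_nat 0:]"
    by (rule w) (use infinitely_many_primes_without_cube_roots_2[OF M0] in \<open>simp only: num_roots_eq\<close>)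
  ultimately show False by simp
qed

end

theorem theorem4p6:
  fixes zmul :: "int \<Rightarrow> 'a::ab_group_add \<Rightarrow> 'a"
    and br :: "'a \<Rightarrow> 'a \<Rightarrow> 'a"
    and x y :: "nat \<Rightarrow> 'a"
  assumes L: "L_np8 zmul br x y"
  shows "(\<forall>p s. prime p \<and> p \<ge> 3 \<longrightarrow>
            (let q = (of_nat p :: complex);
                 t = q powr (- s);
                 N = (of_nat (num_roots p) :: complex);
                 b = (of_nat (gauss_binomial p 3 1) :: complex)
             in ideal_zeta zmul br 8 p s =
                  zeta_Fp_power p 5 s + q ^ 3 * N * t ^ 3 + q ^ 2 * b * N * t ^ 4
                  + (q + q ^ 2 * (1 + N) + q ^ 3 * (1 + N)) * t ^ 5
                  + (1 + q + q ^ 2 * (1 + N)) * t ^ 6 + b * t ^ 7 + t ^ 8))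
       \<and> (\<forall>p. prime p \<and> p \<ge> 3 \<longrightarrow>
            ([p = 1] (mod 3) \<and> (\<exists>a b :: int. int p = a ^ 2 + 27 * b ^ 2) \<longrightarrow> num_roots p = 3)
          \<and> ([p = 1] (mod 3) \<and> \<not> (\<exists>a b :: int. int p = a ^ 2 + 27 * b ^ 2) \<longrightarrow> num_roots p = 0)
          \<and> ([p = 2] (mod 3) \<longrightarrow> num_roots p = 1))
       \<and> \<not> PORC (ideal_zeta zmul br 8)"
proof (intro conjI allI impI)
  interpret L_np8 zmul br x y by (rule L)
  show "let q = (of_nat p :: complex);
                 t = q powr (- s);
                 N = (of_nat (num_roots p) :: complex);
                 b = (of_nat (gauss_binomial p 3 1) :: complex)
             in ideal_zeta zmul br 8 p s =
                  zeta_Fp_power p 5 s + q ^ 3 * N * t ^ 3 + q ^ 2 * b * N * t ^ 4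
                  + (q + q ^ 2 * (1 + N) + q ^ 3 * (1 + N)) * t ^ 5
                  + (1 + q + q ^ 2 * (1 + N)) * t ^ 6 + b * t ^ 7 + t ^ 8"
    if "prime p \<and> p \<ge> 3" for p s
    by (rule ideal_zeta_formula) (use that in simp)
  show "num_roots p = 3" if "prime p \<and> p \<ge> 3" "[p = 1] (mod 3) \<and> (\<exists>a b :: int. int p = a ^ 2 + 27 * b ^ 2)" for p
    unfolding num_roots_eq using that card_cube_roots_2_one_mod_3[of p] by (simp only: if_True)
  show "num_roots p = 0" if "prime p \<and> p \<ge> 3" "[p = 1] (mod 3) \<and> \<not> (\<exists>a b :: int. int p = a ^ 2 + 27 * b ^ 2)" for p
    unfolding num_roots_eq using that card_cube_roots_2_one_mod_3[of p] by (simp only: if_False)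
  show "num_roots p = 1" if "prime p \<and> p \<ge> 3" "[p = 2] (mod 3)" for p
    unfolding num_roots_eq using that card_cube_roots_2_two_mod_3[of p] by blast
  show "\<not> PORC (ideal_zeta zmul br 8)" by (rule not_PORC)
qed

end
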